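(* Let $f_0$ be a meromorphic function of finite order $\rho$ such that: (M1) there exists a pole $b$ of $f_0$ with $b\notin\overline{\mathrm{Sing}(f_0^{-1})}$, of multiplicity $q$; (M2) there are constants $s_0>0$, $Q>0$ and $\alpha>-1-1/q$ such that $|f_0'(z)|\leq Q|z|^{\alpha}$ for $z\in f_0^{-1}(U_0)$, $|z|\to\infty$, where $U_0=B(b,s_0)$. Then there exist $\varepsilon,\delta>0$ such that if $(\lambda_n),(c_n)$ are sequences in $\mathbb{C}$ with $\lambda_n,\lambda_n^{-1}\in B(1,\delta)$ and $|c_n|<\varepsilon$ for each $n$, then $$\mathrm{HD}(\mathcal{J}_r(F_A))\geq\frac{\rho}{\alpha+1+1/q}.$$
   Context: $\mathrm{Sing}(f^{-1})$ is the set of finite critical and asymptotic values. Given $(\lambda_n),(c_n)$: $\hat f_n(z)=\lambda_nf_0(z)+c_n$, $F_A^n=\hat f_n\circ\dots\circ\hat f_1$. The Julia set $\mathcal{J}(F_A)$ is the complement in $\mathbb{C}$ of the set of points having a neighborhood on which all $F_A^n$ are defined and form a normal family. The radial Julia set $\mathcal{J}_r(F_A)$ is the set of $z\in\mathcal{J}(F_A)$ with all $F_A^n(z)$ defined and some $\delta>0$ such that for infinitely many $n$ the disk $B(F_A^n(z),\delta)$ can be pulled back univalently along the orbit of $z$. HD is Hausdorff dimension. *)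

theory Defs
  imports "HOL-Complex_Analysis.Complex_Analysis"
begin

text \<open>A meromorphic function on the plane: nicely meromorphic on UNIV
  (only singularities are poles; value 0 at poles, a harmless convention).\<close>
definition merom_plane :: "(complex \<Rightarrow> complex) \<Rightarrow> bool" where
  "merom_plane f \<longleftrightarrow> f nicely_meromorphic_on UNIV"

definition poles :: "(complex \<Rightarrow> complex) \<Rightarrow> complex set" where
  "poles f = {z. is_pole f z}"

definition critical_values :: "(complex \<Rightarrow> complex) \<Rightarrow> complex set" where
  "critical_values f = {f c | c. c \<notin> poles f \<and> deriv f c = 0}"

definition asymptotic_values :: "(complex \<Rightarrow> complex) \<Rightarrow> complex set" where
  "asymptotic_values f = {a. \<exists>\<gamma> :: real \<Rightarrow> complex.
      continuous_on {0..<1} \<gamma> \<and> (\<forall>t\<in>{0..<1}. \<gamma> t \<notin> poles f) \<and>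
      filterlim (\<lambda>t. norm (\<gamma> t)) at_top (at_left 1) \<and>
      ((\<lambda>t. f (\<gamma> t)) \<longlongrightarrow> a) (at_left 1)}"

definition sing_inv :: "(complex \<Rightarrow> complex) \<Rightarrow> complex set" where
  "sing_inv f = critical_values f \<union> asymptotic_values f"

definition pole_count :: "(complex \<Rightarrow> complex) \<Rightarrow> real \<Rightarrow> real" where
  "pole_count f t = (\<Sum>p\<in>{p. is_pole f p \<and> norm p \<le> t}. real (nat (- zorder f p)))"

definition counting_N :: "(complex \<Rightarrow> complex) \<Rightarrow> real \<Rightarrow> real" where
  "counting_N f r = integral {0..r} (\<lambda>t. (pole_count f t - pole_count f 0) / t)
                    + pole_count f 0 * ln r"

definition ln_plus :: "real \<Rightarrow> real" where
  "ln_plus x = max 0 (ln x)"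

definition proximity_m :: "(complex \<Rightarrow> complex) \<Rightarrow> real \<Rightarrow> real" where
  "proximity_m f r = integral {0..2*pi} (\<lambda>t. ln_plus (norm (f (of_real r * cis t)))) / (2*pi)"

definition nevanlinna_T :: "(complex \<Rightarrow> complex) \<Rightarrow> real \<Rightarrow> real" where
  "nevanlinna_T f r = proximity_m f r + counting_N f r"

definition merom_order :: "(complex \<Rightarrow> complex) \<Rightarrow> ereal" where
  "merom_order f = Limsup at_top (\<lambda>r. ereal (ln (nevanlinna_T f r) / ln r))"

text \<open>Sequences are indexed from 0: lam n, c n play the role of
  lambda_{n+1}, c_{n+1}.  nonaut f lam c n = F^n.\<close>
primrec nonaut :: "(complex \<Rightarrow> complex) \<Rightarrow> (nat \<Rightarrow> complex) \<Rightarrow> (nat \<Rightarrow> complex)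
                    \<Rightarrow> nat \<Rightarrow> complex \<Rightarrow> complex" where
  "nonaut f lam c 0 z = z"
| "nonaut f lam c (Suc n) z = lam n * f (nonaut f lam c n z) + c n"

definition iter_defined :: "(complex \<Rightarrow> complex) \<Rightarrow> (nat \<Rightarrow> complex) \<Rightarrow> (nat \<Rightarrow> complex)
                    \<Rightarrow> nat \<Rightarrow> complex \<Rightarrow> bool" where
  "iter_defined f lam c n z \<longleftrightarrow> (\<forall>k<n. nonaut f lam c k z \<notin> poles f)"

text \<open>Normal family (holomorphic functions; limits holomorphic or locally uniformly infinite).\<close>
definition normal_family :: "complex set \<Rightarrow> (nat \<Rightarrow> complex \<Rightarrow> complex) \<Rightarrow> bool" where
  "normal_family U F \<longleftrightarrow> (\<forall>ns :: nat \<Rightarrow> nat. \<exists>r. strict_mono r \<and>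
     ((\<exists>g. \<forall>K. compact K \<and> K \<subseteq> U \<longrightarrow> uniform_limit K (\<lambda>k. F (ns (r k))) g sequentially) \<or>
      (\<forall>K. compact K \<and> K \<subseteq> U \<longrightarrow>
         (\<forall>B. eventually (\<lambda>k. \<forall>z\<in>K. B \<le> norm (F (ns (r k)) z)) sequentially))))"

definition julia_set :: "(complex \<Rightarrow> complex) \<Rightarrow> (nat \<Rightarrow> complex) \<Rightarrow> (nat \<Rightarrow> complex) \<Rightarrow> complex set" where
  "julia_set f lam c = - {z. \<exists>U. open U \<and> z \<in> U \<and>
      (\<forall>n. \<forall>w\<in>U. iter_defined f lam c n w) \<and> normal_family U (nonaut f lam c)}"

definition radial_julia_set :: "(complex \<Rightarrow> complex) \<Rightarrow> (nat \<Rightarrow> complex) \<Rightarrow> (nat \<Rightarrow> complex) \<Rightarrow> complex set" where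
  "radial_julia_set f lam c = {z \<in> julia_set f lam c. (\<forall>n. iter_defined f lam c n z) \<and>
      (\<exists>\<delta>>0. infinite {n. \<exists>V. open V \<and> z \<in> V \<and> (\<forall>w\<in>V. iter_defined f lam c n w) \<and>
          inj_on (nonaut f lam c n) V \<and> nonaut f lam c n ` V = ball (nonaut f lam c n z) \<delta>})}"

definition hausdorff_pre :: "real \<Rightarrow> real \<Rightarrow> 'a::metric_space set \<Rightarrow> ennreal" where
  "hausdorff_pre s \<delta> A = (INF U \<in> {U :: nat \<Rightarrow> 'a set. (\<forall>i. bounded (U i) \<and> diameter (U i) \<le> \<delta>)
        \<and> A \<subseteq> (\<Union>i. U i)}. (\<Sum>i. ennreal (diameter (U i) powr s)))"

definition hausdorff_measure :: "real \<Rightarrow> 'a::metric_space set \<Rightarrow> ennreal" where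
  "hausdorff_measure s A = (SUP \<delta>\<in>{0<..}. hausdorff_pre s \<delta> A)"

definition hausdorff_dim :: "'a::metric_space set \<Rightarrow> ereal" where
  "hausdorff_dim A = Inf (ereal ` {s. s > 0 \<and> hausdorff_measure s A = 0})"

end

theory Submission
  imports Defs "HOL-Probability.Probability" "HOL-Real_Asymp.Real_Asymp"
begin

text \<open>
  A disk around \<open>b\<close> free of singular values lifts to univalent inverse branches \<open>\<phi>\<^sub>z\<close>, one for each
  preimage \<open>z\<close> of \<open>b\<close>. Following \<open>\<phi>\<^sub>z\<close> by an inverse branch of \<open>f\<^sub>0\<close> at the pole \<open>b\<close> gives, for large
  \<open>|z|\<close>, maps of the disk into itself whose derivative is at least a constant times \<open>|z| powr -\<tau>\<close>,
  where \<open>\<tau> = \<alpha> + 1 + 1/q\<close>; the perturbations by \<open>\<lambda>\<^sub>n\<close> and \<open>c\<^sub>n\<close> only change constants. The limit set of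
  the resulting nonautonomous iterated function system lies in the radial Julia set: each of its
  points is approximated by points that are mapped to the pole \<open>b\<close>. Its dimension is at least \<open>t\<close> as
  soon as finitely many \<open>z\<close> make the sum of \<open>|z| powr -(t * \<tau>)\<close> large. That such \<open>z\<close> exist for
  \<open>t * \<tau> < \<rho>\<close> follows from Jensen's formula: if few points were mapped near \<open>b\<close>, then averaging
  \<open>ln |f\<^sub>0 - w|\<close> over a small circle of values \<open>w\<close> around \<open>b\<close> would bound the Nevanlinna
  characteristic by a power of exponent less than \<open>\<rho>\<close>.
\<close>

section \<open>A lower bound for Hausdorff measure from a coding\<close>

text \<open>Two steps per map are forced: from near b one step leads to large modulus, and only the
  second returns to a fixed disk. The exponent \<tau> comes from the chain rule. Near b the function
  behaves like (z - b)^(-q), so its inverse has derivative of size |v|^(-1-1/q) at a large value v,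
  while a branch at z contributes 1/|f0'|, which is at least |z|^(-\<alpha>)/Q up to a constant.
  Since (M2) is one-sided, everything rests on lower bounds for derivatives: contraction comes from
  each map sending a disk into a much smaller one, and separation of images comes from the lower
  bounds. The constants must depend neither on z nor on n. This uniformity holds because b is a
  pole, so every inverse branch omits the value b, and univalent functions omitting a point satisfy
  a Harnack type comparison. What is lost on the way, even a factor 2 per map, is absorbed because
  the sum over the preimages can be made arbitrarily large as long as t * \<tau> stays strictly
  below \<rho>.\<close>

text \<open>Mass distribution principle for the Bernoulli measure with weights
  \<open>a i powr t / S\<close>. Keeping the measure on the code space, and enclosing sets of codes
  in cylinders from outside, avoids any measurability question about \<open>\<pi>\<close>.\<close>

lemma hausdorff_measure_coding_nonzero:
  fixes \<pi> :: "(nat \<Rightarrow> 'i) \<Rightarrow> 'a::metric_space" and a :: "'i \<Rightarrow> real"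
  assumes fin: "finite I" and a: "\<And>i. i \<in> I \<Longrightarrow> 0 < a i \<and> a i \<le> 1"
    and t: "t > 0" and \<kappa>: "\<kappa> > 0"
    and sum_ge: "(\<Sum>i\<in>I. a i powr t) \<ge> 2"
    and sep: "\<And>\<omega> \<omega>' n. \<lbrakk>range \<omega> \<subseteq> I; range \<omega>' \<subseteq> I; \<forall>k<n. \<omega> k = \<omega>' k; \<omega> n \<noteq> \<omega>' n\<rbrakk>
                \<Longrightarrow> \<kappa> * (\<Prod>k<n. a (\<omega> k)) \<le> dist (\<pi> \<omega>) (\<pi> \<omega>')"
    and A: "\<And>\<omega>. range \<omega> \<subseteq> I \<Longrightarrow> \<pi> \<omega> \<in> A"
  shows "hausdorff_measure t A \<noteq> 0"
proof -
  define S where "S = (\<Sum>i\<in>I. a i powr t)"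
  have S: "S \<ge> 2" using sum_ge by (simp add: S_def)
  define p where "p i = a i powr t / S" for i
  have p_pos: "0 \<le> p i" for i using S by (simp add: p_def)
  have p_le: "p i \<le> a i powr t" if "i \<in> I" for i
    using S a[OF that] by (simp add: p_def divide_le_eq mult_le_cancel_left1)
  \<comment> \<open>Here it matters that the sum is at least 2 and not just 1: weights of at most
    1/2 make every single code a null set.\<close>
  have p_half: "p i \<le> 1/2" if "i \<in> I" for i
  proof -
    have "a i powr t \<le> 1" using a[OF that] t powr_mono2[of t "a i" 1] by simp
    then show ?thesis using S by (simp add: p_def divide_le_eq)
  qed
  have p_sum: "(\<Sum>i\<in>I. p i) = 1"
    using S by (simp add: p_def S_def[symmetric] sum_divide_distrib[symmetric])
  define N where "N = point_measure I (\<lambda>i. ennreal (p i))"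
  have N_single: "emeasure N {i} = ennreal (p i)" if "i \<in> I" for i
    unfolding N_def using that fin by (subst emeasure_point_measure_finite) auto
  have "emeasure N (space N) = 1"
    unfolding N_def using fin p_sum p_pos
    by (simp add: emeasure_point_measure_finite space_point_measure sum_ennreal)
  then interpret N: prob_space N by (rule prob_spaceI)
  interpret P: product_prob_space "\<lambda>_::nat. N" UNIV
    by standard
  define M where "M = PiM (UNIV :: nat set) (\<lambda>_. N)"
  interpret M: prob_space M unfolding M_def by (rule P.prob_space_axioms)
  have spM: "space M = {\<omega>. range \<omega> \<subseteq> I}"
    unfolding M_def N_def by (auto simp: space_PiM space_point_measure PiE_def Pi_def)
  define cyl where "cyl \<omega> n = {x \<in> space M. \<forall>k\<in>{..<n}. x k \<in> {\<omega> k}}" for \<omega> :: "nat \<Rightarrow> 'i" and n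
  have cyl_emeasure: "emeasure M (cyl \<omega> n) = ennreal (\<Prod>k<n. p (\<omega> k))"
    if "range \<omega> \<subseteq> I" for \<omega> n
  proof -
    have "emeasure M (cyl \<omega> n) = (\<Prod>k<n. emeasure N {\<omega> k})"
      unfolding cyl_def M_def
      by (rule P.emeasure_PiM_Collect) (use that in \<open>auto simp: N_def sets_point_measure\<close>)
    also have "\<dots> = (\<Prod>k<n. ennreal (p (\<omega> k)))"
      by (intro prod.cong refl N_single) (use that in auto)
    finally show ?thesis by (simp add: prod_ennreal p_pos)
  qed
  have cyl_sets: "cyl \<omega> n \<in> sets M" if "range \<omega> \<subseteq> I" for \<omega> n
  proof -
    have "cyl \<omega> n = (\<Inter>k\<in>{..<n}. {x \<in> space M. x k \<in> {\<omega> k}}) \<inter> space M"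
      by (auto simp: cyl_def)
    moreover have "{x \<in> space M. x k \<in> {\<omega> k}} \<in> sets M" for k
    proof (rule measurable_sets_Collect[where N=N])
      show "(\<lambda>x. x k) \<in> M \<rightarrow>\<^sub>M N" unfolding M_def by measurable
      show "{x \<in> space N. x \<in> {\<omega> k}} \<in> sets N"
        by (auto simp: N_def sets_point_measure space_point_measure)
    qed
    ultimately show ?thesis by (cases "n = 0") auto
  qed
  have cover: "\<exists>C\<in>sets M. {\<omega>. range \<omega> \<subseteq> I \<and> \<pi> \<omega> \<in> U} \<subseteq> C \<and>
      emeasure M C \<le> ennreal ((diameter U / \<kappa>) powr t)" if U: "bounded U" for U
  proof -
    let ?E = "{\<omega>. range \<omega> \<subseteq> I \<and> \<pi> \<omega> \<in> U}"
    consider "?E = {}" | \<omega> where "?E = {\<omega>}" | \<omega> \<omega>' where "\<omega> \<in> ?E" "\<omega>' \<in> ?E" "\<omega> \<noteq> \<omega>'"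
      by blast
    then show ?thesis
    proof cases
      case 1 then show ?thesis by (intro bexI[of _ "{}"]) auto
    next
      case 2
      then have \<omega>: "range \<omega> \<subseteq> I" by auto
      \<comment> \<open>A set of diameter 0 may contain one coded point, so the enclosing set must
        have measure 0; the intersection of all cylinders around the code does.\<close>
      define C where "C = (\<Inter>n. cyl \<omega> n)"
      have Cs: "C \<in> sets M" unfolding C_def using cyl_sets[OF \<omega>] by auto
      have "emeasure M C \<le> ennreal ((1/2)^n)" for n
      proof -
        have "emeasure M C \<le> emeasure M (cyl \<omega> n)"
          by (intro emeasure_mono cyl_sets \<omega>) (auto simp: C_def)
        also have "\<dots> \<le> ennreal ((1/2)^n)"
          unfolding cyl_emeasure[OF \<omega>]
        proof (rule ennreal_leI)
          have "(\<Prod>k<n. p (\<omega> k)) \<le> (\<Prod>k<n. 1/2)"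
            by (intro prod_mono conjI p_pos p_half) (use \<omega> in auto)
          then show "(\<Prod>k<n. p (\<omega> k)) \<le> (1/2)^n" by simp
        qed
        finally show ?thesis .
      qed
      moreover have "(\<lambda>n. ennreal ((1/2)^n)) \<longlonglongrightarrow> ennreal 0"
        by (intro tendsto_ennrealI LIMSEQ_realpow_zero) auto
      ultimately have "emeasure M C \<le> ennreal 0"
        by (intro LIMSEQ_le_const) auto
      moreover have "?E \<subseteq> C"
        using 2 \<omega> by (auto simp: C_def cyl_def spM)
      ultimately show ?thesis using Cs by (intro bexI[of _ C]) auto
    next
      case 3
      \<comment> \<open>The least n at which two codes of the set disagree: before n all of them
        agree, so one cylinder of length n contains them all, and \<open>sep\<close> for a pair that
        disagrees at n bounds the mass of this cylinder by the diameter.\<close>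
      define Q where "Q n \<longleftrightarrow> (\<exists>x\<in>?E. \<exists>y\<in>?E. x n \<noteq> y n)" for n
      obtain j where "\<omega> j \<noteq> \<omega>' j" using 3 by (auto simp: fun_eq_iff)
      then have "\<exists>n. Q n" unfolding Q_def using 3(1,2) by (intro exI[of _ j] bexI[of _ \<omega>] bexI[of _ \<omega>']) auto
      define n where "n = (LEAST n. Q n)"
      have "Q n" unfolding n_def using \<open>\<exists>n. Q n\<close> by (rule LeastI_ex)
      then obtain x y where xy: "x \<in> ?E" "y \<in> ?E" "x n \<noteq> y n" unfolding Q_def by (elim bexE)
      have agree: "z k = x k" if "z \<in> ?E" "k < n" for z k
      proof (rule ccontr)
        assume "z k \<noteq> x k"
        then have "Q k" unfolding Q_def using that(1) xy(1) by (intro bexI[of _ z] bexI[of _ x]) auto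
        then show False using not_less_Least[of k Q] that(2) by (simp add: n_def)
      qed
      have x: "range x \<subseteq> I" using xy by auto
      have "?E \<subseteq> cyl x n" using agree by (auto simp: cyl_def spM)
      moreover have "emeasure M (cyl x n) \<le> ennreal ((diameter U / \<kappa>) powr t)"
        unfolding cyl_emeasure[OF x]
      proof (rule ennreal_leI)
        have apos: "0 < a (x k)" for k using a x by auto
        have "\<kappa> * (\<Prod>k<n. a (x k)) \<le> dist (\<pi> x) (\<pi> y)"
          by (rule sep) (use xy agree[of y] in auto)
        also have "\<dots> \<le> diameter U"
          using diameter_bounded_bound[OF U] xy by auto
        finally have le: "(\<Prod>k<n. a (x k)) \<le> diameter U / \<kappa>"
          using \<kappa> by (simp add: field_simps)
        have "(\<Prod>k<n. p (x k)) \<le> (\<Prod>k<n. a (x k) powr t)"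
          by (intro prod_mono conjI p_pos p_le) (use x in auto)
        also have "\<dots> = (\<Prod>k<n. a (x k)) powr t"
          using apos by (simp add: prod_powr_distrib less_imp_le)
        also have "\<dots> \<le> (diameter U / \<kappa>) powr t"
          by (intro powr_mono2 le) (use t apos in \<open>auto intro: prod_nonneg less_imp_le\<close>)
        finally show "(\<Prod>k<n. p (x k)) \<le> (diameter U / \<kappa>) powr t" .
      qed
      ultimately show ?thesis using cyl_sets[OF x] by (intro bexI[of _ "cyl x n"]) auto
    qed
  qed
  have "ennreal (\<kappa> powr t) \<le> hausdorff_pre t 1 A"
    unfolding hausdorff_pre_def
  proof (rule INF_greatest)
    fix U :: "nat \<Rightarrow> 'a set"
    assume "U \<in> {U. (\<forall>i. bounded (U i) \<and> diameter (U i) \<le> 1) \<and> A \<subseteq> (\<Union>i. U i)}"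
    then have U: "\<And>i. bounded (U i)" "A \<subseteq> (\<Union>i. U i)" by auto
    have "\<forall>i. \<exists>C. C \<in> sets M \<and> {\<omega>. range \<omega> \<subseteq> I \<and> \<pi> \<omega> \<in> U i} \<subseteq> C \<and>
        emeasure M C \<le> ennreal ((diameter (U i) / \<kappa>) powr t)"
      using cover[OF U(1)] by (intro allI) (simp only: Bex_def)
    from choice[OF this] obtain C where C': "\<forall>i. C i \<in> sets M \<and> {\<omega>. range \<omega> \<subseteq> I \<and> \<pi> \<omega> \<in> U i} \<subseteq> C i \<and>
        emeasure M (C i) \<le> ennreal ((diameter (U i) / \<kappa>) powr t)"
      by (elim exE)
    have C: "C i \<in> sets M" "{\<omega>. range \<omega> \<subseteq> I \<and> \<pi> \<omega> \<in> U i} \<subseteq> C i"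
      "emeasure M (C i) \<le> ennreal ((diameter (U i) / \<kappa>) powr t)" for i
      using C'[rule_format, of i] by auto
    have "space M \<subseteq> (\<Union>i. C i)"
    proof
      fix \<omega> assume "\<omega> \<in> space M"
      then have \<omega>: "range \<omega> \<subseteq> I" by (simp add: spM)
      obtain i where "\<pi> \<omega> \<in> U i" using A[OF \<omega>] U(2) by blast
      then show "\<omega> \<in> (\<Union>i. C i)" using C(2)[of i] \<omega> by blast
    qed
    then have "1 \<le> emeasure M (\<Union>i. C i)"
      using C(1) emeasure_mono[of "space M" "\<Union>i. C i" M] by (auto simp: M.emeasure_space_1)
    also have "\<dots> \<le> (\<Sum>i. emeasure M (C i))"
      by (rule emeasure_subadditive_countably) (use C in auto)
    also have "\<dots> \<le> (\<Sum>i. ennreal ((diameter (U i) / \<kappa>) powr t))"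
      by (intro suminf_le C summableI)
    finally have "ennreal (\<kappa> powr t) * 1 \<le> ennreal (\<kappa> powr t) * (\<Sum>i. ennreal ((diameter (U i) / \<kappa>) powr t))"
      by (rule mult_left_mono) simp
    also have "\<dots> = (\<Sum>i. ennreal (\<kappa> powr t) * ennreal ((diameter (U i) / \<kappa>) powr t))"
      by simp
    also have "\<dots> = (\<Sum>i. ennreal (diameter (U i) powr t))"
    proof (intro suminf_cong)
      fix i
      have "\<kappa> powr t * (diameter (U i) / \<kappa>) powr t = diameter (U i) powr t"
        using \<kappa> diameter_ge_0[OF U(1)[of i]]
        by (simp add: powr_divide)
      then show "ennreal (\<kappa> powr t) * ennreal ((diameter (U i) / \<kappa>) powr t) = ennreal (diameter (U i) powr t)"
        by (simp add: ennreal_mult[symmetric])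
    qed
    finally show "ennreal (\<kappa> powr t) \<le> (\<Sum>i. ennreal (diameter (U i) powr t))" by simp
  qed
  also have "\<dots> \<le> hausdorff_measure t A"
    unfolding hausdorff_measure_def by (rule SUP_upper) auto
  finally show ?thesis using \<kappa> by (auto simp: ennreal_zero_less_mult_iff)
qed

section \<open>Inverse branches\<close>

lemma analytic_at_not_pole:
  assumes "merom_plane f" "z \<notin> poles f"
  shows "f analytic_on {z}"
  using assms nicely_meromorphic_on_imp_analytic_at[of f UNIV z]
  by (auto simp: merom_plane_def poles_def)

lemma holomorphic_on_compl_poles:
  assumes "merom_plane f"
  shows "f holomorphic_on - poles f"
proof -
  have "f analytic_on - poles f"
    using analytic_at_not_pole[OF assms] analytic_on_analytic_at by blast
  then show ?thesis by (rule analytic_imp_holomorphic)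
qed

lemma open_compl_poles:
  assumes "merom_plane f"
  shows "open (- poles f)"
  unfolding open_contains_ball
proof
  fix z assume "z \<in> - poles f"
  then have "f analytic_on {z}" using analytic_at_not_pole[OF assms] by auto
  then obtain e where e: "e > 0" "f holomorphic_on ball z e"
    by (auto simp: analytic_on_def)
  have "ball z e \<subseteq> - poles f"
    using not_is_pole_holomorphic[OF open_ball _ e(2)] by (auto simp: poles_def)
  then show "\<exists>e>0. ball z e \<subseteq> - poles f" using e by blast
qed

lemma finite_poles_cball:
  assumes "merom_plane f"
  shows "finite {p. is_pole f p \<and> norm p \<le> r}"
proof -
  have "f meromorphic_on UNIV" using assms by (simp add: merom_plane_def nicely_meromorphic_on_def)
  from meromorphic_on_imp_not_pole_cosparse[OF this]
  have "{p. is_pole f p} sparse_in UNIV" by (simp add: eventually_cosparse)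
  then have "{p. is_pole f p} sparse_in cball 0 r" by (rule sparse_in_subset) auto
  from sparse_in_compact_finite[OF this] have "finite (cball 0 r \<inter> {p. is_pole f p})" by simp
  then show ?thesis by (rule finite_subset[rotated]) auto
qed

text \<open>Poles are excluded explicitly because f has the value 0 there, so
  \<open>f (\<phi> w) = w\<close> alone could hold at w = 0 with \<open>\<phi> w\<close> a
  pole.\<close>

definition inverse_branch :: "(complex \<Rightarrow> complex) \<Rightarrow> complex set \<Rightarrow> (complex \<Rightarrow> complex) \<Rightarrow> bool" where
  "inverse_branch f D \<phi> \<longleftrightarrow> \<phi> holomorphic_on D \<and> (\<forall>w\<in>D. \<phi> w \<notin> poles f \<and> f (\<phi> w) = w)"

lemma inverse_branch_subset:
  "inverse_branch f D \<phi> \<Longrightarrow> E \<subseteq> D \<Longrightarrow> inverse_branch f E \<phi>"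
  unfolding inverse_branch_def by (blast intro: holomorphic_on_subset)

lemma inverse_branch_inj: "inverse_branch f D \<phi> \<Longrightarrow> inj_on \<phi> D"
  unfolding inverse_branch_def inj_on_def by metis

lemma inverse_branch_deriv:
  assumes f: "merom_plane f" and \<phi>: "inverse_branch f D \<phi>" and D: "open D" "w \<in> D"
  shows "deriv f (\<phi> w) * deriv \<phi> w = 1"
proof -
  have 1: "(\<phi> has_field_derivative deriv \<phi> w) (at w)"
    using \<phi> D by (auto simp: inverse_branch_def intro: holomorphic_derivI)
  have 2: "(f has_field_derivative deriv f (\<phi> w)) (at (\<phi> w))"
    using \<phi> D holomorphic_on_compl_poles[OF f] open_compl_poles[OF f]
    by (auto simp: inverse_branch_def intro: holomorphic_derivI)
  have "((\<lambda>w. f (\<phi> w)) has_field_derivative deriv f (\<phi> w) * deriv \<phi> w) (at w)"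
    using DERIV_chain2[OF 2 1] .
  moreover have "((\<lambda>w. f (\<phi> w)) has_field_derivative 1) (at w)"
    by (rule has_field_derivative_transform_within_open[OF DERIV_ident D(1,2)])
      (use \<phi> in \<open>auto simp: inverse_branch_def\<close>)
  ultimately show ?thesis by (rule DERIV_unique)
qed

text \<open>The last clause says that every point near z is recovered from its value. It is what
  identifies other branches with \<psi> later on.\<close>

lemma local_inverse_branch:
  assumes f: "merom_plane f" and z: "z \<notin> poles f" and d: "deriv f z \<noteq> 0"
  obtains \<psi> e r where "e > 0" "r > 0" "inverse_branch f (ball (f z) e) \<psi>" "\<psi> (f z) = z"
    "\<And>z'. z' \<in> ball z r \<Longrightarrow> \<psi> (f z') = z'"
proof -
  obtain r where r: "r > 0" "ball z r \<subseteq> - poles f" "open (f ` ball z r)" "inj_on f (ball z r)"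
    using has_complex_derivative_locally_invertible[OF holomorphic_on_compl_poles[OF f] _ open_compl_poles[OF f] d] z
    by auto
  have "f holomorphic_on ball z r" using holomorphic_on_compl_poles[OF f] r(2) by (rule holomorphic_on_subset)
  from holomorphic_has_inverse[OF this open_ball r(4)]
  obtain \<psi> where \<psi>: "\<psi> holomorphic_on f ` ball z r" "\<And>z'. z' \<in> ball z r \<Longrightarrow> \<psi> (f z') = z'" by blast
  obtain e where e: "e > 0" "ball (f z) e \<subseteq> f ` ball z r"
    using r(1,3) open_contains_ball by (metis centre_in_ball imageI)
  have "inverse_branch f (ball (f z) e) \<psi>"
    unfolding inverse_branch_def
  proof (intro conjI ballI)
    show "\<psi> holomorphic_on ball (f z) e" using \<psi>(1) e(2) by (rule holomorphic_on_subset)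
    fix w assume "w \<in> ball (f z) e"
    then obtain z' where "z' \<in> ball z r" "w = f z'" using e by blast
    then show "\<psi> w \<notin> poles f" "f (\<psi> w) = w" using \<psi>(2) r(2) by auto
  qed
  moreover have "\<psi> (f z) = z" using \<psi>(2)[of z] r by simp
  ultimately show ?thesis using that[OF e(1) r(1)] \<psi>(2) by blast
qed

text \<open>Near \<open>w0\<close> both branches stay in a disk on which f is injective, so both
  equal the local inverse there; the identity theorem extends the equality to the connected set
  D.\<close>

lemma inverse_branch_unique:
  assumes f: "merom_plane f" and D: "open D" "connected D" "w0 \<in> D"
    and \<phi>: "inverse_branch f D \<phi>" and \<psi>: "inverse_branch f D \<psi>" and eq: "\<phi> w0 = \<psi> w0"
    and w: "w \<in> D"
  shows "\<phi> w = \<psi> w"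
proof -
  let ?z = "\<phi> w0"
  have z: "?z \<notin> poles f" "f ?z = w0" using \<phi> D by (auto simp: inverse_branch_def)
  have "deriv f ?z \<noteq> 0" using inverse_branch_deriv[OF f \<phi> D(1,3)] by auto
  from local_inverse_branch[OF f z(1) this] obtain \<xi> r where r: "r > 0"
    "\<And>z'. z' \<in> ball ?z r \<Longrightarrow> \<xi> (f z') = z'" by metis
  have c: "isCont \<phi> w0" "isCont \<psi> w0"
    using \<phi> \<psi> D by (auto simp: inverse_branch_def intro: holomorphic_on_imp_continuous_on 
        continuous_on_interior simp: interior_open)
  have "eventually (\<lambda>w. \<phi> w \<in> ball ?z r) (nhds w0)" "eventually (\<lambda>w. \<psi> w \<in> ball ?z r) (nhds w0)"
    using c r(1) eq unfolding isCont_def tendsto_at_iff_tendsto_nhds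
    by (auto dest!: tendstoD[of _ _ _ r] simp: dist_commute)
  moreover have "eventually (\<lambda>w. w \<in> D) (nhds w0)" using D by (simp add: eventually_nhds_in_open)
  ultimately have "eventually (\<lambda>w. w \<in> D \<and> \<phi> w \<in> ball ?z r \<and> \<psi> w \<in> ball ?z r) (nhds w0)"
    by (simp add: eventually_conj_iff)
  then obtain U where U: "open U" "w0 \<in> U" "\<And>w. w \<in> U \<Longrightarrow> w \<in> D \<and> \<phi> w \<in> ball ?z r \<and> \<psi> w \<in> ball ?z r"
    by (auto simp: eventually_nhds)
  have "\<phi> u = \<psi> u" if "u \<in> U" for u
  proof -
    have "\<phi> u = \<xi> (f (\<phi> u))" "\<psi> u = \<xi> (f (\<psi> u))" using r(2) U(3)[OF that] by auto
    then show ?thesis using \<phi> \<psi> U(3)[OF that] by (auto simp: inverse_branch_def)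
  qed
  note * = this
  show ?thesis
    by (rule analytic_continuation_open[of U D \<phi> \<psi>])
      (use * U D \<phi> \<psi> w in \<open>auto simp: inverse_branch_def\<close>)
qed

text \<open>If the limit a is not an asymptotic value, the curve cannot tend to infinity, so it
  returns to a bounded disk at times tending to 1. An accumulation point z of these returns is not a
  pole, because f stays bounded along them, and continuity gives f z = a.\<close>

lemma asymptotic_limit_point:
  assumes f: "merom_plane f" and \<gamma>: "continuous_on {0..<1} \<gamma>" "\<And>t. t \<in> {0..<1} \<Longrightarrow> \<gamma> t \<notin> poles f"
    and lim: "((\<lambda>t. f (\<gamma> t)) \<longlongrightarrow> a) (at_left (1::real))" and a: "a \<notin> asymptotic_values f"
  obtains z s where "z \<notin> poles f" "f z = a" "\<And>k::nat. s k \<in> {0..<1}" "s \<longlonglongrightarrow> 1" "(\<lambda>k. \<gamma> (s k)) \<longlonglongrightarrow> z"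
proof -
  have "\<not> filterlim (\<lambda>t. norm (\<gamma> t)) at_top (at_left 1)"
    using a \<gamma> lim unfolding asymptotic_values_def by blast
  then obtain M where M: "\<not> eventually (\<lambda>t. M \<le> norm (\<gamma> t)) (at_left 1)"
    by (auto simp: filterlim_at_top)
  have "\<exists>s. s \<in> {0..<1} \<and> 1 - 1 / real (Suc k) < s \<and> norm (\<gamma> s) < M" for k
  proof (rule ccontr)
    assume *: "\<not> ?thesis"
    have "eventually (\<lambda>t::real. t \<in> {0<..<1}) (at_left 1)"
      by (rule eventually_at_leftI[of 0]) auto
    moreover have "eventually (\<lambda>t::real. t \<in> {1 - 1 / real (Suc k)<..<1}) (at_left 1)"
      by (rule eventually_at_leftI[of "1 - 1 / real (Suc k)"]) auto
    ultimately have "eventually (\<lambda>t::real. t \<in> {0<..<1} \<and> t \<in> {1 - 1 / real (Suc k)<..<1}) (at_left 1)"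
      by (rule eventually_conj)
    then have "eventually (\<lambda>t. M \<le> norm (\<gamma> t)) (at_left 1)"
    proof (rule eventually_mono)
      fix s assume "s \<in> {0<..<1} \<and> s \<in> {1 - 1 / real (Suc k)<..<1}"
      then have "s \<in> {0..<1}" "1 - 1 / real (Suc k) < s" by auto
      then show "M \<le> norm (\<gamma> s)" using * by (meson not_less)
    qed
    then show False using M by simp
  qed
  then obtain s where s: "\<And>k. s k \<in> {0..<1}" "\<And>k. 1 - 1 / real (Suc k) < s k" "\<And>k. norm (\<gamma> (s k)) < M"
    by metis
  have s1: "s \<longlonglongrightarrow> 1"
  proof (rule tendsto_sandwich)
    show "(\<lambda>k. 1 - 1 / real (Suc k)) \<longlonglongrightarrow> 1"
      using tendsto_diff[OF tendsto_const[of 1] LIMSEQ_Suc[OF lim_1_over_n]] by simp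
    show "(\<lambda>k. 1::real) \<longlonglongrightarrow> 1" by simp
    show "\<forall>\<^sub>F n in sequentially. 1 - 1 / real (Suc n) \<le> s n" using s(2) by (simp add: less_imp_le)
    show "\<forall>\<^sub>F n in sequentially. s n \<le> 1" using s(1) by (simp add: less_imp_le)
  qed
  have "\<forall>k. \<gamma> (s k) \<in> cball 0 M" using s(3) by (auto simp: less_imp_le)
  then obtain z r where z: "strict_mono r" "((\<lambda>k. \<gamma> (s k)) \<circ> r) \<longlonglongrightarrow> z"
    using compact_cball[of "0::complex" M] unfolding compact_def by metis
  define s' where "s' = s \<circ> r"
  have s': "\<And>k. s' k \<in> {0..<1}" "s' \<longlonglongrightarrow> 1" "(\<lambda>k. \<gamma> (s' k)) \<longlonglongrightarrow> z"
    using s z LIMSEQ_subseq_LIMSEQ[OF s1 z(1)] by (auto simp: s'_def o_def)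
  have "filterlim s' (at_left 1) sequentially"
    using s' by (auto simp: filterlim_at less_le intro!: always_eventually)
  then have fl: "(\<lambda>k. f (\<gamma> (s' k))) \<longlonglongrightarrow> a"
    using filterlim_compose[OF lim] by blast
  have np: "z \<notin> poles f"
  proof
    assume pz: "z \<in> poles f"
    \<comment> \<open>The curve avoids poles, so the sequence never equals z and the punctured limit
      in \<open>is_pole\<close> applies.\<close>
    have "filterlim (\<lambda>k. \<gamma> (s' k)) (at z) sequentially"
      using s' \<gamma>(2) pz by (auto simp: filterlim_at intro!: always_eventually)
    then have "filterlim (\<lambda>k. f (\<gamma> (s' k))) at_infinity sequentially"
      using pz unfolding poles_def is_pole_def by (auto intro: filterlim_compose)
    then show False using fl not_tendsto_and_filterlim_at_infinity sequentially_bot by blast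
  qed
  have "isCont f z" using analytic_at_not_pole[OF f np] by (rule analytic_at_imp_isCont)
  then have "(\<lambda>k. f (\<gamma> (s' k))) \<longlonglongrightarrow> f z" using s'(3) by (rule isCont_tendsto_compose)
  then have "f z = a" using fl LIMSEQ_unique by blast
  then show ?thesis using that np s' by blast
qed

text \<open>Monodromy on a convex set. All branches on convex open subsets containing
  \<open>w0\<close> are glued; convexity keeps intersections connected, so they agree. If the union
  missed a point, the lift along the segment towards it would accumulate at a point with value in D,
  by absence of asymptotic values, and that point would not be critical. A local inverse there
  extends the branch past the alleged end.\<close>

lemma inverse_branch_exists:
  assumes f: "merom_plane f" and D: "open D" "convex D" "D \<inter> sing_inv f = {}"
    and w0: "w0 \<in> D" and z0: "z0 \<notin> poles f" "f z0 = w0"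
  obtains \<phi> where "inverse_branch f D \<phi>" "\<phi> w0 = z0"
proof -
  define \<C> where "\<C> = {(S,\<phi>). open S \<and> convex S \<and> w0 \<in> S \<and> S \<subseteq> D \<and> inverse_branch f S \<phi> \<and> \<phi> w0 = z0}"
  have agree: "\<phi> w = \<psi> w" if "(S,\<phi>) \<in> \<C>" "(T,\<psi>) \<in> \<C>" "w \<in> S" "w \<in> T" for S T \<phi> \<psi> w
  proof (rule inverse_branch_unique[OF f, of "S \<inter> T" w0 \<phi> \<psi> w])
    show "open (S \<inter> T)" "connected (S \<inter> T)" "w0 \<in> S \<inter> T" "w \<in> S \<inter> T"
      using that by (auto simp: \<C>_def intro: convex_connected convex_Int)
    show "inverse_branch f (S \<inter> T) \<phi>" "inverse_branch f (S \<inter> T) \<psi>"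
      using that by (auto simp: \<C>_def intro: inverse_branch_subset)
  qed (use that in \<open>auto simp: \<C>_def\<close>)
  define \<Omega> where "\<Omega> = \<Union>(fst ` \<C>)"
  define \<Phi> where "\<Phi> w = (snd (SOME p. p \<in> \<C> \<and> w \<in> fst p)) w" for w
  have \<Phi>_eq: "\<Phi> w = \<phi> w" if "(S,\<phi>) \<in> \<C>" "w \<in> S" for S \<phi> w
  proof -
    let ?p = "SOME p. p \<in> \<C> \<and> w \<in> fst p"
    have "?p \<in> \<C> \<and> w \<in> fst ?p" by (rule someI[of _ "(S,\<phi>)"]) (use that in auto)
    then show ?thesis unfolding \<Phi>_def
      using agree[of "fst ?p" "snd ?p" S \<phi> w] that by auto
  qed
  have \<Omega>_mem: "\<exists>S \<phi>. (S,\<phi>) \<in> \<C> \<and> w \<in> S" if "w \<in> \<Omega>" for w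
    using that by (auto simp: \<Omega>_def)
  have \<Omega>I: "w \<in> \<Omega>" if "(S,\<phi>) \<in> \<C>" "w \<in> S" for S \<phi> w
    using that by (force simp: \<Omega>_def)
  have open\<Omega>: "open \<Omega>" unfolding \<Omega>_def by (rule open_Union) (auto simp: \<C>_def)
  have hol: "\<Phi> holomorphic_on \<Omega>"
    unfolding holomorphic_on_def
  proof
    fix w assume "w \<in> \<Omega>"
    then obtain S \<phi> where S: "(S,\<phi>) \<in> \<C>" "w \<in> S" using \<Omega>_mem by blast
    then have "\<phi> field_differentiable (at w)"
      by (auto simp: \<C>_def inverse_branch_def intro: holomorphic_on_imp_differentiable_at)
    then have "\<Phi> field_differentiable (at w)"
      unfolding field_differentiable_def
      using S \<Phi>_eq[OF S(1)] has_field_derivative_transform_within_open[of \<phi> _ w S \<Phi>]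
      by (auto simp: \<C>_def)
    then show "\<Phi> field_differentiable (at w within \<Omega>)"
      by (rule field_differentiable_at_within)
  qed
  have br: "inverse_branch f \<Omega> \<Phi>"
    unfolding inverse_branch_def
  proof (intro conjI hol ballI)
    fix w assume "w \<in> \<Omega>"
    then obtain S \<phi> where S: "(S,\<phi>) \<in> \<C>" "w \<in> S" using \<Omega>_mem by blast
    then show "\<Phi> w \<notin> poles f" "f (\<Phi> w) = w" using \<Phi>_eq[OF S] by (auto simp: \<C>_def inverse_branch_def)
  qed
  have crit: "deriv f z \<noteq> 0" if "z \<notin> poles f" "f z \<in> D" for z
    using that D(3) by (auto simp: sing_inv_def critical_values_def)
  have w0\<Omega>: "w0 \<in> \<Omega>"
  proof -
    obtain \<psi> e where e: "e > 0" "inverse_branch f (ball w0 e) \<psi>" "\<psi> w0 = z0"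
      using local_inverse_branch[OF f z0(1)] crit[OF z0(1)] z0(2) w0 by metis
    have "(ball w0 e \<inter> D, \<psi>) \<in> \<C>"
      using e w0 D by (auto simp: \<C>_def intro: convex_Int inverse_branch_subset)
    then show ?thesis by (rule \<Omega>I) (use e w0 in auto)
  qed
  have "\<zeta> \<in> \<Omega>" if \<zeta>: "\<zeta> \<in> D" for \<zeta>
  proof (rule ccontr)
    assume n: "\<zeta> \<notin> \<Omega>"
    define W where "W t = w0 + of_real t * (\<zeta> - w0)" for t :: real
    have W_cont: "continuous_on A W" for A unfolding W_def by (intro continuous_intros)
    have W01: "W 0 = w0" "W 1 = \<zeta>" by (auto simp: W_def)
    have W_seg: "W t = (1 - t) *\<^sub>R w0 + t *\<^sub>R \<zeta>" for t
      by (simp add: W_def scaleR_conv_of_real algebra_simps)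
    have W_D: "W t \<in> D" if "0 \<le> t" "t \<le> 1" for t
      unfolding W_seg using D(2) w0 \<zeta> that by (intro convexD) auto
    \<comment> \<open>The least element T of A is the first parameter at which the segment leaves
      \<Omega>.\<close>
    define A where "A = {0..1} \<inter> W -` (- \<Omega>)"
    have "closed A" unfolding A_def
      by (rule continuous_closed_preimage[OF W_cont]) (use open\<Omega> in auto)
    then have "compact A" unfolding A_def
      by (metis Int_absorb1 Int_lower1 compact_Icc compact_Int_closed A_def)
    moreover have "1 \<in> A" using n W01 by (auto simp: A_def)
    ultimately obtain T where T: "T \<in> A" "\<And>t. t \<in> A \<Longrightarrow> T \<le> t"
      using compact_attains_inf[of A] by blast
    have T0: "0 < T" "T \<le> 1" using T(1) w0\<Omega> W01 unfolding A_def by (auto simp: less_le)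
    have before: "W t \<in> \<Omega>" if "0 \<le> t" "t < T" for t
      using T(2)[of t] that T0 by (auto simp: A_def)
    define \<gamma> where "\<gamma> s = \<Phi> (W (T * s))" for s
    have Ts: "W (T * s) \<in> \<Omega>" if "s \<in> {0..<1}" for s
      using that T0 by (intro before) auto
    have \<gamma>_cont: "continuous_on {0..<1} \<gamma>"
      unfolding \<gamma>_def
      by (rule continuous_on_compose2[OF holomorphic_on_imp_continuous_on[OF hol]])
         (use Ts in \<open>auto simp: W_def intro!: continuous_intros\<close>)
    have \<gamma>_p: "\<gamma> s \<notin> poles f" "f (\<gamma> s) = W (T * s)" if "s \<in> {0..<1}" for s
      using Ts[OF that] br by (auto simp: \<gamma>_def inverse_branch_def)
    have "((\<lambda>s. W (T * s)) \<longlongrightarrow> W (T * 1)) (at_left 1)"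
      unfolding W_def by (intro tendsto_intros)
    moreover have "eventually (\<lambda>s. W (T * s) = f (\<gamma> s)) (at_left 1)"
      by (rule eventually_at_leftI[of 0]) (use \<gamma>_p in auto)
    ultimately have lim: "((\<lambda>s. f (\<gamma> s)) \<longlongrightarrow> W T) (at_left 1)"
      using tendsto_cong by fastforce
    have WT: "W T \<in> D" using W_D T0 by auto
    then have "W T \<notin> asymptotic_values f" using D(3) by (auto simp: sing_inv_def)
    from asymptotic_limit_point[OF f \<gamma>_cont \<gamma>_p(1) lim this]
    obtain z s where z: "z \<notin> poles f" "f z = W T" and s: "\<And>k::nat. s k \<in> {0..<1}" "s \<longlonglongrightarrow> 1" "(\<lambda>k. \<gamma> (s k)) \<longlonglongrightarrow> z"
      by blast
    obtain \<psi> e r where \<psi>: "e > 0" "r > 0" "inverse_branch f (ball (W T) e) \<psi>"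
      "\<And>z'. z' \<in> ball z r \<Longrightarrow> \<psi> (f z') = z'"
      using local_inverse_branch[OF f z(1)] crit[OF z(1)] z(2) WT by metis
    have "(\<lambda>k. W (T * s k)) \<longlonglongrightarrow> W (T * 1)" unfolding W_def by (intro tendsto_intros s)
    then have "eventually (\<lambda>k. W (T * s k) \<in> ball (W T) e) sequentially"
      using \<psi>(1) by (auto dest!: tendstoD[of _ _ _ e] simp: dist_commute)
    moreover have "eventually (\<lambda>k. \<gamma> (s k) \<in> ball z r) sequentially"
      using s(3) \<psi>(2) by (auto dest!: tendstoD[of _ _ _ r] simp: dist_commute)
    ultimately have "eventually (\<lambda>k. W (T * s k) \<in> ball (W T) e \<and> \<gamma> (s k) \<in> ball z r) sequentially"
      by (rule eventually_conj)
    \<comment> \<open>One index suffices: at \<open>W (T * s k)\<close> the new local branch \<psi>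
      takes the value of \<Phi>, and uniqueness spreads the agreement over the connected set S
      \<inter> B.\<close>
    then obtain k where k: "W (T * s k) \<in> ball (W T) e" "\<gamma> (s k) \<in> ball z r"
      by (auto simp: eventually_sequentially)
    let ?w = "W (T * s k)"
    have \<psi>w: "\<psi> ?w = \<Phi> ?w"
      using \<psi>(4)[OF k(2)] \<gamma>_p[OF s(1)[of k]] by (simp add: \<gamma>_def)
    obtain S \<phi> where S: "(S,\<phi>) \<in> \<C>" "?w \<in> S" using \<Omega>_mem[OF Ts[OF s(1)]] by blast
    define B where "B = ball (W T) e \<inter> D"
    have B: "open B" "convex B" "W T \<in> B" "?w \<in> B" "B \<subseteq> D" "inverse_branch f B \<psi>"
      using D \<psi> WT k T0 s(1)[of k]
      by (auto simp: B_def intro!: convex_Int W_D mult_le_one intro: inverse_branch_subset)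
    have S': "open S" "convex S" "w0 \<in> S" "S \<subseteq> D" "inverse_branch f S \<phi>" "\<phi> w0 = z0"
      using S by (auto simp: \<C>_def)
    have ag: "\<phi> x = \<psi> x" if "x \<in> S" "x \<in> B" for x
    proof (rule inverse_branch_unique[OF f, of "S \<inter> B" ?w \<phi> \<psi> x])
      show "connected (S \<inter> B)" using S' B by (intro convex_connected convex_Int)
      show "inverse_branch f (S \<inter> B) \<phi>" "inverse_branch f (S \<inter> B) \<psi>"
        using S' B by (auto intro: inverse_branch_subset)
    qed (use S S' B that \<psi>w \<Phi>_eq[OF S] in auto)
    define \<xi> where "\<xi> = (\<lambda>x. if x \<in> S then \<phi> x else \<psi> x)"
    have "\<xi> holomorphic_on S \<union> B"
      unfolding \<xi>_def using S' B ag
      by (intro holomorphic_on_If_Un) (auto simp: inverse_branch_def)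
    then have \<xi>: "inverse_branch f (S \<union> B) \<xi>"
      using S' B by (auto simp: inverse_branch_def \<xi>_def)
    let ?seg = "closed_segment w0 (W T)"
    have "?seg \<subseteq> S \<union> B"
    proof
      fix x assume "x \<in> ?seg"
      then obtain u where u: "0 \<le> u" "u \<le> 1" "x = (1 - u) *\<^sub>R w0 + u *\<^sub>R W T"
        by (auto simp: in_segment)
      then have x: "x = W (T * u)" by (simp add: W_def scaleR_conv_of_real algebra_simps)
      show "x \<in> S \<union> B"
      proof (cases "u \<le> s k")
        case True
        then have "x \<in> closed_segment w0 ?w"
          using s(1)[of k] u x
          by (auto simp: in_segment W_def scaleR_conv_of_real algebra_simps
              intro!: exI[of _ "if s k = 0 then 0 else u / s k"])
        then show ?thesis using closed_segment_subset[OF S'(3) S(2) S'(2)] by auto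
      next
        case False
        define v where "v = (u - s k) / (1 - s k)"
        have "v * (1 - s k) = u - s k" using s(1)[of k] by (simp add: v_def)
        then have v: "u = (1 - v) * s k + v" by (simp add: algebra_simps)
        have v01: "0 \<le> v" "v \<le> 1"
          using s(1)[of k] u False by (auto simp: v_def divide_le_eq)
        have "x = (1 - v) *\<^sub>R ?w + v *\<^sub>R W T"
          unfolding x v by (simp add: W_def scaleR_conv_of_real algebra_simps)
        then have "x \<in> closed_segment ?w (W T)"
          using v01 by (auto simp: in_segment)
        then show ?thesis using closed_segment_subset[OF B(4,3,2)] by auto
      qed
    qed
    then obtain \<epsilon> where \<epsilon>: "\<epsilon> > 0" "(\<Union>x\<in>?seg. ball x \<epsilon>) \<subseteq> S \<union> B"
      using compact_subset_open_imp_ball_epsilon_subset[of ?seg "S \<union> B"] S' B by auto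
    \<comment> \<open>The union S \<union> B need not be convex. A thin neighbourhood of the segment
      is: it is the Minkowski sum of a segment and a disk, so it qualifies as a member of
      \<open>\<C>\<close>.\<close>
    define N where "N = (\<Union>x\<in>?seg. \<Union>y\<in>ball 0 \<epsilon>. {x + y})"
    have N_eq: "N = (\<Union>x\<in>?seg. ball x \<epsilon>)"
    proof -
      have "(\<Union>y\<in>ball 0 \<epsilon>. {x + y}) = ball x \<epsilon>" for x :: complex
      proof -
        have "(\<Union>y\<in>ball 0 \<epsilon>. {x + y}) = (+) x ` ball 0 \<epsilon>"
          by (rule UNION_singleton_eq_range)
        then show ?thesis by simp
      qed
      then show ?thesis by (simp add: N_def)
    qed
    have "convex N" unfolding N_def by (intro convex_sums) auto
    moreover have "open N" unfolding N_eq by auto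
    moreover have "w0 \<in> N" unfolding N_eq using \<epsilon>(1) by (intro UN_I[of w0]) auto
    moreover have "W T \<in> N" unfolding N_eq using \<epsilon>(1) by (intro UN_I[of "W T"]) auto
    moreover have "\<xi> w0 = z0" using S' by (simp add: \<xi>_def)
    ultimately have "(N, \<xi>) \<in> \<C>"
      using \<epsilon>(2) S' B \<xi> unfolding \<C>_def N_eq by (auto intro: inverse_branch_subset)
    then have "W T \<in> \<Omega>" using \<open>W T \<in> N\<close> \<Omega>I by blast
    then show False using T(1) by (auto simp: A_def)
  qed
  then have "D \<subseteq> \<Omega>" by blast
  then have "inverse_branch f D \<Phi>" using br inverse_branch_subset by blast
  moreover have "\<Phi> w0 = z0" using \<Omega>_mem[OF w0\<Omega>] \<Phi>_eq by (auto simp: \<C>_def)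
  ultimately show ?thesis using that by blast
qed

section \<open>Univalent functions\<close>

text \<open>A logarithm of \<open>\<phi> - p\<close> cannot cover a disk of radius greater than \<open>pi\<close>, so
  Bloch's theorem bounds its derivative.\<close>

lemma univalent_omitting_log_deriv_bound:
  assumes \<phi>: "\<phi> holomorphic_on ball c R" "inj_on \<phi> (ball c R)" "\<And>w. w \<in> ball c R \<Longrightarrow> \<phi> w \<noteq> p"
    and R: "R > 0"
  obtains g where "g holomorphic_on ball c R" "\<And>w. w \<in> ball c R \<Longrightarrow> exp (g w) = \<phi> w - p"
    "\<And>w. w \<in> ball c R \<Longrightarrow> norm (deriv g w) * (R - dist c w) \<le> 12 * pi"
proof -
  obtain g where g: "g holomorphic_on ball c R" "\<And>w. w \<in> ball c R \<Longrightarrow> exp (g w) = \<phi> w - p"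
    by (rule holomorphic_logarithm_exists[of "ball c R" "\<lambda>w. \<phi> w - p" c])
      (use \<phi> R in \<open>auto intro!: holomorphic_intros\<close>)
  have "norm (deriv g w) * (R - dist c w) \<le> 12 * pi" if w: "w \<in> ball c R" for w
  proof (rule ccontr)
    assume neg: "\<not> ?thesis"
    \<comment> \<open>The factor 1/12 is the constant in \<open>Bloch_general\<close>. The negated
      bound says r > pi, so the covered disk contains two points differing by 2 * pi * \<i>, which
      exp identifies.\<close>
    define r where "r = (R - dist c w) * norm (deriv g w) / 12"
    have r: "r > pi" using neg by (simp add: r_def mult.commute)
    obtain b where b: "ball b r \<subseteq> g ` ball c R"
    proof (rule Bloch_general[OF g(1) w, of "R - dist c w" r])
      fix z assume "z \<in> frontier (ball c R)"
      then have "dist c z = R" using R by (simp add: frontier_ball)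
      then show "R - dist c w \<le> dist w z" using dist_triangle[of c z w] by simp
    qed (auto simp: r_def)
    have "b + \<i> * pi \<in> ball b r" "b - \<i> * pi \<in> ball b r"
      using r by (auto simp: dist_norm norm_mult)
    then have "b + \<i> * pi \<in> g ` ball c R" "b - \<i> * pi \<in> g ` ball c R"
      using b by (auto simp only: subset_iff)
    then obtain x y where xy: "x \<in> ball c R" "y \<in> ball c R" "g x = b + \<i> * pi" "g y = b - \<i> * pi"
      by (auto elim!: imageE)
    have "exp (g x) = exp (g y)"
      unfolding xy exp_add exp_diff by (simp only: exp_pi_i') simp
    then have "\<phi> x - p = \<phi> y - p" by (simp only: g(2)[OF xy(1)] g(2)[OF xy(2)])
    then have "\<phi> x = \<phi> y" by simp
    then have "x = y" using \<phi>(2) xy by (auto dest: inj_onD)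
    then have "b + \<i> * pi = b - \<i> * pi" using xy(3,4) by simp
    then show False using pi_gt_zero by (simp add: complex_eq_iff)
  qed
  then show ?thesis using that g by blast
qed

text \<open>On the half disk the logarithm of \<phi> - p has derivative at most 24 * pi / R, and
  points are at distance below R/2 from the centre; so ln |\<phi> - p| varies by at most 12 * pi.
  The constant depends neither on \<phi> nor on R.\<close>

lemma univalent_omitting_comparable:
  assumes \<phi>: "\<phi> holomorphic_on ball c R" "inj_on \<phi> (ball c R)" "\<And>w. w \<in> ball c R \<Longrightarrow> \<phi> w \<noteq> p"
    and R: "R > 0" and w: "w \<in> ball c (R/2)"
  shows "norm (\<phi> w - p) \<le> exp (12 * pi) * norm (\<phi> c - p)"
    and "norm (\<phi> c - p) \<le> exp (12 * pi) * norm (\<phi> w - p)"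
proof -
  obtain g where g: "g holomorphic_on ball c R" "\<And>w. w \<in> ball c R \<Longrightarrow> exp (g w) = \<phi> w - p"
    "\<And>w. w \<in> ball c R \<Longrightarrow> norm (deriv g w) * (R - dist c w) \<le> 12 * pi"
    using univalent_omitting_log_deriv_bound[OF \<phi> R] by blast
  have "norm (g w - g c) \<le> (24 * pi / R) * norm (w - c)"
  proof (rule field_differentiable_bound[of "ball c (R/2)"])
    fix z assume z: "z \<in> ball c (R/2)"
    then have zR: "z \<in> ball c R" using R by auto
    then have "(g has_field_derivative deriv g z) (at z)"
      using g(1) by (auto intro: holomorphic_derivI)
    then show "(g has_field_derivative deriv g z) (at z within ball c (R/2))"
      by (rule has_field_derivative_at_within)
    have "norm (deriv g z) * (R/2) \<le> norm (deriv g z) * (R - dist c z)"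
      using z by (intro mult_left_mono) auto
    also have "\<dots> \<le> 12 * pi" using g(3)[OF zR] .
    finally show "norm (deriv g z) \<le> 24 * pi / R" using R by (simp add: field_simps)
  qed (use w R in auto)
  also have "\<dots> \<le> (24 * pi / R) * (R/2)"
    using w R by (intro mult_left_mono) (auto simp: dist_norm norm_minus_commute)
  finally have le: "norm (g w - g c) \<le> 12 * pi" using R by simp
  have n: "norm (\<phi> x - p) = exp (Re (g x))" if "x \<in> ball c R" for x
    using g(2)[OF that] by (metis norm_exp_eq_Re)
  have "\<bar>Re (g w) - Re (g c)\<bar> \<le> 12 * pi" using abs_Re_le_cmod[of "g w - g c"] le by simp
  then have "Re (g w) \<le> 12 * pi + Re (g c)" "Re (g c) \<le> 12 * pi + Re (g w)" by auto
  then show "norm (\<phi> w - p) \<le> exp (12 * pi) * norm (\<phi> c - p)"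
    "norm (\<phi> c - p) \<le> exp (12 * pi) * norm (\<phi> w - p)"
    using w R by (auto simp: n exp_add[symmetric])
qed

text \<open>Follow the preimage of a segment in the image: it moves at speed at most \<open>1/a\<close>, hence
  cannot reach the boundary of the disk before the segment has length \<open>a * r\<close>.\<close>

lemma univalent_image_contains_ball:
  assumes \<phi>: "\<phi> holomorphic_on ball x r" "inj_on \<phi> (ball x r)"
    and r: "r > 0" and a: "a > 0" and d: "\<And>w. w \<in> ball x r \<Longrightarrow> a \<le> norm (deriv \<phi> w)"
  obtains g where "g holomorphic_on \<phi> ` ball x r" "\<And>w. w \<in> ball x r \<Longrightarrow> g (\<phi> w) = w"
    "\<And>y. y \<in> \<phi> ` ball x r \<Longrightarrow> norm (deriv g y) \<le> 1 / a"
    "ball (\<phi> x) (a * r) \<subseteq> \<phi> ` ball x r"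
proof -
  let ?B = "ball x r"
  obtain g where g: "g holomorphic_on \<phi> ` ?B" "\<And>w. w \<in> ?B \<Longrightarrow> deriv \<phi> w * deriv g (\<phi> w) = 1"
    "\<And>w. w \<in> ?B \<Longrightarrow> g (\<phi> w) = w"
    using holomorphic_has_inverse[OF \<phi>(1) open_ball \<phi>(2)] by blast
  have op: "open (\<phi> ` ?B)" using open_mapping_thm3[OF \<phi>(1) open_ball \<phi>(2)] .
  have dg: "norm (deriv g y) \<le> 1 / a" if "y \<in> \<phi> ` ?B" for y
  proof -
    obtain w where w: "w \<in> ?B" "y = \<phi> w" using \<open>y \<in> \<phi> ` ?B\<close> by blast
    have "norm (deriv \<phi> w) * norm (deriv g y) = 1"
      using g(2)[OF w(1)] w(2) by (metis norm_mult norm_one)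
    moreover have "a * norm (deriv g y) \<le> norm (deriv \<phi> w) * norm (deriv g y)"
      using d[OF w(1)] by (intro mult_right_mono) auto
    ultimately show ?thesis using a by (simp add: field_simps)
  qed
  have sub: "ball (\<phi> x) (a * r) \<subseteq> \<phi> ` ?B"
  proof (rule ccontr)
    assume "\<not> ?thesis"
    then obtain y where y: "y \<in> ball (\<phi> x) (a * r)" "y \<notin> \<phi> ` ?B" by blast
    define W where "W t = \<phi> x + of_real t * (y - \<phi> x)" for t :: real
    have W_cont: "continuous_on A W" for A unfolding W_def by (intro continuous_intros)
    define A where "A = {0..1} \<inter> W -` (- \<phi> ` ?B)"
    have "closed A" unfolding A_def
      by (rule continuous_closed_preimage[OF W_cont]) (use op in auto)
    then have "compact A" unfolding A_def
      by (metis Int_absorb1 Int_lower1 compact_Icc compact_Int_closed A_def)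
    moreover have "1 \<in> A" using y by (auto simp: A_def W_def)
    ultimately obtain T where T: "T \<in> A" "\<And>t. t \<in> A \<Longrightarrow> T \<le> t"
      using compact_attains_inf[of A] by blast
    have T0: "0 < T" "T \<le> 1" using T(1) r unfolding A_def by (auto simp: less_le W_def)
    have before: "W t \<in> \<phi> ` ?B" if "0 \<le> t" "t < T" for t
      using T(2)[of t] that T0 by (auto simp: A_def)
    \<comment> \<open>The farthest the lift can travel. It is strictly below r, so the lift stays in
      the compact disk \<open>cball x m\<close>, whose image is closed and therefore contains the
      limit \<open>W T\<close>.\<close>
    define m where "m = norm (y - \<phi> x) / a"
    have m: "0 \<le> m" "m < r" using y a by (auto simp: m_def field_simps dist_norm norm_minus_commute)
    have near: "dist x (g (W t)) \<le> m" if t: "0 \<le> t" "t < T" for t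
    proof -
      have seg: "closed_segment (\<phi> x) (W t) \<subseteq> \<phi> ` ?B"
      proof
        fix v assume "v \<in> closed_segment (\<phi> x) (W t)"
        then obtain u where u: "0 \<le> u" "u \<le> 1" "v = (1 - u) *\<^sub>R \<phi> x + u *\<^sub>R W t"
          by (auto simp: in_segment)
        then have "v = W (u * t)" by (simp add: W_def scaleR_conv_of_real algebra_simps)
        moreover have "u * t \<le> t" using u t by (intro mult_left_le_one_le) auto
        ultimately show "v \<in> \<phi> ` ?B" using before[of "u * t"] u t by auto
      qed
      have "norm (g (W t) - g (\<phi> x)) \<le> (1/a) * norm (W t - \<phi> x)"
      proof (rule field_differentiable_bound[OF convex_closed_segment])
        fix z assume z: "z \<in> closed_segment (\<phi> x) (W t)"
        then have "(g has_field_derivative deriv g z) (at z)"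
          using holomorphic_derivI[OF g(1) op] seg by blast
        then show "(g has_field_derivative deriv g z) (at z within closed_segment (\<phi> x) (W t))"
          by (rule has_field_derivative_at_within)
        show "norm (deriv g z) \<le> 1/a" using dg seg z by blast
      qed auto
      also have "norm (W t - \<phi> x) \<le> norm (y - \<phi> x)"
        using t T0 by (auto simp: W_def norm_mult intro!: mult_left_le_one_le)
      finally show ?thesis
        using a g(3)[of x] r by (auto simp: m_def dist_norm norm_minus_commute divide_right_mono)
    qed
    have "W T \<in> closure (\<phi> ` cball x m)"
      unfolding closure_sequential
    proof (intro exI conjI allI)
      fix n
      let ?t = "T * (1 - 1 / real (Suc n))"
      have t: "0 \<le> ?t" "?t < T" using T0 by (auto simp: field_simps)
      obtain w where w: "w \<in> ?B" "W ?t = \<phi> w" using before[OF t] by auto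
      then show "W ?t \<in> \<phi> ` cball x m" using near[OF t] g(3)[OF w(1)] by auto
    next
      have "(\<lambda>n. W (T * (1 - 1 / real (Suc n)))) \<longlonglongrightarrow> W (T * (1 - 0))"
        unfolding W_def by (intro tendsto_intros LIMSEQ_Suc[OF lim_1_over_n])
      then show "(\<lambda>n. W (T * (1 - 1 / real (Suc n)))) \<longlonglongrightarrow> W T" by simp
    qed
    moreover have "cball x m \<subseteq> ?B" using m by auto
    then have "compact (\<phi> ` cball x m)"
      using holomorphic_on_imp_continuous_on[OF \<phi>(1)]
      by (intro compact_continuous_image) (auto intro: continuous_on_subset)
    ultimately have "W T \<in> \<phi> ` cball x m" by (simp add: compact_imp_closed closure_closed)
    then have "W T \<in> \<phi> ` ?B" using \<open>cball x m \<subseteq> ?B\<close> by blast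
    then show False using T(1) by (auto simp: A_def)
  qed
  show ?thesis using that g(1,3) dg sub by blast
qed

text \<open>The image of \<open>ball x s\<close> contains a disk of radius a * s about
  \<open>\<phi> x\<close>, on which the inverse is Lipschitz with constant 1/a. If
  \<open>\<phi> y\<close> lies in this disk, the sharper bound with a holds. Otherwise the images
  are at least a * s apart, while x and y are at most 2 * s apart; this case costs the factor
  1/2.\<close>

lemma univalent_lower_bound:
  assumes \<phi>: "\<phi> holomorphic_on ball b (2 * s)" "inj_on \<phi> (ball b (2 * s))"
    and s: "s > 0" and a: "a > 0" and d: "\<And>w. w \<in> ball b (2 * s) \<Longrightarrow> a \<le> norm (deriv \<phi> w)"
    and x: "x \<in> cball b s"
  shows "ball (\<phi> x) (a * s) \<subseteq> \<phi> ` ball b (2 * s)"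
    and "y \<in> cball b s \<Longrightarrow> (a / 2) * dist x y \<le> dist (\<phi> x) (\<phi> y)"
proof -
  have sub: "ball x s \<subseteq> ball b (2 * s)"
  proof
    fix v assume "v \<in> ball x s"
    then show "v \<in> ball b (2 * s)" using x dist_triangle[of b v x] by auto
  qed
  obtain g where g: "g holomorphic_on \<phi> ` ball x s" "\<And>w. w \<in> ball x s \<Longrightarrow> g (\<phi> w) = w"
    "\<And>y. y \<in> \<phi> ` ball x s \<Longrightarrow> norm (deriv g y) \<le> 1 / a"
    "ball (\<phi> x) (a * s) \<subseteq> \<phi> ` ball x s"
    using univalent_image_contains_ball[OF holomorphic_on_subset[OF \<phi>(1) sub] inj_on_subset[OF \<phi>(2) sub] s a]
      d sub by (metis subsetD)
  show "ball (\<phi> x) (a * s) \<subseteq> \<phi> ` ball b (2 * s)" using g(4) sub by blast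
  assume y: "y \<in> cball b s"
  show "(a / 2) * dist x y \<le> dist (\<phi> x) (\<phi> y)"
  proof (cases "dist (\<phi> x) (\<phi> y) < a * s")
    case True
    then have yb: "\<phi> y \<in> ball (\<phi> x) (a * s)" by simp
    then obtain w where w: "w \<in> ball x s" "\<phi> y = \<phi> w" using g(4) by blast
    have "y = w"
    proof (rule inj_onD[OF \<phi>(2) w(2)])
      show "y \<in> ball b (2 * s)" using y s by simp
      show "w \<in> ball b (2 * s)" using w(1) sub by blast
    qed
    have op: "open (\<phi> ` ball x s)"
      by (rule open_mapping_thm3[OF holomorphic_on_subset[OF \<phi>(1) sub] open_ball inj_on_subset[OF \<phi>(2) sub]])
    have "norm (g (\<phi> x) - g (\<phi> y)) \<le> (1/a) * norm (\<phi> x - \<phi> y)"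
    proof (rule field_differentiable_bound[of "ball (\<phi> x) (a * s)"])
      fix z assume z: "z \<in> ball (\<phi> x) (a * s)"
      then have "(g has_field_derivative deriv g z) (at z)"
        using holomorphic_derivI[OF g(1) op] g(4) by blast
      then show "(g has_field_derivative deriv g z) (at z within ball (\<phi> x) (a * s))"
        by (rule has_field_derivative_at_within)
      show "norm (deriv g z) \<le> 1/a" using g(3,4) z by blast
    qed (use yb a s in auto)
    moreover have "g (\<phi> x) = x" "g (\<phi> y) = y" using g(2) w \<open>y = w\<close> s by auto
    ultimately have "a * dist x y \<le> dist (\<phi> x) (\<phi> y)"
      using a by (simp add: dist_norm field_simps)
    moreover have "a / 2 * dist x y \<le> a * dist x y" using a by (intro mult_right_mono) auto
    ultimately show ?thesis by linarith
  next
    case False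
    have "dist x y \<le> 2 * s" using x y dist_triangle2[of x y b] by (auto simp: dist_commute)
    then have "(a / 2) * dist x y \<le> (a / 2) * (2 * s)" using a by (intro mult_left_mono) auto
    then show ?thesis using False by simp
  qed
qed

section \<open>Logarithmic means and Jensen's formula\<close>

text \<open>Angles with total mass 2 * pi, not normalised. As a measure it gives access to Fubini,
  monotone convergence and almost everywhere statements; \<open>integral_circle_measure\<close>
  leads back to the gauge integral used in the Nevanlinna functions.\<close>

definition circle_measure :: "real measure" where
  "circle_measure = restrict_space lborel {0..2*pi}"

lemma space_circle_measure [simp]: "space circle_measure = {0..2*pi}"
  by (simp add: circle_measure_def space_restrict_space)

lemma emeasure_circle_measure: "emeasure circle_measure {0..2*pi} = ennreal (2 * pi)"
  by (simp add: circle_measure_def emeasure_restrict_space space_restrict_space)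

lemma finite_measure_circle_measure: "finite_measure circle_measure"
  by (rule finite_measureI) (simp add: emeasure_circle_measure)

lemma integral_const_circle_measure: "(\<integral>t. c \<partial>circle_measure) = 2 * pi * (c::real)"
  by (simp add: measure_def emeasure_circle_measure)

lemma borel_measurable_circle_measure:
  assumes "f \<in> borel_measurable borel"
  shows "f \<in> borel_measurable circle_measure"
  using measurable_restrict_space1[of f lborel borel "{0..2*pi}"] assms
  by (simp add: circle_measure_def)

lemma integrable_circle_measure_continuous:
  fixes f :: "real \<Rightarrow> 'b::{banach, second_countable_topology}"
  assumes "continuous_on {0..2*pi} f"
  shows "integrable circle_measure f"
  unfolding circle_measure_def
  by (subst integrable_restrict_space) (auto intro: borel_integrable_compact assms)

lemma integral_circle_measure:
  fixes f :: "real \<Rightarrow> 'b::euclidean_space"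
  assumes "integrable circle_measure f"
  shows "f integrable_on {0..2*pi}" "integral {0..2*pi} f = integral\<^sup>L circle_measure f"
proof -
  have "set_integrable lborel {0..2*pi} f"
    using assms unfolding circle_measure_def set_integrable_def
    by (subst (asm) integrable_restrict_space) auto
  from set_borel_integral_eq_integral[OF this]
  show "f integrable_on {0..2*pi}" "integral {0..2*pi} f = integral\<^sup>L circle_measure f"
    by (auto simp: circle_measure_def set_lebesgue_integral_def integral_restrict_space)
qed

text \<open>Since \<open>ln 0 = 0\<close>, splitting the logarithm of a product is valid only where
  no factor vanishes. The exceptional angles are countably many, hence null.\<close>

lemma AE_circle_measure_neq:
  assumes "r > 0"
  shows "AE t in circle_measure. of_real r * cis t \<noteq> a"
proof -
  have "countable {t. of_real r * cis t = a}"
  proof (cases "\<exists>t. of_real r * cis t = a")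
    case True
    then obtain t0 where t0: "of_real r * cis t0 = a" by blast
    have "{t. of_real r * cis t = a} \<subseteq> range (\<lambda>k::int. t0 + 2 * pi * k)"
    proof
      fix t assume "t \<in> {t. of_real r * cis t = a}"
      then have "cis t = cis t0" using t0 assms by auto
      then have "sin t = sin t0 \<and> cos t = cos t0" by (auto simp: complex_eq_iff)
      then show "t \<in> range (\<lambda>k::int. t0 + 2 * pi * k)"
        by (auto simp: sin_cos_eq_iff)
    qed
    then show ?thesis by (rule countable_subset) auto
  qed auto
  from AE_not_in[OF countable_imp_null_set_lborel[OF this]]
  have "AE t in lborel. of_real r * cis t \<noteq> a" by simp
  then show ?thesis unfolding circle_measure_def
    by (subst AE_restrict_space_iff) (auto elim: eventually_mono)
qed

lemma circle_mean_Re_holomorphic: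
  assumes g: "g holomorphic_on ball 0 R" and r: "0 < r" "r < R"
  shows "integrable circle_measure (\<lambda>t. Re (g (of_real r * cis t)))"
    and "(\<integral>t. Re (g (of_real r * cis t)) \<partial>circle_measure) = 2 * pi * Re (g 0)"
proof -
  have gc: "continuous_on {0..2*pi} (\<lambda>t. g (of_real r * cis t))"
    by (rule continuous_on_compose2[OF holomorphic_on_imp_continuous_on[OF g]])
      (use r in \<open>auto intro!: continuous_intros simp: norm_mult\<close>)
  then have int: "integrable circle_measure (\<lambda>t. g (of_real r * cis t))"
    by (rule integrable_circle_measure_continuous)
  show int': "integrable circle_measure (\<lambda>t. Re (g (of_real r * cis t)))"
    using gc by (intro integrable_circle_measure_continuous continuous_intros)
  have "g holomorphic_on cball 0 r" using g by (rule holomorphic_on_subset) (use r in auto)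
  then have "((\<lambda>u. g u / (u - 0)) has_contour_integral 2 * of_real pi * \<i> * g 0) (circlepath 0 r)"
    using r by (intro Cauchy_integral_circlepath_simple) auto
  then have "((\<lambda>t. g (0 + of_real r * cis t) / (0 + of_real r * cis t - 0) * r * \<i> * cis t)
      has_integral 2 * of_real pi * \<i> * g 0) {0..2*pi}"
    unfolding circlepath_def by (subst (asm) has_contour_integral_part_circlepath_iff) auto
  then have "((\<lambda>t. g (of_real r * cis t) * \<i>) has_integral 2 * of_real pi * \<i> * g 0) {0..2*pi}"
    by (rule has_integral_eq[rotated]) (use r in \<open>auto simp: field_simps\<close>)
  then have "((\<lambda>t. g (of_real r * cis t) * \<i> * (-\<i>)) has_integral 2 * of_real pi * \<i> * g 0 * (-\<i>)) {0..2*pi}"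
    by (rule has_integral_mult_left)
  moreover have "2 * of_real pi * \<i> * g 0 * (-\<i>) = 2 * of_real pi * g 0"
    by (simp add: algebra_simps)
  ultimately have "((\<lambda>t. g (of_real r * cis t) * \<i> * (-\<i>)) has_integral 2 * of_real pi * g 0) {0..2*pi}"
    by (simp only:)
  then have "((\<lambda>t. g (of_real r * cis t)) has_integral 2 * of_real pi * g 0) {0..2*pi}"
    by (simp add: algebra_simps)
  then have "integral {0..2*pi} (\<lambda>t. g (of_real r * cis t)) = 2 * of_real pi * g 0"
    by (rule integral_unique)
  then have "(\<integral>t. g (of_real r * cis t) \<partial>circle_measure) = 2 * of_real pi * g 0"
    using integral_circle_measure[OF int] by simp
  moreover have "(\<integral>t. Re (g (of_real r * cis t)) \<partial>circle_measure) = Re (\<integral>t. g (of_real r * cis t) \<partial>circle_measure)"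
    using int by (rule integral_Re)
  ultimately show "(\<integral>t. Re (g (of_real r * cis t)) \<partial>circle_measure) = 2 * pi * Re (g 0)" by simp
qed

text \<open>On a disk a zero-free h has a holomorphic logarithm, and ln |h| is its real part; the
  mean value property does the rest.\<close>

lemma circle_mean_ln_norm_nonvanishing:
  assumes h: "h holomorphic_on ball 0 R" "\<And>z. z \<in> ball 0 R \<Longrightarrow> h z \<noteq> 0" and r: "0 < r" "r < R"
  shows "integrable circle_measure (\<lambda>t. ln (norm (h (of_real r * cis t))))"
    and "(\<integral>t. ln (norm (h (of_real r * cis t))) \<partial>circle_measure) = 2 * pi * ln (norm (h 0))"
proof -
  obtain g where g: "g holomorphic_on ball 0 R" "\<And>z. z \<in> ball 0 R \<Longrightarrow> exp (g z) = h z"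
    by (rule holomorphic_logarithm_exists[of "ball 0 R" h 0]) (use h r in auto)
  have ln: "ln (norm (h z)) = Re (g z)" if "z \<in> ball 0 R" for z
    using g(2)[OF that] by (metis norm_exp_eq_Re ln_exp)
  have "ln (norm (h (of_real r * cis t))) = Re (g (of_real r * cis t))" for t
    by (rule ln) (use r in \<open>auto simp: norm_mult\<close>)
  moreover have "ln (norm (h 0)) = Re (g 0)" by (rule ln) (use r in auto)
  ultimately show "integrable circle_measure (\<lambda>t. ln (norm (h (of_real r * cis t))))"
    "(\<integral>t. ln (norm (h (of_real r * cis t))) \<partial>circle_measure) = 2 * pi * ln (norm (h 0))"
    using circle_mean_Re_holomorphic[OF g(1) r] by auto
qed

text \<open>Pushing a radially outwards from the circle through z increases its distance from z.
  This supplies the monotonicity for the limiting case of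
  \<open>circle_mean_ln_dist\<close>.\<close>

lemma norm_diff_scaled_mono:
  fixes z a :: complex
  assumes "norm z = norm a" "1 \<le> c" "c \<le> c'"
  shows "norm (z - of_real c * a) \<le> norm (z - of_real c' * a)"
proof -
  have eq: "(norm (z - of_real c * a))\<^sup>2 = (norm a)\<^sup>2 - 2 * c * (z \<bullet> a) + c\<^sup>2 * (norm a)\<^sup>2" for c
  proof -
    have "(norm (z - c *\<^sub>R a))\<^sup>2 = (norm z)\<^sup>2 - 2 * c * (z \<bullet> a) + c\<^sup>2 * (norm a)\<^sup>2"
      unfolding power2_norm_eq_inner
      by (simp add: inner_diff inner_commute power2_eq_square algebra_simps)
    then show ?thesis using assms(1) by (simp add: scaleR_conv_of_real)
  qed
  have "z \<bullet> a \<le> (norm a)\<^sup>2" using norm_cauchy_schwarz[of z a] assms(1) by (simp add: power2_eq_square)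
  then have "2 * (c' - c) * (z \<bullet> a) \<le> 2 * (c' - c) * (norm a)\<^sup>2"
    using assms by (intro mult_left_mono) auto
  also have "\<dots> \<le> (c' + c) * (c' - c) * (norm a)\<^sup>2"
    using assms by (intro mult_right_mono) auto
  finally have "(norm (z - of_real c * a))\<^sup>2 \<le> (norm (z - of_real c' * a))\<^sup>2"
    unfolding eq by (simp add: algebra_simps power2_eq_square)
  then show ?thesis by (rule power2_le_imp_le) auto
qed

lemma borel_measurable_ln_norm_circle:
  "(\<lambda>t. ln (norm (of_real r * cis t - a))) \<in> borel_measurable circle_measure"
proof (rule borel_measurable_circle_measure)
  have "(\<lambda>t. norm (of_real r * cis t - a)) \<in> borel_measurable borel"
    by (intro borel_measurable_continuous_onI continuous_intros)
  then show "(\<lambda>t. ln (norm (of_real r * cis t - a))) \<in> borel_measurable borel"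
    by measurable
qed

text \<open>For a outside the circle the function z - a is zero-free. For a inside, it is replaced
  by its reflection, which has the same modulus on the circle. For a on the circle the logarithm is
  unbounded and a limit from outside is taken.\<close>

lemma circle_mean_ln_dist:
  assumes r: "r > 0"
  shows "integrable circle_measure (\<lambda>t. ln (norm (of_real r * cis t - a)))"
    and "(\<integral>t. ln (norm (of_real r * cis t - a)) \<partial>circle_measure) = 2 * pi * ln (max r (norm a))"
proof -
  have outside: "integrable circle_measure (\<lambda>t. ln (norm (of_real r * cis t - a))) \<and>
     (\<integral>t. ln (norm (of_real r * cis t - a)) \<partial>circle_measure) = 2 * pi * ln (max r (norm a))"
    if "r < norm a" for a
  proof -
    have "(\<lambda>z. z - a) holomorphic_on ball 0 (norm a)" by (intro holomorphic_intros)
    moreover have "z - a \<noteq> 0" if "z \<in> ball 0 (norm a)" for z using that by auto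
    ultimately show ?thesis
      using circle_mean_ln_norm_nonvanishing[of "\<lambda>z. z - a" "norm a" r] that r by (simp add: max_def)
  qed
  have "integrable circle_measure (\<lambda>t. ln (norm (of_real r * cis t - a))) \<and>
     (\<integral>t. ln (norm (of_real r * cis t - a)) \<partial>circle_measure) = 2 * pi * ln (max r (norm a))"
  proof (cases "norm a" r rule: linorder_cases)
    case greater
    then show ?thesis by (rule outside)
  next
    case less
    \<comment> \<open>For nonzero a this R lies strictly between 1 and r / |a|, so r - cnj a * z is
      zero-free on a disk beyond the unit circle, where its modulus equals that of r * cis t -
      a.\<close>
    define R where "R = 2 * r / (r + norm a)"
    have R: "1 < R" "norm a * R < r \<or> a = 0"
      using less r by (auto simp: R_def field_simps add_pos_nonneg)
    have nz: "of_real r - cnj a * z \<noteq> 0" if "z \<in> ball 0 R" for z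
    proof
      assume "of_real r - cnj a * z = 0"
      then have eq: "of_real r = cnj a * z" by simp
      have "r = norm (of_real r :: complex)" using r by simp
      also have "\<dots> = norm a * norm z" unfolding eq by (simp add: norm_mult)
      finally have "r = norm a * norm z" .
      moreover have "norm a * norm z \<le> norm a * R" using that by (intro mult_left_mono) auto
      ultimately show False using R r by auto
    qed
    have norm_eq: "norm (of_real r - cnj a * (of_real 1 * cis t)) = norm (of_real r * cis t - a)" for t
    proof -
      have "norm (of_real r * cis t - a) = norm (cnj (of_real r * cis t - a)) * norm (cis t)"
        by (simp only: complex_mod_cnj norm_cis mult_1_right)
      also have "\<dots> = norm (of_real r * (cis (-t) * cis t) - cnj a * cis t)"
        unfolding norm_mult[symmetric] by (simp add: cis_cnj algebra_simps)
      also have "cis (-t) * cis t = 1" by (simp add: cis_mult)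
      finally show ?thesis by simp
    qed
    have "(\<lambda>z. of_real r - cnj a * z) holomorphic_on ball 0 R" by (intro holomorphic_intros)
    from circle_mean_ln_norm_nonvanishing[OF this nz, of 1] R(1) less r
    show ?thesis unfolding norm_eq by (auto simp: max_def)
  next
    case equal
    \<comment> \<open>The points c n * a approach a radially from outside. The negative logarithms
      then increase with n, as monotone convergence requires.\<close>
    define c where "c n = 1 + 1 / real (Suc n)" for n
    have c: "1 < c n" "c (Suc n) \<le> c n" for n by (auto simp: c_def field_simps)
    have c_mono: "c m \<le> c n" if "n \<le> m" for n m
      using lift_Suc_antimono_le[of c, OF c(2) that] by simp
    have c_lim: "c \<longlonglongrightarrow> 1"
      using tendsto_add[OF tendsto_const[of 1] LIMSEQ_Suc[OF lim_1_over_n]] by (simp add: c_def[abs_def])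
    have big: "r < norm (of_real (c n) * a)" for n
      using c(1)[of n] equal r by (simp add: norm_mult)
    define F where "F n t = - ln (norm (of_real r * cis t - of_real (c n) * a))" for n t
    have F_int: "integrable circle_measure (F n)" 
      and F_val: "integral\<^sup>L circle_measure (F n) = - (2 * pi * ln (c n * r))" for n
      using outside[OF big[of n]] big[of n] c(1)[of n] equal
      by (auto simp: F_def[abs_def] max_def norm_mult)
    have mono: "mono (\<lambda>n. F n t)" for t
    proof (rule monoI)
      fix n m :: nat assume "n \<le> m"
      have "norm (of_real r * cis t - of_real (c m) * a) \<le> norm (of_real r * cis t - of_real (c n) * a)"
        using c(1)[of m] c_mono[OF \<open>n \<le> m\<close>] equal r
        by (intro norm_diff_scaled_mono) (auto simp: norm_mult)
      moreover have "0 < norm (of_real r * cis t - of_real (c m) * a)"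
      proof -
        have "norm (of_real r * cis t) = r" using r by (simp add: norm_mult)
        then have "of_real r * cis t \<noteq> of_real (c m) * a" using big[of m] by force
        then show ?thesis by simp
      qed
      ultimately have "ln (norm (of_real r * cis t - of_real (c m) * a)) \<le> ln (norm (of_real r * cis t - of_real (c n) * a))"
        by (subst ln_le_cancel_iff) linarith+
      then show "F n t \<le> F m t" unfolding F_def by linarith
    qed
    have lim: "AE t in circle_measure. (\<lambda>n. F n t) \<longlonglongrightarrow> - ln (norm (of_real r * cis t - a))"
      using AE_circle_measure_neq[OF r, of a]
    proof eventually_elim
      case (elim t)
      have "(\<lambda>n. - ln (norm (of_real r * cis t - of_real (c n) * a))) \<longlonglongrightarrow> - ln (norm (of_real r * cis t - of_real 1 * a))"
        using elim by (intro tendsto_intros c_lim) auto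
      then show ?case by (simp add: F_def)
    qed
    have ilim: "(\<lambda>n. integral\<^sup>L circle_measure (F n)) \<longlonglongrightarrow> - (2 * pi * ln r)"
    proof -
      have "(\<lambda>n. - (2 * pi * ln (c n * r))) \<longlonglongrightarrow> - (2 * pi * ln (1 * r))"
        using r by (intro tendsto_intros c_lim) auto
      then show ?thesis by (simp add: F_val)
    qed
    have meas: "(\<lambda>t. - ln (norm (of_real r * cis t - a))) \<in> borel_measurable circle_measure"
      using borel_measurable_ln_norm_circle by measurable
    have "integrable circle_measure (\<lambda>t. - ln (norm (of_real r * cis t - a)))"
      "integral\<^sup>L circle_measure (\<lambda>t. - ln (norm (of_real r * cis t - a))) = - (2 * pi * ln r)"
      using integrable_monotone_convergence[OF F_int _ lim ilim meas]
        integral_monotone_convergence[OF F_int _ lim ilim meas] mono by auto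
    then show ?thesis using equal by auto
  qed
  then show "integrable circle_measure (\<lambda>t. ln (norm (of_real r * cis t - a)))"
    "(\<integral>t. ln (norm (of_real r * cis t - a)) \<partial>circle_measure) = 2 * pi * ln (max r (norm a))"
    by auto
qed

text \<open>Dividing by H reduces this to the distance of G / H from a circle of radius s. In the
  application G - s * cis \<theta> * H runs through g - w * f2 with w on a circle around b.\<close>

lemma circle_mean_ln_pencil:
  fixes G H :: complex
  assumes s: "s > 0" and nz: "G \<noteq> 0 \<or> H \<noteq> 0"
  shows "integrable circle_measure (\<lambda>t. ln (norm (G - of_real s * cis t * H)))"
    and "(\<integral>t. ln (norm (G - of_real s * cis t * H)) \<partial>circle_measure) = 2 * pi * ln (max (norm G) (s * norm H))"
proof -
  have "integrable circle_measure (\<lambda>t. ln (norm (G - of_real s * cis t * H))) \<and>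
    (\<integral>t. ln (norm (G - of_real s * cis t * H)) \<partial>circle_measure) = 2 * pi * ln (max (norm G) (s * norm H))"
  proof (cases "H = 0")
    case True
    then show ?thesis
      using finite_measure.integrable_const[OF finite_measure_circle_measure, of "ln (norm G)"]
      by (simp add: integral_const_circle_measure max_def del: integral_const lebesgue_integral_const)
  next
    case False
    let ?a = "G / H"
    have ae: "AE t in circle_measure. ln (norm (G - of_real s * cis t * H)) = 
        ln (norm H) + ln (norm (of_real s * cis t - ?a))"
      using AE_circle_measure_neq[OF s, of ?a]
    proof eventually_elim
      case (elim t)
      have "norm (G - of_real s * cis t * H) = norm H * norm (of_real s * cis t - ?a)"
      proof -
        have "H * (of_real s * cis t - ?a) = - (G - of_real s * cis t * H)"
          using False by (simp add: algebra_simps)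
        then show ?thesis by (metis norm_minus_cancel norm_mult)
      qed
      then show ?case using False elim by (simp add: ln_mult)
    qed
    have c: "integrable circle_measure (\<lambda>t. ln (norm H))"
      using finite_measure.integrable_const[OF finite_measure_circle_measure] .
    note i = circle_mean_ln_dist[OF s, of ?a]
    have m: "(\<lambda>t. ln (norm (G - of_real s * cis t * H))) \<in> borel_measurable circle_measure"
    proof (rule borel_measurable_circle_measure)
      have "(\<lambda>t. norm (G - of_real s * cis t * H)) \<in> borel_measurable borel"
        by (intro borel_measurable_continuous_onI continuous_intros)
      then show "(\<lambda>t. ln (norm (G - of_real s * cis t * H))) \<in> borel_measurable borel"
        by measurable
    qed
    have m': "(\<lambda>t. ln (norm H) + ln (norm (of_real s * cis t - ?a))) \<in> borel_measurable circle_measure"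
      using borel_measurable_ln_norm_circle by measurable
    have "integrable circle_measure (\<lambda>t. ln (norm (G - of_real s * cis t * H)))"
      using integrable_cong_AE[OF m m' ae] Bochner_Integration.integrable_add[OF c i(1)] by simp
    moreover have "(\<integral>t. ln (norm (G - of_real s * cis t * H)) \<partial>circle_measure) = 
        2 * pi * ln (norm H) + 2 * pi * ln (max s (norm ?a))"
      using integral_cong_AE[OF m m' ae] Bochner_Integration.integral_add[OF c i(1)] i(2)
      by (simp add: integral_const_circle_measure del: lebesgue_integral_const)
    moreover have "ln (max (norm G) (s * norm H)) = ln (norm H) + ln (max s (norm ?a))"
    proof -
      have "max (norm G) (s * norm H) = norm H * max s (norm ?a)"
        using False by (simp add: max_def norm_divide field_simps)
      moreover have "0 < max s (norm ?a)" using s by (simp add: less_max_iff_disj)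
      ultimately show ?thesis using False by (simp add: ln_mult)
    qed
    ultimately show ?thesis by (simp add: algebra_simps)
  qed
  then show "integrable circle_measure (\<lambda>t. ln (norm (G - of_real s * cis t * H)))"
    "(\<integral>t. ln (norm (G - of_real s * cis t * H)) \<partial>circle_measure) = 2 * pi * ln (max (norm G) (s * norm H))"
    by auto
qed

section \<open>Zeros of entire functions and Jensen's formula\<close>

lemma finite_zeros_entire:
  assumes G: "G holomorphic_on UNIV" "G \<beta> \<noteq> 0"
  shows "finite {a. norm a \<le> r \<and> G a = 0}"
proof (cases "G constant_on UNIV")
  case True
  then have "G a \<noteq> 0" for a using G(2) unfolding constant_on_def by (metis UNIV_I)
  then have "{a. norm a \<le> r \<and> G a = 0} = {}" by simp
  then show ?thesis by (simp only: finite.emptyI)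
next
  case False
  have "finite {z \<in> cball 0 r. G z = 0}"
    by (rule holomorphic_compact_finite_zeros[OF G(1) open_UNIV connected_UNIV compact_cball subset_UNIV False])
  then show ?thesis by (rule finite_subset[rotated]) auto
qed

text \<open>Zeros on the circle |z| = r are divided out too, so h is zero-free on an open disk
  larger than the closed one and its logarithm can be averaged over the circle itself.\<close>

lemma entire_factor_zeros_cball:
  fixes r :: real
  assumes G: "G holomorphic_on UNIV" "G \<beta> \<noteq> 0"
  defines "Z \<equiv> {a. norm a \<le> r \<and> G a = 0}"
  obtains h R where "r < R" "h holomorphic_on ball 0 R" "\<And>z. z \<in> ball 0 R \<Longrightarrow> h z \<noteq> 0"
    "\<And>z. z \<in> ball 0 R \<Longrightarrow> G z = h z * (\<Prod>a\<in>Z. (z - a) ^ nat (zorder G a))"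
proof -
  have fin: "finite {a. norm a \<le> r' \<and> G a = 0}" for r' by (rule finite_zeros_entire[OF G])
  have Z: "finite Z" unfolding Z_def by (rule fin)
  \<comment> \<open>Moduli of the finitely many zeros just outside the closed disk; r + 1 makes the
    set nonempty. Below its minimum R there are no zeros other than those in Z.\<close>
  define N where "N = insert (r + 1) (norm ` {a. norm a \<le> r + 1 \<and> G a = 0 \<and> r < norm a})"
  have finN: "finite N" unfolding N_def
    by (intro finite.insertI finite_imageI finite_subset[OF _ fin[of "r+1"]]) auto
  define R where "R = Min N"
  have "r < R" unfolding R_def using finN by (subst Min_gr_iff) (auto simp: N_def)
  have R_le: "R \<le> r + 1" unfolding R_def using finN by (intro Min_le) (auto simp: N_def)
  have in_Z: "z \<in> Z" if "z \<in> ball 0 R" "G z = 0" for z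
  proof (rule ccontr)
    assume "z \<notin> Z"
    then have "norm z \<in> N" using that R_le by (auto simp: N_def Z_def)
    then have "R \<le> norm z" unfolding R_def using finN by simp
    then show False using that by simp
  qed
  have ev: "eventually (\<lambda>w. G w \<noteq> 0) (at z)" for z
    using non_zero_neighbour_alt[OF G(1) _ _ _ _ G(2), of z] by (auto elim: eventually_mono)
  have anG: "G analytic_on {z}" for z using G(1) by (simp add: analytic_on_holomorphic) blast
  have zpos: "zorder G a > 0" if "G a = 0" for a
    using zorder_pos_iff'[OF anG, of a] ev[of a] that eventually_frequently[of "at a"] by auto
  define P where "P z = (\<Prod>a\<in>Z. (z - a) ^ nat (zorder G a))" for z
  have P_hol: "P holomorphic_on A" for A unfolding P_def by (intro holomorphic_intros)
  have P0: "P z = 0 \<longleftrightarrow> z \<in> Z" for z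
    using Z zpos by (auto simp: P_def Z_def)
  have G0: "P z = 0 \<longleftrightarrow> G z = 0" if "z \<in> ball 0 R" for z
    using that in_Z by (auto simp: P0) (auto simp: Z_def)
  have zo: "zorder P z = zorder G z" if z: "z \<in> ball 0 R" for z
  proof (cases "z \<in> Z")
    case False
    then have "G z \<noteq> 0" "P z \<noteq> 0" using in_Z z P0 by auto
    moreover have "P analytic_on {z}" using P_hol[of UNIV] by (simp add: analytic_on_holomorphic) blast
    ultimately show ?thesis using zorder_eq_0I[OF anG] zorder_eq_0I[of P z] by simp
  next
    case True
    show ?thesis
    proof (rule zorder_eqI[of UNIV z "\<lambda>w. \<Prod>a\<in>Z - {z}. (w - a) ^ nat (zorder G a)"])
      show "(\<Prod>a\<in>Z - {z}. (z - a) ^ nat (zorder G a)) \<noteq> 0" using Z by auto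
      have "zorder G z > 0" using True zpos by (auto simp: Z_def)
      then show "P w = (\<Prod>a\<in>Z - {z}. (w - a) ^ nat (zorder G a)) * (w - z) powi zorder G z" for w
        unfolding P_def using Z True by (subst prod.remove[of Z z]) (auto simp: power_int_def)
    qed (auto intro!: holomorphic_intros)
  qed
  have "G holomorphic_on ball 0 R" using G(1) by (rule holomorphic_on_subset) auto
  from holomorphic_zorder_factorization[OF this open_ball connected_ball P_hol G0 zo]
  obtain h where "h holomorphic_on ball 0 R" "\<And>z. z \<in> ball 0 R \<Longrightarrow> h z \<noteq> 0"
    "\<And>z. z \<in> ball 0 R \<Longrightarrow> G z = h z * P z" by blast
  then show ?thesis using that \<open>r < R\<close> unfolding P_def by blast
qed

text \<open>Here c is the leading Taylor coefficient at 0, so that G may vanish there. Zeros on the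
  circle enter with weight ln 1 = 0. The proof averages the logarithm of the factorisation term by
  term.\<close>

theorem jensen_formula:
  assumes G: "G holomorphic_on UNIV" and c: "c \<noteq> 0" "((\<lambda>z. G z / z ^ nat (zorder G 0)) \<longlongrightarrow> c) (at 0)"
    and r: "r > 0"
  shows "integrable circle_measure (\<lambda>t. ln (norm (G (of_real r * cis t))))"
    and "(\<integral>t. ln (norm (G (of_real r * cis t))) \<partial>circle_measure) =
      2 * pi * (ln (norm c) + real (nat (zorder G 0)) * ln r +
        (\<Sum>a | 0 < norm a \<and> norm a \<le> r \<and> G a = 0. real (nat (zorder G a)) * ln (r / norm a)))"
proof -
  have "\<exists>\<beta>. G \<beta> \<noteq> 0"
  proof (rule ccontr)
    assume "\<not> ?thesis"
    then have "((\<lambda>z::complex. 0) \<longlongrightarrow> c) (at 0)" using c(2) by simp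
    then show False using c(1) by (simp add: tendsto_const_iff)
  qed
  then obtain \<beta> where \<beta>: "G \<beta> \<noteq> 0" by blast
  define Z where "Z = {a. norm a \<le> r \<and> G a = 0}"
  have finZ: "finite Z" unfolding Z_def by (rule finite_zeros_entire[OF G \<beta>])
  define m where "m a = nat (zorder G a)" for a
  define Z' where "Z' = Z - {0}"
  have Z'_eq: "{a. 0 < norm a \<and> norm a \<le> r \<and> G a = 0} = Z'" by (auto simp: Z'_def Z_def)
  have finZ': "finite Z'" using finZ by (simp add: Z'_def)
  obtain h R where hR: "r < R" "h holomorphic_on ball 0 R" "\<And>z. z \<in> ball 0 R \<Longrightarrow> h z \<noteq> 0"
    "\<And>z. z \<in> ball 0 R \<Longrightarrow> G z = h z * (\<Prod>a\<in>Z. (z - a) ^ m a)"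
    by (rule entire_factor_zeros_cball[OF G \<beta>, of r, folded Z_def m_def]) blast
  have m0: "m 0 = 0" if "0 \<notin> Z"
  proof -
    have "G 0 \<noteq> 0" using that r by (auto simp: Z_def)
    moreover have "G analytic_on {0}" using G by (simp add: analytic_on_holomorphic) blast
    ultimately show ?thesis by (simp add: m_def zorder_eq_0I)
  qed
  have split: "(\<Prod>a\<in>Z. (z - a) ^ m a) = z ^ m 0 * (\<Prod>a\<in>Z'. (z - a) ^ m a)" for z
  proof (cases "0 \<in> Z")
    case True
    then show ?thesis unfolding Z'_def using finZ by (subst prod.remove[of Z 0]) auto
  qed (use m0 in \<open>auto simp: Z'_def\<close>)
  have ssum: "(\<Sum>a\<in>Z. real (m a) * x) = real (m 0) * x + (\<Sum>a\<in>Z'. real (m a) * x)" for x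
  proof (cases "0 \<in> Z")
    case True
    then show ?thesis unfolding Z'_def using finZ by (subst sum.remove[of Z 0]) auto
  qed (use m0 in \<open>auto simp: Z'_def\<close>)
  have "((\<lambda>z. h z * (\<Prod>a\<in>Z'. (z - a) ^ m a)) \<longlongrightarrow> h 0 * (\<Prod>a\<in>Z'. (0 - a) ^ m a)) (at 0)"
  proof (intro tendsto_intros)
    have "isCont h 0" using hR(1,2) r
      by (intro continuous_on_interior[of "ball 0 R"] holomorphic_on_imp_continuous_on) (auto simp: interior_open)
    then show "(h \<longlongrightarrow> h 0) (at 0)" by (simp add: isCont_def)
  qed
  moreover have "eventually (\<lambda>z. h z * (\<Prod>a\<in>Z'. (z - a) ^ m a) = G z / z ^ m 0) (at 0)"
  proof -
    have "eventually (\<lambda>z. z \<in> ball 0 R - {0}) (at 0)"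
      using hR(1) r by (intro eventually_at_in_open) auto
    then show ?thesis
      by eventually_elim (use hR(4) split in auto)
  qed
  ultimately have "((\<lambda>z. G z / z ^ m 0) \<longlongrightarrow> h 0 * (\<Prod>a\<in>Z'. (0 - a) ^ m a)) (at 0)"
    by (rule Lim_transform_eventually)
  then have c_eq: "c = h 0 * (\<Prod>a\<in>Z'. (0 - a) ^ m a)"
    using c(2) tendsto_unique[of "at (0::complex)"] by (simp add: m_def)
  have h0: "h 0 \<noteq> 0" using hR(1,3) r by auto
  have ln_c: "ln (norm c) = ln (norm (h 0)) + (\<Sum>a\<in>Z'. real (m a) * ln (norm a))"
  proof -
    have "norm c = norm (h 0) * (\<Prod>a\<in>Z'. norm a ^ m a)"
      unfolding c_eq by (simp add: norm_mult prod_norm[symmetric] norm_power)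
    moreover have "ln (\<Prod>a\<in>Z'. norm a ^ m a) = (\<Sum>a\<in>Z'. ln (norm a ^ m a))"
      by (rule ln_prod) (auto simp: finZ Z'_def)
    moreover have "ln (norm a ^ m a) = real (m a) * ln (norm a)" if "a \<in> Z'" for a
      using that by (simp add: Z'_def ln_realpow)
    moreover have "(\<Prod>a\<in>Z'. norm a ^ m a) \<noteq> 0" using finZ' by (auto simp: Z'_def)
    ultimately show ?thesis using h0 by (simp add: ln_mult)
  qed
  \<comment> \<open>The logarithm of the factorisation written as a sum; it equals ln |G| except at
    the angles where G vanishes.\<close>
  define L where "L t = ln (norm (h (of_real r * cis t))) + (\<Sum>a\<in>Z. real (m a) * ln (norm (of_real r * cis t - a)))" for t
  have ae: "AE t in circle_measure. ln (norm (G (of_real r * cis t))) = L t"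
  proof -
    have "AE t in circle_measure. \<forall>a\<in>Z. of_real r * cis t \<noteq> a"
      using finZ AE_circle_measure_neq[OF r] by (intro AE_finite_allI)
    then show ?thesis
    proof eventually_elim
      case (elim t)
      let ?z = "of_real r * cis t"
      have zR: "?z \<in> ball 0 R" using r hR(1) by (simp add: norm_mult)
      have "norm (G ?z) = norm (h ?z) * (\<Prod>a\<in>Z. norm (?z - a) ^ m a)"
        unfolding hR(4)[OF zR] by (simp add: norm_mult prod_norm[symmetric] norm_power)
      moreover have "ln (\<Prod>a\<in>Z. norm (?z - a) ^ m a) = (\<Sum>a\<in>Z. ln (norm (?z - a) ^ m a))"
        by (rule ln_prod) (use finZ elim in auto)
      moreover have "ln (norm (?z - a) ^ m a) = real (m a) * ln (norm (?z - a))" if "a \<in> Z" for a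
        by (simp add: ln_realpow)
      moreover have "(\<Prod>a\<in>Z. norm (?z - a) ^ m a) \<noteq> 0" using finZ elim by auto
      ultimately show ?case using hR(3)[OF zR] by (simp add: ln_mult L_def)
    qed
  qed
  note ih = circle_mean_ln_norm_nonvanishing[OF hR(2,3) r hR(1)]
  note ia = circle_mean_ln_dist[OF r]
  have L_int: "integrable circle_measure L" unfolding L_def
    by (intro Bochner_Integration.integrable_add ih(1) Bochner_Integration.integrable_sum integrable_mult_right ia(1))
  have "integral\<^sup>L circle_measure L = (\<integral>t. ln (norm (h (of_real r * cis t))) \<partial>circle_measure) + (\<Sum>a\<in>Z. real (m a) * (2 * pi * ln (max r (norm a))))"
    unfolding L_def
    by (subst Bochner_Integration.integral_add)
      (auto intro!: ih(1) Bochner_Integration.integrable_sum integrable_mult_right ia(1)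
        simp: ia Bochner_Integration.integral_sum)
  also note ih(2)
  also have "(\<Sum>a\<in>Z. real (m a) * (2 * pi * ln (max r (norm a)))) = (\<Sum>a\<in>Z. real (m a) * (2 * pi * ln r))"
    by (intro sum.cong) (auto simp: Z_def max_def)
  also have "\<dots> = 2 * pi * (real (m 0) * ln r + (\<Sum>a\<in>Z'. real (m a) * ln r))"
    unfolding ssum by (simp add: algebra_simps sum_distrib_left)
  also have "(\<Sum>a\<in>Z'. real (m a) * ln r) = (\<Sum>a\<in>Z'. real (m a) * ln (norm a)) + (\<Sum>a\<in>Z'. real (m a) * ln (r / norm a))"
    unfolding sum.distrib[symmetric] using r
    by (intro sum.cong refl) (auto simp: Z'_def ln_div algebra_simps)
  finally have L_val: "integral\<^sup>L circle_measure L =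
      2 * pi * (ln (norm c) + real (m 0) * ln r + (\<Sum>a\<in>Z'. real (m a) * ln (r / norm a)))"
    unfolding ln_c by (simp add: algebra_simps)
  have meas: "(\<lambda>t. ln (norm (G (of_real r * cis t)))) \<in> borel_measurable circle_measure"
  proof (rule borel_measurable_circle_measure)
    have "(\<lambda>t. norm (G (of_real r * cis t))) \<in> borel_measurable borel"
      by (intro borel_measurable_continuous_onI continuous_intros
          continuous_on_compose2[OF holomorphic_on_imp_continuous_on[OF G]]) auto
    then show "(\<lambda>t. ln (norm (G (of_real r * cis t)))) \<in> borel_measurable borel" by measurable
  qed
  have Lm: "L \<in> borel_measurable circle_measure" using L_int by auto
  show "integrable circle_measure (\<lambda>t. ln (norm (G (of_real r * cis t))))"
    using integrable_cong_AE[OF meas Lm ae] L_int by simp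
  show "(\<integral>t. ln (norm (G (of_real r * cis t))) \<partial>circle_measure) =
      2 * pi * (ln (norm c) + real (nat (zorder G 0)) * ln r +
        (\<Sum>a | 0 < norm a \<and> norm a \<le> r \<and> G a = 0. real (nat (zorder G a)) * ln (r / norm a)))"
    using integral_cong_AE[OF meas Lm ae] L_val unfolding Z'_eq m_def by simp
qed

text \<open>Averaging the bound over \<open>\<theta>\<close> and exchanging the integrals turns the pencil into its maximum.\<close>

lemma circle_mean_pencil_le:
  fixes G H :: "real \<Rightarrow> complex"
  assumes G: "continuous_on UNIV G" and H: "continuous_on UNIV H" and nz: "\<And>t. G t \<noteq> 0 \<or> H t \<noteq> 0"
    and s: "s > 0" and B: "\<And>\<theta>. (\<integral>t. ln (norm (G t - of_real s * cis \<theta> * H t)) \<partial>circle_measure) \<le> B"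
  shows "integrable circle_measure (\<lambda>t. ln (max (norm (G t)) (s * norm (H t))))"
    and "(\<integral>t. ln (max (norm (G t)) (s * norm (H t))) \<partial>circle_measure) \<le> B"
proof -
  let ?M = circle_measure
  interpret M: finite_measure ?M by (rule finite_measure_circle_measure)
  interpret pair_sigma_finite ?M ?M by standard
  define u where "u t \<theta> = ln (norm (G t - of_real s * cis \<theta> * H t))" for t \<theta>
  define \<Psi> where "\<Psi> t = ln (max (norm (G t)) (s * norm (H t)))" for t
  have max_pos: "0 < max (norm (G t)) (s * norm (H t))" for t
    using nz[of t] s by (auto simp: less_max_iff_disj)
  have \<Psi>_cont: "continuous_on {0..2*pi} \<Psi>"
    unfolding \<Psi>_def using max_pos
    by (intro continuous_intros continuous_on_subset[OF G] continuous_on_subset[OF H]) (auto simp: less_le)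
  show "integrable ?M (\<lambda>t. ln (max (norm (G t)) (s * norm (H t))))"
    using integrable_circle_measure_continuous[OF \<Psi>_cont] by (simp add: \<Psi>_def[abs_def])
  have "compact (\<Psi> ` {0..2*pi})" using \<Psi>_cont by (intro compact_continuous_image) auto
  then obtain K where K: "\<And>t. t \<in> {0..2*pi} \<Longrightarrow> \<bar>\<Psi> t\<bar> \<le> K"
    using compact_imp_bounded by (fastforce simp: bounded_iff)
  have K0: "0 \<le> K" using K[of 0] by auto
  have [measurable]: "G \<in> borel_measurable ?M" "H \<in> borel_measurable ?M" "cis \<in> borel_measurable ?M"
    by (auto intro!: borel_measurable_circle_measure borel_measurable_continuous_onI G H continuous_intros)
  have um [measurable]: "case_prod u \<in> borel_measurable (?M \<Otimes>\<^sub>M ?M)"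
    unfolding u_def by measurable
  have ui: "integrable ?M (u t)" and uv: "integral\<^sup>L ?M (u t) = 2 * pi * \<Psi> t" for t
    using circle_mean_ln_pencil[OF s nz[of t]] by (auto simp: u_def[abs_def] \<Psi>_def)
  define C where "C = K + ln 2"
  have u_le: "u t \<theta> \<le> C" if "t \<in> {0..2*pi}" for t \<theta>
  proof (cases "G t - of_real s * cis \<theta> * H t = 0")
    case True then show ?thesis using K0 by (simp add: u_def C_def)
  next
    case False
    have "norm (G t - of_real s * cis \<theta> * H t) \<le> norm (G t) + s * norm (H t)"
      using norm_triangle_ineq4[of "G t" "of_real s * cis \<theta> * H t"] s by (simp add: norm_mult)
    also have "\<dots> \<le> 2 * max (norm (G t)) (s * norm (H t))" by (simp add: max_def)
    finally have "u t \<theta> \<le> ln (2 * max (norm (G t)) (s * norm (H t)))"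
      unfolding u_def using False by (intro ln_mono) auto
    also have "\<dots> = ln 2 + \<Psi> t" using max_pos[of t] by (simp add: ln_mult \<Psi>_def)
    finally show ?thesis using K[OF that] by (auto simp: C_def)
  qed
  have C0: "0 \<le> C" using K0 by (simp add: C_def)
  have int: "integrable (?M \<Otimes>\<^sub>M ?M) (case_prod u)"
  proof (rule Fubini_integrable[OF um])
    show "AE t in ?M. integrable ?M (\<lambda>\<theta>. case (t, \<theta>) of (x, xa) \<Rightarrow> u x xa)"
      using ui by simp
    show "integrable ?M (\<lambda>t. \<integral>\<theta>. norm (case (t, \<theta>) of (x, xa) \<Rightarrow> u x xa) \<partial>?M)"
    proof (rule M.integrable_const_bound[where B="2 * pi * (2 * C) + 2 * pi * K"])
      show "(\<lambda>t. \<integral>\<theta>. norm (case (t, \<theta>) of (x, xa) \<Rightarrow> u x xa) \<partial>?M) \<in> borel_measurable ?M"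
        by measurable
      show "AE t in ?M. norm (\<integral>\<theta>. norm (case (t, \<theta>) of (x, xa) \<Rightarrow> u x xa) \<partial>?M) \<le> 2 * pi * (2 * C) + 2 * pi * K"
      proof (rule AE_I2)
        fix t assume "t \<in> space ?M"
        then have t: "t \<in> {0..2*pi}" by simp
        \<comment> \<open>There is no lower bound for u, which has logarithmic poles. From u \<le> C
          and 0 \<le> C one gets |u| \<le> 2 * C - u, whose mean over \<theta> is known exactly and
          is bounded in t.\<close>
        have "(\<integral>\<theta>. \<bar>u t \<theta>\<bar> \<partial>?M) \<le> (\<integral>\<theta>. 2 * C - u t \<theta> \<partial>?M)"
        proof (rule integral_mono)
          show "integrable ?M (\<lambda>\<theta>. \<bar>u t \<theta>\<bar>)" using ui by auto
          show "integrable ?M (\<lambda>\<theta>. 2 * C - u t \<theta>)" using ui by (intro Bochner_Integration.integrable_diff) auto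
          show "\<bar>u t \<theta>\<bar> \<le> 2 * C - u t \<theta>" for \<theta> using u_le[OF t, of \<theta>] C0 by linarith
        qed
        also have "\<dots> = 2 * pi * (2 * C) - 2 * pi * \<Psi> t"
          using ui[of t] uv[of t] by (subst Bochner_Integration.integral_diff)
            (auto simp: integral_const_circle_measure simp del: lebesgue_integral_const)
        also have "\<dots> \<le> 2 * pi * (2 * C) + 2 * pi * K"
        proof -
          have "2 * pi * (- \<Psi> t) \<le> 2 * pi * K" using K[OF t] by (intro mult_left_mono) auto
          then show ?thesis by simp
        qed
        finally show "norm (\<integral>\<theta>. norm (case (t, \<theta>) of (x, xa) \<Rightarrow> u x xa) \<partial>?M) \<le> 2 * pi * (2 * C) + 2 * pi * K"
          by simp
      qed
    qed
  qed
  have "2 * pi * (\<integral>t. \<Psi> t \<partial>?M) = (\<integral>t. (\<integral>\<theta>. u t \<theta> \<partial>?M) \<partial>?M)"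
    using uv by simp
  also have "\<dots> = (\<integral>\<theta>. (\<integral>t. u t \<theta> \<partial>?M) \<partial>?M)"
    by (rule Fubini_integral[OF int, symmetric])
  also have "\<dots> \<le> (\<integral>\<theta>. B \<partial>?M)"
  proof (rule integral_mono)
    show "integrable ?M (\<lambda>\<theta>. \<integral>t. u t \<theta> \<partial>?M)" by (rule integrable_snd[OF int])
    show "integrable ?M (\<lambda>\<theta>. B)" by simp
    show "(\<integral>t. u t \<theta> \<partial>?M) \<le> B" for \<theta> unfolding u_def by (rule B)
  qed
  also have "\<dots> = 2 * pi * B" by (rule integral_const_circle_measure)
  finally show "(\<integral>t. ln (max (norm (G t)) (s * norm (H t))) \<partial>?M) \<le> B"
    by (simp add: \<Psi>_def[abs_def])
qed

section \<open>The order of growth and the number of preimages\<close>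

text \<open>The integrand is a sum of step functions divided by t; a pole p contributes the integral
  of 1/t from |p| to r. This is the shape in which the zeros appear in Jensen's formula.\<close>

lemma counting_N_eq:
  assumes f: "merom_plane f" and r: "r > 0"
  shows "counting_N f r = (\<Sum>p | is_pole f p \<and> 0 < norm p \<and> norm p \<le> r. real (nat (- zorder f p)) * ln (r / norm p))
     + pole_count f 0 * ln r"
proof -
  define P where "P = {p. is_pole f p \<and> 0 < norm p \<and> norm p \<le> r}"
  define m where "m p = real (nat (- zorder f p))" for p
  have finP: "finite P" unfolding P_def by (rule finite_subset[OF _ finite_poles_cball[OF f, of r]]) auto
  \<comment> \<open>At t = 0 both sides vanish: every p in P has positive modulus, and the quotient
    on the right is 0/0 = 0.\<close>
  have eq: "(\<Sum>p\<in>P. m p * (if t \<in> {norm p..r} then 1 / t else 0)) = (pole_count f t - pole_count f 0) / t"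
    if t: "t \<in> {0..r}" for t
  proof -
    let ?A = "{p. is_pole f p \<and> norm p \<le> t}" and ?B = "{p. is_pole f p \<and> norm p \<le> 0}"
    have "pole_count f t = sum m (?A - ?B) + sum m ?B"
      unfolding pole_count_def m_def[symmetric] using t
      by (intro sum.subset_diff finite_poles_cball[OF f]) auto
    moreover have "?A - ?B = {p\<in>P. norm p \<le> t}" using t by (auto simp: P_def)
    ultimately have "pole_count f t - pole_count f 0 = (\<Sum>p | p \<in> P \<and> norm p \<le> t. m p)"
      unfolding pole_count_def m_def by simp
    also have "\<dots> = (\<Sum>p\<in>P. if norm p \<le> t then m p else 0)"
      by (rule sum.inter_filter[OF finP])
    finally show ?thesis using t
      by (auto simp: sum_divide_distrib intro!: sum.cong)
  qed
  have "((\<lambda>t. if t \<in> {norm p..r} then 1 / t else 0) has_integral ln (r / norm p)) {0..r}" if p: "p \<in> P" for p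
  proof -
    have pr: "0 < norm p" "norm p \<le> r" using p by (auto simp: P_def)
    have "((\<lambda>t. 1 / t) has_integral (ln r - ln (norm p))) {norm p..r}"
    proof (rule fundamental_theorem_of_calculus[OF pr(2)])
      fix x assume "x \<in> {norm p..r}"
      then have "0 < x" using pr(1) unfolding atLeastAtMost_iff by linarith
      then have "(ln has_real_derivative 1 / x) (at x within {norm p..r})"
        by (auto intro!: derivative_eq_intros)
      then show "(ln has_vector_derivative 1 / x) (at x within {norm p..r})"
        by (simp add: has_real_derivative_iff_has_vector_derivative)
    qed
    then show ?thesis
      using pr r by (subst has_integral_restrict) (auto simp: ln_div)
  qed
  then have "((\<lambda>t. \<Sum>p\<in>P. m p * (if t \<in> {norm p..r} then 1 / t else 0)) has_integral (\<Sum>p\<in>P. m p * ln (r / norm p))) {0..r}"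
    by (intro has_integral_sum finP has_integral_mult_right)
  then have "((\<lambda>t. (pole_count f t - pole_count f 0) / t) has_integral (\<Sum>p\<in>P. m p * ln (r / norm p))) {0..r}"
    by (rule has_integral_eq[rotated]) (rule eq)
  then show ?thesis unfolding counting_N_def P_def m_def by (simp add: integral_unique)
qed

text \<open>Preimages of the sphere must stay away from 0 uniformly in the value; otherwise the
  terms ln (r / |a|) in Jensen's formula would not be controlled by their number. If 0 is a pole, f
  is large near it.\<close>

lemma values_near_zero_avoid_sphere:
  assumes f: "merom_plane f" and f0: "0 \<notin> poles f \<Longrightarrow> f 0 \<notin> sphere b s"
  obtains r0 where "0 < r0" "r0 \<le> 1" "\<And>a. norm a < r0 \<Longrightarrow> a \<notin> poles f \<Longrightarrow> f a \<notin> sphere b s"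
proof -
  have "eventually (\<lambda>a. a \<notin> poles f \<longrightarrow> f a \<notin> sphere b s) (nhds 0)"
  proof (cases "0 \<in> poles f")
    case False
    have "isCont f 0" by (rule analytic_at_imp_isCont[OF analytic_at_not_pole[OF f False]])
    then have "(f \<longlongrightarrow> f 0) (nhds 0)" by (simp add: isCont_def tendsto_at_iff_tendsto_nhds)
    then have "eventually (\<lambda>a. f a \<in> - sphere b s) (nhds 0)"
      by (rule topological_tendstoD) (use f0[OF False] in auto)
    then show ?thesis by (rule eventually_mono) auto
  next
    case True
    then have "filterlim f at_infinity (at 0)" by (simp add: poles_def is_pole_def)
    then have "eventually (\<lambda>a. norm b + \<bar>s\<bar> + 1 \<le> norm (f a)) (at 0)"
      by (rule filterlim_at_infinity_imp_norm_at_top[THEN filterlim_at_top[THEN iffD1, THEN spec]])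
    then have "eventually (\<lambda>a. a \<noteq> 0 \<longrightarrow> norm b + \<bar>s\<bar> + 1 \<le> norm (f a)) (nhds 0)"
      by (simp add: eventually_at_filter)
    then show ?thesis
    proof (rule eventually_mono, intro impI notI)
      fix a assume a: "a \<noteq> 0 \<longrightarrow> norm b + \<bar>s\<bar> + 1 \<le> norm (f a)" "a \<notin> poles f" "f a \<in> sphere b s"
      have "norm (f a) \<le> norm b + dist b (f a)"
        by (metis dist_norm norm_minus_commute norm_triangle_sub)
      then show False using a True by auto
    qed
  qed
  then obtain d where d: "d > 0" "\<And>a. dist a 0 < d \<Longrightarrow> a \<notin> poles f \<longrightarrow> f a \<notin> sphere b s"
    unfolding eventually_nhds_metric by blast
  then show ?thesis by (intro that[of "min d 1"]) auto
qed

text \<open>Cartan's averaging. With f = g / f2 for entire g and f2 without common zeros, the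
  proximity function is at most a constant plus the mean of ln (max |g - b * f2| (s * |f2|)) minus
  the mean of ln |f2|. By Jensen the latter mean is the counting function plus a constant, so it
  cancels in the characteristic. The mean of the maximum is the average over w on the sphere of
  Jensen's formula for g - w * f2, whose zeros are simple by \<open>crit\<close>, so that
  cardinalities suffice. Quantifying over r and n inside the conclusion keeps r0 and C independent
  of them.\<close>

lemma nevanlinna_T_bound:
  assumes f: "merom_plane f" and s: "s > 0" and f0: "0 \<notin> poles f \<Longrightarrow> f 0 \<notin> sphere b s"
    and crit: "\<And>z. z \<notin> poles f \<Longrightarrow> f z \<in> sphere b s \<Longrightarrow> deriv f z \<noteq> 0"
  obtains r0 C where "0 < r0" "r0 \<le> 1"
    "\<forall>r n. r \<ge> 1 \<longrightarrow> (\<forall>w\<in>sphere b s. real (card {a. a \<notin> poles f \<and> f a = w \<and> norm a \<le> r}) \<le> n) \<longrightarrow>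
       0 \<le> nevanlinna_T f r \<and> nevanlinna_T f r \<le> C + n * ln (r / r0)"
proof -
  have "f nicely_meromorphic_on UNIV" using f by (simp add: merom_plane_def)
  then obtain h f1 f2 where W: "h holomorphic_on UNIV" "f1 holomorphic_on UNIV" "f2 holomorphic_on UNIV"
    "\<forall>z. f1 z = 0 \<longleftrightarrow> \<not>is_pole f z \<and> f z = 0"
    "\<forall>z. f2 z = 0 \<longleftrightarrow> is_pole f z"
    "\<forall>z. \<not>is_pole f z \<longrightarrow> zorder f1 z = zorder f z"
    "\<forall>z. is_pole f z \<longrightarrow> zorder f2 z = -zorder f z"
    "\<forall>z. h z \<noteq> 0" "\<forall>z. f z = h z * f1 z / f2 z"
    by (rule weierstrass_factorization_meromorphic_UNIV)
  define g where "g z = h z * f1 z" for z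
  have g_hol: "g holomorphic_on UNIV" unfolding g_def using W by (intro holomorphic_intros)
  have f_eq: "f z = g z / f2 z" for z using W(9) by (simp add: g_def)
  have f2_0: "f2 z = 0 \<longleftrightarrow> z \<in> poles f" for z using W(5) by (simp add: poles_def)
  have no_common: "g z \<noteq> 0" if "f2 z = 0" for z using that W(4,5,8) by (auto simp: g_def)
  have "\<exists>\<beta>. f2 \<beta> \<noteq> 0"
  proof (rule ccontr)
    assume "\<not> ?thesis"
    then have "{p. is_pole f p \<and> norm p \<le> 1} = cball 0 1" using W(5) by auto
    then have "finite (cball (0::complex) 1)" using finite_poles_cball[OF f, of 1] by simp
    then show False using uncountable_cball[of 1 "0::complex"] uncountable_infinite by auto
  qed
  then obtain \<beta> where \<beta>: "f2 \<beta> \<noteq> 0" by blast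
  have an: "k analytic_on {z}" if "k holomorphic_on UNIV" for k :: "complex \<Rightarrow> complex" and z
    using that by (simp add: analytic_on_holomorphic) blast
  have ev2: "eventually (\<lambda>w. f2 w \<noteq> 0) (at z)" for z
    using non_zero_neighbour_alt[OF W(3) _ _ _ _ \<beta>, of z] by (auto elim: eventually_mono)
  have freq2: "frequently (\<lambda>w. f2 w \<noteq> 0) (at z)" for z
    using ev2 by (rule eventually_frequently[rotated]) auto
  obtain c2 where c2: "c2 \<noteq> 0" "((\<lambda>z. f2 z / z ^ nat (zorder f2 0)) \<longlongrightarrow> c2) (at 0)"
  proof -
    have iso: "isolated_singularity_at f2 0" "not_essential f2 0"
      using an[OF W(3)] by (auto intro: isolated_singularity_at_analytic not_essential_analytic)
    from zorder_exist[OF iso freq2] obtain e where e: "zor_poly f2 0 0 \<noteq> 0" "e > 0"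
      "zor_poly f2 0 holomorphic_on cball 0 e"
      "\<And>w. w \<in> cball 0 e - {0} \<Longrightarrow> f2 w = zor_poly f2 0 w * (w - 0) powi zorder f2 0" by blast
    have zo: "zorder f2 0 \<ge> 0" by (rule zorder_ge_0[OF an[OF W(3)] freq2])
    have "isCont (zor_poly f2 0) 0" using e(2,3)
      by (intro continuous_on_interior[of "cball 0 e"] holomorphic_on_imp_continuous_on) auto
    then have "(zor_poly f2 0 \<longlongrightarrow> zor_poly f2 0 0) (at 0)" by (simp add: isCont_def)
    moreover have "eventually (\<lambda>z. zor_poly f2 0 z = f2 z / z ^ nat (zorder f2 0)) (at 0)"
    proof -
      have "eventually (\<lambda>z. z \<in> ball 0 e - {0}) (at (0::complex))" using e(2) by (intro eventually_at_in_open) auto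
      then show ?thesis
      proof eventually_elim
        case (elim z)
        then have "f2 z = zor_poly f2 0 z * (z - 0) powi zorder f2 0" by (intro e(4)) auto
        then show ?case using elim zo by (auto simp: power_int_def)
      qed
    qed
    ultimately have "((\<lambda>z. f2 z / z ^ nat (zorder f2 0)) \<longlongrightarrow> zor_poly f2 0 0) (at 0)"
      by (rule Lim_transform_eventually)
    then show ?thesis using that e(1) by blast
  qed
  obtain r0 where r0: "0 < r0" "r0 \<le> 1" "\<And>a. norm a < r0 \<Longrightarrow> a \<notin> poles f \<Longrightarrow> f a \<notin> sphere b s"
    using values_near_zero_avoid_sphere[OF f f0] by blast
  define G where "G w z = g z - w * f2 z" for w z
  have G_hol: "G w holomorphic_on UNIV" for w unfolding G_def using g_hol W(3) by (intro holomorphic_intros)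
  have G_0: "G w a = 0 \<longleftrightarrow> a \<notin> poles f \<and> f a = w" for w a
    using no_common[of a] by (auto simp: G_def f_eq f2_0[symmetric] field_simps)
  have G_zorder: "zorder (G w) a = 1" if w: "w \<in> sphere b s" and a: "G w a = 0" for w a
  proof -
    have a': "a \<notin> poles f" "f a = w" using a G_0 by auto
    have df: "(f has_field_derivative deriv f a) (at a)"
      using a' holomorphic_on_compl_poles[OF f] open_compl_poles[OF f] by (auto intro: holomorphic_derivI)
    have df2: "(f2 has_field_derivative deriv f2 a) (at a)"
      using W(3) by (auto intro: holomorphic_derivI)
    have "((\<lambda>z. (f z - w) * f2 z) has_field_derivative deriv f a * f2 a) (at a)"
      using a' by (auto intro!: derivative_eq_intros df df2)
    moreover have "(f z - w) * f2 z = G w z" if "z \<in> - poles f" for z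
      using that by (simp add: G_def f_eq f2_0 field_simps)
    ultimately have "(G w has_field_derivative deriv f a * f2 a) (at a)"
      using a' open_compl_poles[OF f]
      by (rule_tac has_field_derivative_transform_within_open[of "\<lambda>z. (f z - w) * f2 z" _ a "- poles f"]) auto
    then have "deriv (G w) a = deriv f a * f2 a" by (rule DERIV_imp_deriv)
    also have "\<dots> \<noteq> 0" using a' crit[of a] w f2_0 by auto
    finally have "deriv (G w) a \<noteq> 0" .
    then show ?thesis
      by (intro zorder_zero_eqI[OF G_hol[of w] open_UNIV]) (auto simp: a)
  qed
  \<comment> \<open>Bounds |g 0 - w * f2 0| for all w on the sphere, since |w| \<le> |b| +
    s.\<close>
  define K where "K = norm (g 0) + (norm b + s) * norm (f2 0) + 1"
  have K: "K \<ge> 1" using s by (simp add: K_def)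
  \<comment> \<open>With m the maximum of |g - b * f2| and s * |f2|, one has |g| \<le> m * (1 +
    |b|/s) and |f2| \<le> m/s. The argument of ln dominates both factors, so one constant serves
    both arguments of the maximum in \<open>ln_plus\<close>.\<close>
  define C2 where "C2 = ln (1 + norm b / s + 1 / s)"
  define C where "C = C2 + ln K - ln (norm c2)"
  show ?thesis
  proof (rule that[OF r0(1,2), of C], intro allI impI)
    fix r :: real and n :: real
    assume r1: "r \<ge> 1" and count: "\<forall>w\<in>sphere b s. real (card {a. a \<notin> poles f \<and> f a = w \<and> norm a \<le> r}) \<le> n"
    have r: "r > 0" using r1 by simp
    have lnr: "0 \<le> ln (r / r0)" using r1 r0 by simp
    have bound: "(\<integral>t. ln (norm (G w (of_real r * cis t))) \<partial>circle_measure) \<le> 2 * pi * (ln K + n * ln (r / r0))"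
      if w: "w \<in> sphere b s" for w
    proof -
      have "G w 0 \<noteq> 0" using G_0 w f0 by auto
      have zo0: "zorder (G w) 0 = 0" using \<open>G w 0 \<noteq> 0\<close> zorder_eq_0I[OF an[OF G_hol]] by blast
      have "isCont (G w) 0" using an[OF G_hol] by (rule analytic_at_imp_isCont)
      then have lim: "((\<lambda>z. G w z / z ^ nat (zorder (G w) 0)) \<longlongrightarrow> G w 0) (at 0)"
        by (simp add: zo0 isCont_def)
      let ?Z = "{a. 0 < norm a \<and> norm a \<le> r \<and> G w a = 0}"
      have "(\<Sum>a\<in>?Z. real (nat (zorder (G w) a)) * ln (r / norm a)) \<le> (\<Sum>a\<in>?Z. ln (r / r0))"
      proof (rule sum_mono)
        fix a assume a: "a \<in> ?Z"
        then have "r0 \<le> norm a" using r0(3)[of a] G_0[of w a] w by (cases "norm a < r0") auto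
        then have "r / norm a \<le> r / r0" using r r0(1) by (intro divide_left_mono mult_pos_pos) auto
        then have "ln (r / norm a) \<le> ln (r / r0)" using a r by (intro ln_mono) auto
        then show "real (nat (zorder (G w) a)) * ln (r / norm a) \<le> ln (r / r0)"
          using G_zorder[OF w] a by simp
      qed
      also have "\<dots> = real (card ?Z) * ln (r / r0)" by simp
      also have "\<dots> \<le> n * ln (r / r0)"
      proof (rule mult_right_mono[OF _ lnr])
        have "?Z \<subseteq> {a. norm a \<le> r \<and> G w a = 0}" by auto
        moreover have "finite {a. norm a \<le> r \<and> G w a = 0}"
          using finite_zeros_entire[OF G_hol \<open>G w 0 \<noteq> 0\<close>] .
        moreover have "{a. norm a \<le> r \<and> G w a = 0} = {a. a \<notin> poles f \<and> f a = w \<and> norm a \<le> r}"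
          using G_0 by auto
        ultimately show "real (card ?Z) \<le> n"
          using bspec[OF count w] card_mono[of "{a. norm a \<le> r \<and> G w a = 0}" ?Z] by simp
      qed
      finally have S: "(\<Sum>a\<in>?Z. real (nat (zorder (G w) a)) * ln (r / norm a)) \<le> n * ln (r / r0)" .
      have "norm w \<le> norm b + s"
        using w norm_triangle_sub[of w b] by (auto simp: dist_norm norm_minus_commute)
      then have "norm w * norm (f2 0) \<le> (norm b + s) * norm (f2 0)" by (rule mult_right_mono) simp
      then have "norm (G w 0) \<le> K"
        using norm_triangle_ineq4[of "g 0" "w * f2 0"] by (simp add: G_def K_def norm_mult)
      then have "ln (norm (G w 0)) \<le> ln K" using \<open>G w 0 \<noteq> 0\<close> by (intro ln_mono) auto
      then show ?thesis
        unfolding jensen_formula(2)[OF G_hol \<open>G w 0 \<noteq> 0\<close> lim r]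
        using S zo0 by (intro mult_left_mono) auto
    qed
    define A where "A t = g (of_real r * cis t) - b * f2 (of_real r * cis t)" for t
    define H where "H t = f2 (of_real r * cis t)" for t
    define \<Psi> where "\<Psi> t = ln (max (norm (A t)) (s * norm (H t)))" for t
    have contc: "continuous_on UNIV (\<lambda>t. k (of_real r * cis t))" if "k holomorphic_on UNIV" for k :: "complex \<Rightarrow> complex"
      by (intro continuous_on_compose2[OF holomorphic_on_imp_continuous_on[OF that]] continuous_intros) auto
    have cont: "continuous_on UNIV A" "continuous_on UNIV H"
      unfolding A_def H_def by (intro continuous_intros contc g_hol W(3))+
    have nz: "A t \<noteq> 0 \<or> H t \<noteq> 0" for t using no_common by (auto simp: A_def H_def)
    have \<Psi>B: "(\<integral>t. ln (norm (A t - of_real s * cis \<theta> * H t)) \<partial>circle_measure) \<le> 2 * pi * (ln K + n * ln (r / r0))" for \<theta>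
    proof -
      have "A t - of_real s * cis \<theta> * H t = G (b + of_real s * cis \<theta>) (of_real r * cis t)" for t
        by (simp add: A_def H_def G_def algebra_simps)
      then show ?thesis using bound[of "b + of_real s * cis \<theta>"] s by (simp add: dist_norm norm_mult)
    qed
    note \<Psi>i = circle_mean_pencil_le[OF cont nz s \<Psi>B, folded \<Psi>_def]
    note j2 = jensen_formula[OF W(3) c2 r]
    \<comment> \<open>A majorant of \<open>ln_plus\<close> of |f| wherever f2 does not vanish. The
      term with H produces the negative of the counting function after averaging.\<close>
    define X where "X t = C2 + \<Psi> t - ln (norm (H t))" for t
    interpret M: finite_measure circle_measure by (rule finite_measure_circle_measure)
    have X_int: "integrable circle_measure X"
      unfolding X_def H_def by (intro Bochner_Integration.integrable_diff Bochner_Integration.integrable_add M.integrable_const \<Psi>i j2)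
    have X_val: "integral\<^sup>L circle_measure X = 2 * pi * C2 + integral\<^sup>L circle_measure \<Psi> - (\<integral>t. ln (norm (H t)) \<partial>circle_measure)"
      unfolding X_def H_def using j2(1) \<Psi>i(1)
      by (simp add: integral_const_circle_measure del: lebesgue_integral_const)
    define Y where "Y t = ln_plus (norm (f (of_real r * cis t)))" for t
    have Y_le: "Y t \<le> X t" if "H t \<noteq> 0" for t
    proof -
      let ?z = "of_real r * cis t" let ?m = "max (norm (A t)) (s * norm (H t))"
      have Hm: "norm (H t) \<le> ?m / s" using s by (simp add: field_simps)
      have mpos: "0 < ?m" using that s by (simp add: less_max_iff_disj)
      have "norm (g ?z) \<le> norm (A t) + norm b * norm (H t)"
        using norm_triangle_ineq[of "A t" "b * H t"] by (simp add: A_def H_def norm_mult)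
      also have "\<dots> \<le> ?m + norm b * (?m / s)" using Hm by (intro add_mono mult_left_mono) auto
      finally have g_le: "norm (g ?z) \<le> ?m * (1 + norm b / s)" by (simp add: algebra_simps)
      have c_pos: "0 < 1 + norm b / s + 1 / s" using s by (simp add: add_pos_nonneg)
      have le1: "norm (g ?z) \<le> ?m * (1 + norm b / s + 1 / s)"
        using g_le mpos s by (simp add: algebra_simps) (smt (verit) divide_nonneg_pos)
      have le2: "norm (H t) \<le> ?m * (1 + norm b / s + 1 / s)"
        using Hm mpos s by (simp add: algebra_simps) (smt (verit) divide_nonneg_pos mult_nonneg_nonneg norm_ge_zero)
      have ln_eq: "ln (?m * (1 + norm b / s + 1 / s)) = \<Psi> t + C2"
        using mpos c_pos by (simp add: ln_mult \<Psi>_def C2_def)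
      have fz: "norm (f ?z) = norm (g ?z) / norm (H t)" by (simp add: f_eq H_def norm_divide)
      have "0 \<le> X t"
        using ln_mono[OF le2] that ln_eq by (simp add: X_def)
      moreover have "ln (norm (f ?z)) \<le> X t"
      proof (cases "g ?z = 0")
        case True then show ?thesis using \<open>0 \<le> X t\<close> by (simp add: fz)
      next
        case False
        then have "ln (norm (f ?z)) = ln (norm (g ?z)) - ln (norm (H t))"
          using that by (simp add: fz ln_div)
        then show ?thesis using ln_mono[OF le1] False ln_eq by (simp add: X_def)
      qed
      ultimately show ?thesis by (simp add: Y_def ln_plus_def)
    qed
    have H_ae: "AE t in circle_measure. H t \<noteq> 0"
    proof -
      have "finite {a. norm a \<le> r \<and> f2 a = 0}" by (rule finite_zeros_entire[OF W(3) \<beta>])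
      then have "AE t in circle_measure. \<forall>a\<in>{a. norm a \<le> r \<and> f2 a = 0}. of_real r * cis t \<noteq> a"
        by (intro AE_finite_allI AE_circle_measure_neq r)
      then show ?thesis
      proof eventually_elim
        case (elim t)
        have "norm (of_real r * cis t) \<le> r" using r by (simp add: norm_mult)
        then show ?case using elim unfolding H_def by blast
      qed
    qed
    have Y_nonneg: "0 \<le> Y t" for t by (simp add: Y_def ln_plus_def)
    have Y_meas: "Y \<in> borel_measurable circle_measure"
    proof (rule borel_measurable_circle_measure)
      have "(\<lambda>t. g (of_real r * cis t)) \<in> borel_measurable borel" "(\<lambda>t. f2 (of_real r * cis t)) \<in> borel_measurable borel"
        by (intro borel_measurable_continuous_onI contc g_hol W(3))+
      then show "Y \<in> borel_measurable borel" unfolding Y_def ln_plus_def f_eq by measurable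
    qed
    have Y_int: "integrable circle_measure Y"
    proof (rule Bochner_Integration.integrable_bound[OF X_int Y_meas])
      show "AE t in circle_measure. norm (Y t) \<le> norm (X t)"
        using H_ae by eventually_elim (use Y_le Y_nonneg in \<open>force simp: abs_le_iff\<close>)
    qed
    have prox: "proximity_m f r = integral\<^sup>L circle_measure Y / (2 * pi)"
      unfolding proximity_m_def using integral_circle_measure(2)[OF Y_int] by (simp add: Y_def[abs_def])
    have "integral\<^sup>L circle_measure Y \<le> integral\<^sup>L circle_measure X"
      by (rule integral_mono_AE[OF Y_int X_int]) (use H_ae Y_le in \<open>auto elim: eventually_mono\<close>)
    also have "\<dots> \<le> 2 * pi * C2 + 2 * pi * (ln K + n * ln (r / r0)) - (\<integral>t. ln (norm (H t)) \<partial>circle_measure)"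
      unfolding X_val using \<Psi>i(2) by simp
    finally have Y_bound: "proximity_m f r \<le> C2 + ln K + n * ln (r / r0) - (\<integral>t. ln (norm (H t)) \<partial>circle_measure) / (2 * pi)"
      unfolding prox by (simp add: field_simps)
    let ?Z2 = "{a. 0 < norm a \<and> norm a \<le> r \<and> f2 a = 0}"
    have pc0: "pole_count f 0 = real (nat (zorder f2 0))"
    proof (cases "is_pole f 0")
      case True
      then have e: "{p. is_pole f p \<and> norm p \<le> 0} = {0}" by auto
      show ?thesis using W(7) True unfolding pole_count_def e by simp
    next
      case False
      then have e: "{p. is_pole f p \<and> norm p \<le> 0} = {}" by auto
      have "zorder f2 0 = 0" using False W(5) by (intro zorder_eq_0I an[OF W(3)]) auto
      then show ?thesis unfolding pole_count_def e by simp
    qed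
    have N: "counting_N f r = (\<Sum>a\<in>?Z2. real (nat (zorder f2 a)) * ln (r / norm a)) + real (nat (zorder f2 0)) * ln r"
      unfolding counting_N_eq[OF f r] pc0
      using W(5,7) by (intro arg_cong2[where f="(+)"] refl sum.cong) auto
    have "counting_N f r \<ge> 0" unfolding N
      using r1 by (intro add_nonneg_nonneg sum_nonneg mult_nonneg_nonneg) auto
    moreover have "proximity_m f r \<ge> 0" unfolding prox
      using Y_nonneg by (intro divide_nonneg_pos Bochner_Integration.integral_nonneg) auto
    moreover have "(\<integral>t. ln (norm (H t)) \<partial>circle_measure) / (2 * pi) = ln (norm c2) + counting_N f r"
      unfolding H_def j2(2) N by simp
    ultimately show "0 \<le> nevanlinna_T f r \<and> nevanlinna_T f r \<le> C + n * ln (r / r0)"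
      using Y_bound by (simp add: nevanlinna_T_def C_def)
  qed
qed

text \<open>The characteristic is at most C + D * r^u * ln (r / r0), and the logarithm is absorbed
  by any \<eta> > 0 added to the exponent.\<close>

lemma merom_order_le:
  assumes f: "merom_plane f" and s: "s > 0" and f0: "0 \<notin> poles f \<Longrightarrow> f 0 \<notin> sphere b s"
    and crit: "\<And>z. z \<notin> poles f \<Longrightarrow> f z \<in> sphere b s \<Longrightarrow> deriv f z \<noteq> 0"
    and D: "D > 0" and u: "u > 0"
    and count: "\<And>w r. w \<in> sphere b s \<Longrightarrow> r \<ge> 1 \<Longrightarrow>
        real (card {a. a \<notin> poles f \<and> f a = w \<and> norm a \<le> r}) \<le> D * r powr u"
  shows "merom_order f \<le> ereal u"
proof -
  obtain r0 C where T: "0 < r0" "r0 \<le> 1"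
    "\<forall>r n. r \<ge> 1 \<longrightarrow> (\<forall>w\<in>sphere b s. real (card {a. a \<notin> poles f \<and> f a = w \<and> norm a \<le> r}) \<le> n) \<longrightarrow>
       0 \<le> nevanlinna_T f r \<and> nevanlinna_T f r \<le> C + n * ln (r / r0)"
    by (rule nevanlinna_T_bound[OF f s f0 crit])
  have "merom_order f \<le> ereal (u + \<eta>)" if \<eta>: "\<eta> > 0" for \<eta>
    unfolding merom_order_def
  proof (rule Limsup_bounded)
    have "eventually (\<lambda>r. C + (D * r powr u) * ln (r / r0) \<le> r powr (u + \<eta>)) at_top"
      using D u \<eta> T(1) by real_asymp
    moreover have "eventually (\<lambda>r::real. r > 1) at_top" by (rule eventually_gt_at_top)
    ultimately show "eventually (\<lambda>r. ereal (ln (nevanlinna_T f r) / ln r) \<le> ereal (u + \<eta>)) at_top"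
    proof eventually_elim
      case (elim r)
      have T': "0 \<le> nevanlinna_T f r" "nevanlinna_T f r \<le> r powr (u + \<eta>)"
        using T(3)[rule_format, of r "D * r powr u"] count[of _ r] elim by auto
      \<comment> \<open>A vanishing characteristic is treated separately because monotonicity of ln
        needs a positive argument; there \<open>ln 0 = 0\<close> is harmless.\<close>
      have "ln (nevanlinna_T f r) \<le> (u + \<eta>) * ln r"
      proof (cases "nevanlinna_T f r = 0")
        case True then show ?thesis using elim u \<eta> by simp
      next
        case False
        then have "ln (nevanlinna_T f r) \<le> ln (r powr (u + \<eta>))" using T' by (intro ln_mono) auto
        then show ?thesis using elim by (simp add: ln_powr)
      qed
      then show ?case using elim by (simp add: field_simps)
    qed
  qed
  then show ?thesis
    using ereal_le_epsilon2[of "merom_order f" "ereal u"] by simp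
qed

section \<open>Nonautonomous iterated function systems\<close>

text \<open>The maps change with time n, but the alphabet I and the lower bounds a do not, so one
  Bernoulli measure fits all times. The gap between the domain of radius 2 * s and the image disk of
  radius s/4 yields contraction without any upper bound on derivatives being assumed.\<close>

locale nonaut_ifs =
  fixes \<Phi> :: "nat \<Rightarrow> 'i \<Rightarrow> complex \<Rightarrow> complex" and I :: "'i set" and b :: complex and s :: real and a :: "'i \<Rightarrow> real"
  assumes s: "s > 0" and fin: "finite I" and a_pos: "\<And>i. i \<in> I \<Longrightarrow> a i > 0"
    and hol: "\<And>n i. i \<in> I \<Longrightarrow> \<Phi> n i holomorphic_on ball b (2 * s)"
    and inj: "\<And>n i. i \<in> I \<Longrightarrow> inj_on (\<Phi> n i) (ball b (2 * s))"
    and img: "\<And>n i x. i \<in> I \<Longrightarrow> x \<in> ball b (2 * s) \<Longrightarrow> \<Phi> n i x \<in> ball b (s / 4)"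
    and der: "\<And>n i x. i \<in> I \<Longrightarrow> x \<in> ball b (2 * s) \<Longrightarrow> a i \<le> norm (deriv (\<Phi> n i) x)"
    and disj: "\<And>n i j x y. \<lbrakk>i \<in> I; j \<in> I; x \<in> ball b (2 * s); y \<in> ball b (2 * s); \<Phi> n i x = \<Phi> n j y\<rbrakk> \<Longrightarrow> i = j"
begin

text \<open>Cauchy's inequality on a circle of radius s/2, on which the map stays within s/4 of
  b.\<close>

lemma deriv_le_half:
  assumes i: "i \<in> I" and x: "x \<in> cball b s"
  shows "norm (deriv (\<Phi> n i) x) \<le> 1 / 2"
proof -
  have sub: "cball x (s/2) \<subseteq> ball b (2 * s)"
  proof
    fix y assume "y \<in> cball x (s/2)"
    then show "y \<in> ball b (2 * s)" using x s dist_triangle[of b y x] by auto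
  qed
  have h: "(\<lambda>w. \<Phi> n i w - b) holomorphic_on cball x (s/2)"
    by (intro holomorphic_intros holomorphic_on_subset[OF hol[OF i] sub])
  have "norm ((deriv ^^ 1) (\<lambda>w. \<Phi> n i w - b) x) \<le> fact 1 * (s/4) / (s/2) ^ 1"
  proof (rule Cauchy_inequality)
    show "(\<lambda>w. \<Phi> n i w - b) holomorphic_on ball x (s/2)" using h by (rule holomorphic_on_subset) auto
    show "continuous_on (cball x (s/2)) (\<lambda>w. \<Phi> n i w - b)" by (rule holomorphic_on_imp_continuous_on[OF h])
    fix y assume "norm (x - y) = s/2"
    then have "y \<in> ball b (2 * s)" using sub by (auto simp: dist_norm)
    from img[OF i this, of n] show "norm (\<Phi> n i y - b) \<le> s/4" by (simp add: dist_norm norm_minus_commute)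
  qed (use s in auto)
  moreover have "deriv (\<lambda>w. \<Phi> n i w - b) x = deriv (\<Phi> n i) x"
  proof -
    have "\<Phi> n i field_differentiable at x"
      by (rule holomorphic_on_imp_differentiable_at[OF hol[OF i]]) (use x s in auto)
    then show ?thesis by simp
  qed
  ultimately show ?thesis using s by simp
qed

lemma cball_sub: "cball b s \<subseteq> ball b (2 * s)" using s by auto

lemma maps_cball: "i \<in> I \<Longrightarrow> x \<in> cball b s \<Longrightarrow> \<Phi> n i x \<in> cball b s"
  using img[of i x n] cball_sub s by fastforce

lemma contraction:
  assumes "i \<in> I" "x \<in> cball b s" "y \<in> cball b s"
  shows "dist (\<Phi> n i x) (\<Phi> n i y) \<le> dist x y / 2"
proof -
  have "norm (\<Phi> n i x - \<Phi> n i y) \<le> 1 / 2 * norm (x - y)"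
  proof (rule field_differentiable_bound[of "cball b s"])
    fix z assume z: "z \<in> cball b s"
    then show "norm (deriv (\<Phi> n i) z) \<le> 1/2" using deriv_le_half assms by blast
    have "(\<Phi> n i has_field_derivative deriv (\<Phi> n i) z) (at z)"
      using holomorphic_derivI[OF hol[OF assms(1)] open_ball] z cball_sub by blast
    then show "(\<Phi> n i has_field_derivative deriv (\<Phi> n i) z) (at z within cball b s)"
      by (rule has_field_derivative_at_within)
  qed (use assms in auto)
  then show ?thesis by (simp add: dist_norm)
qed

lemma expansion:
  assumes "i \<in> I" "x \<in> cball b s" "y \<in> cball b s"
  shows "a i / 2 * dist x y \<le> dist (\<Phi> n i x) (\<Phi> n i y)"
  using univalent_lower_bound(2)[OF hol[OF assms(1)] inj[OF assms(1)] s a_pos[OF assms(1)] der[OF assms(1)] assms(2,3)] .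

text \<open>A disk of radius a i * s about \<open>\<Phi> n i x\<close> is covered by
  \<open>\<Phi> n i\<close>, and images with different indices are disjoint.\<close>

lemma separation:
  assumes "i \<in> I" "j \<in> I" "i \<noteq> j" "x \<in> cball b s" "y \<in> cball b s"
  shows "a i * s \<le> dist (\<Phi> n i x) (\<Phi> n j y)"
proof (rule ccontr)
  assume "\<not> ?thesis"
  then have "\<Phi> n j y \<in> ball (\<Phi> n i x) (a i * s)" by simp
  then obtain z where "z \<in> ball b (2 * s)" "\<Phi> n j y = \<Phi> n i z"
    using univalent_lower_bound(1)[OF hol[OF assms(1)] inj[OF assms(1)] s a_pos[OF assms(1)] der[OF assms(1)] assms(4), of n]
    by (meson imageE subsetD)
  then show False using disj[of j i y z n] assms cball_sub by auto
qed

lemma a_le_half: "i \<in> I \<Longrightarrow> a i \<le> 1 / 2"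
  using der[of i b 0] deriv_le_half[of i b 0] s by simp

text \<open>The composition of the maps at times k, ..., k + n - 1 with the earliest outermost. The
  recursion appends the innermost map, so estimates go by induction with x arbitrary;
  \<open>comp_Suc_left\<close> gives the other end.\<close>

primrec comp :: "(nat \<Rightarrow> 'i) \<Rightarrow> nat \<Rightarrow> nat \<Rightarrow> complex \<Rightarrow> complex" where
  "comp \<omega> k 0 x = x"
| "comp \<omega> k (Suc n) x = comp \<omega> k n (\<Phi> (k + n) (\<omega> (k + n)) x)"

lemma comp_Suc_left: "comp \<omega> k (Suc n) x = \<Phi> k (\<omega> k) (comp \<omega> (Suc k) n x)"
  by (induction n arbitrary: x) auto

lemma comp_cong: "(\<And>j. j < n \<Longrightarrow> \<omega> (k + j) = \<omega>' (k + j)) \<Longrightarrow> comp \<omega> k n x = comp \<omega>' k n x"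
  by (induction n arbitrary: x) auto

context
  fixes \<omega> :: "nat \<Rightarrow> 'i"
  assumes \<omega>: "range \<omega> \<subseteq> I"
begin

lemma \<omega>_I: "\<omega> k \<in> I" using \<omega> by auto

lemma comp_cball: "x \<in> cball b s \<Longrightarrow> comp \<omega> k n x \<in> cball b s"
  by (induction n arbitrary: x) (simp_all only: comp.simps maps_cball[OF \<omega>_I])

lemma comp_contraction:
  "x \<in> cball b s \<Longrightarrow> y \<in> cball b s \<Longrightarrow> dist (comp \<omega> k n x) (comp \<omega> k n y) \<le> dist x y / 2 ^ n"
proof (induction n arbitrary: x y)
  case (Suc n)
  have "dist (comp \<omega> k (Suc n) x) (comp \<omega> k (Suc n) y)
      \<le> dist (\<Phi> (k + n) (\<omega> (k + n)) x) (\<Phi> (k + n) (\<omega> (k + n)) y) / 2 ^ n"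
    unfolding comp.simps by (rule Suc.IH) (use Suc.prems in \<open>simp_all only: maps_cball[OF \<omega>_I]\<close>)
  also have "\<dots> \<le> (dist x y / 2) / 2 ^ n"
    by (intro divide_right_mono contraction \<omega>_I Suc.prems) auto
  finally show ?case by simp
qed simp

lemma comp_expansion:
  "x \<in> cball b s \<Longrightarrow> y \<in> cball b s \<Longrightarrow> (\<Prod>j<n. a (\<omega> j) / 2) * dist x y \<le> dist (comp \<omega> 0 n x) (comp \<omega> 0 n y)"
proof (induction n arbitrary: x y)
  case (Suc n)
  have "(\<Prod>j<Suc n. a (\<omega> j) / 2) * dist x y = (\<Prod>j<n. a (\<omega> j) / 2) * (a (\<omega> n) / 2 * dist x y)" by simp
  also have "\<dots> \<le> (\<Prod>j<n. a (\<omega> j) / 2) * dist (\<Phi> n (\<omega> n) x) (\<Phi> n (\<omega> n) y)"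
    using a_pos[OF \<omega>_I] by (intro mult_left_mono expansion \<omega>_I Suc.prems prod_nonneg) (auto simp: less_imp_le)
  also have "\<dots> \<le> dist (comp \<omega> 0 (Suc n) x) (comp \<omega> 0 (Suc n) y)"
    unfolding comp.simps add_0 by (rule Suc.IH) (use Suc.prems in \<open>simp_all only: maps_cball[OF \<omega>_I]\<close>)
  finally show ?case .
qed simp

lemma comp_convergent: "convergent (\<lambda>n. comp \<omega> k n b)"
proof -
  have b: "b \<in> cball b s" using s by simp
  have step: "norm (comp \<omega> k (Suc n) b - comp \<omega> k n b) \<le> s * (1/2) ^ n" for n
  proof -
    have "dist (comp \<omega> k (Suc n) b) (comp \<omega> k n b) \<le> dist (\<Phi> (k + n) (\<omega> (k + n)) b) b / 2 ^ n"
      unfolding comp.simps by (rule comp_contraction) (simp_all only: maps_cball[OF \<omega>_I] b)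
    also have "\<dots> \<le> s / 2 ^ n"
      using maps_cball[OF \<omega>_I b, of "k+n" "k+n"] by (intro divide_right_mono) (auto simp: dist_commute)
    finally show ?thesis unfolding dist_norm by (simp only: power_one_over times_divide_eq_right mult_1_right)
  qed
  have "summable (\<lambda>n. s * (1/2) ^ n)" by (intro summable_mult summable_geometric) simp
  then have "summable (\<lambda>n. comp \<omega> k (Suc n) b - comp \<omega> k n b)"
    by (rule summable_comparison_test') (rule step)
  then have "(\<lambda>n. (\<Sum>j<n. comp \<omega> k (Suc j) b - comp \<omega> k j b)) \<longlonglongrightarrow> (\<Sum>j. comp \<omega> k (Suc j) b - comp \<omega> k j b)"
    by (rule summable_LIMSEQ)
  then have "(\<lambda>n. comp \<omega> k n b - b) \<longlonglongrightarrow> (\<Sum>j. comp \<omega> k (Suc j) b - comp \<omega> k j b)"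
    unfolding sum_lessThan_telescope[of "\<lambda>j. comp \<omega> k j b"] comp.simps(1) .
  from tendsto_add[OF this tendsto_const[of b]]
  show ?thesis by (auto simp: convergent_def)
qed

text \<open>The point coded by the tail of \<omega> from time k on, the maps being those of times k,
  k + 1, and so on.\<close>

definition pt :: "nat \<Rightarrow> complex" where "pt k = lim (\<lambda>n. comp \<omega> k n b)"

lemma pt_lim: "(\<lambda>n. comp \<omega> k n b) \<longlonglongrightarrow> pt k"
  unfolding pt_def using comp_convergent by (simp add: convergent_LIMSEQ_iff)

lemma pt_cball: "pt k \<in> cball b s"
  by (rule closed_sequentially[OF closed_cball _ pt_lim]) (use s comp_cball in auto)

lemma pt_step: "pt k = \<Phi> k (\<omega> k) (pt (Suc k))"
proof -
  have "isCont (\<Phi> k (\<omega> k)) (pt (Suc k))"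
    using pt_cball[of "Suc k"] cball_sub
    by (intro continuous_on_interior[OF holomorphic_on_imp_continuous_on[OF hol[OF \<omega>_I]]]) (auto simp: interior_open)
  then have "(\<lambda>n. \<Phi> k (\<omega> k) (comp \<omega> (Suc k) n b)) \<longlonglongrightarrow> \<Phi> k (\<omega> k) (pt (Suc k))"
    using pt_lim by (rule isCont_tendsto_compose)
  then have "(\<lambda>n. comp \<omega> k (Suc n) b) \<longlonglongrightarrow> \<Phi> k (\<omega> k) (pt (Suc k))"
    by (simp only: comp_Suc_left)
  moreover have "(\<lambda>n. comp \<omega> k (Suc n) b) \<longlonglongrightarrow> pt k" by (rule LIMSEQ_Suc[OF pt_lim])
  ultimately show ?thesis using LIMSEQ_unique by blast
qed

lemma pt_ball: "pt k \<in> ball b (s / 4)"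
  unfolding pt_step[of k] using img[OF \<omega>_I] pt_cball cball_sub by blast

lemma pt_0: "pt 0 = comp \<omega> 0 n (pt n)"
  by (induction n) (simp_all add: pt_step[symmetric])

end

text \<open>At the first disagreement n the tail points lie in images with different indices, hence
  are at least s * a (\<omega> n) apart; \<open>comp_expansion\<close> carries this back along the
  common word. Taking the minimum over the finite alphabet makes the factor independent of
  n.\<close>

lemma pt_separated:
  assumes \<omega>: "range \<omega> \<subseteq> I" "range \<omega>' \<subseteq> I" and agree: "\<forall>k<n. \<omega> k = \<omega>' k" and neq: "\<omega> n \<noteq> \<omega>' n"
  shows "s * Min (a ` I) * (\<Prod>k<n. a (\<omega> k) / 2) \<le> dist (pt \<omega> 0) (pt \<omega>' 0)"
proof -
  have "s * Min (a ` I) \<le> s * a (\<omega> n)"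
    using s fin \<omega> by (intro mult_left_mono Min_le) auto
  also have "\<dots> \<le> dist (pt \<omega> n) (pt \<omega>' n)"
    unfolding pt_step[OF \<omega>(1), of n] pt_step[OF \<omega>(2), of n]
    using separation[of "\<omega> n" "\<omega>' n" "pt \<omega> (Suc n)" "pt \<omega>' (Suc n)" n] neq \<omega> pt_cball[OF \<omega>(1)] pt_cball[OF \<omega>(2)]
    by (auto simp: mult.commute)
  finally have "(\<Prod>k<n. a (\<omega> k) / 2) * (s * Min (a ` I)) \<le> (\<Prod>k<n. a (\<omega> k) / 2) * dist (pt \<omega> n) (pt \<omega>' n)"
    using a_pos[OF \<omega>_I[OF \<omega>(1)]] by (intro mult_left_mono prod_nonneg) (auto simp: less_imp_le)
  also have "\<dots> \<le> dist (comp \<omega> 0 n (pt \<omega> n)) (comp \<omega> 0 n (pt \<omega>' n))"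
    by (intro comp_expansion \<omega> pt_cball)
  also have "comp \<omega> 0 n (pt \<omega>' n) = comp \<omega>' 0 n (pt \<omega>' n)"
    using agree by (intro comp_cong) auto
  finally show ?thesis using pt_0[OF \<omega>(1), of n] pt_0[OF \<omega>(2), of n] by (simp add: mult.commute)
qed

text \<open>The weights are a i / 2 rather than a i because \<open>expansion\<close> loses a factor
  2 at every step.\<close>

theorem hausdorff_measure_limit_set_nonzero:
  assumes t: "t > 0" and sum: "(\<Sum>i\<in>I. (a i / 2) powr t) \<ge> 2"
    and A: "\<And>\<omega>. range \<omega> \<subseteq> I \<Longrightarrow> pt \<omega> 0 \<in> A"
  shows "hausdorff_measure t A \<noteq> 0"
proof (rule hausdorff_measure_coding_nonzero[OF fin _ t _ sum, where \<kappa>="s * Min (a ` I)" and \<pi>="\<lambda>\<omega>. pt \<omega> 0"])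
  show "0 < a i / 2 \<and> a i / 2 \<le> 1" if "i \<in> I" for i using a_pos[OF that] a_le_half[OF that] by simp
  have "I \<noteq> {}" using sum by auto
  then have "0 < Min (a ` I)" using fin a_pos by (subst Min_gr_iff) auto
  then show "0 < s * Min (a ` I)" using s by simp
  show "s * Min (a ` I) * (\<Prod>k<n. a (\<omega> k) / 2) \<le> dist (pt \<omega> 0) (pt \<omega>' 0)"
    if "range \<omega> \<subseteq> I" "range \<omega>' \<subseteq> I" "\<forall>k<n. \<omega> k = \<omega>' k" "\<omega> n \<noteq> \<omega>' n" for \<omega> \<omega>' n
    using that by (rule pt_separated)
qed (rule A)

end

section \<open>Inverse branches at a pole\<close>

text \<open>K is the inverse of a local coordinate k with k^q = 1/f, in which the pole of order q
  becomes exactly 1 / u^q. All q local inverses of f near infinity then come from the q-th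
  roots.\<close>

lemma pole_normal_form:
  assumes f: "merom_plane f" and pole: "is_pole f b" and mult: "zorder f b = - int q"
  obtains K e \<kappa> L where "0 < q" "0 < e" "0 < \<kappa>" "0 < L" "K holomorphic_on ball 0 e"
    "\<forall>u\<in>ball 0 e. \<kappa> \<le> norm (deriv K u) \<and> norm (K u - b) \<le> L * norm u"
    "\<forall>u\<in>ball 0 e - {0}. K u \<notin> poles f \<and> f (K u) = 1 / u ^ q"
proof -
  have "f meromorphic_on {b}"
    using f unfolding merom_plane_def nicely_meromorphic_on_def by (blast intro: meromorphic_on_subset)
  then have "isolated_singularity_at f b" by (simp add: meromorphic_at_iff)
  then obtain r1 where r1: "r1 > 0" "f analytic_on ball b r1 - {b}"
    unfolding isolated_singularity_at_def by blast
  then have holf: "f holomorphic_on ball b r1 - {b}" by (auto intro: analytic_imp_holomorphic)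
  have np: "z \<notin> poles f" if "z \<in> ball b r1 - {b}" for z
    using not_is_pole_holomorphic[OF open_delete[OF open_ball] that holf] by (simp add: poles_def)
  define g where "g = zor_poly f b"
  from zorder_exist_pole[OF holf open_ball _ pole] r1(1)
  obtain r where r: "zorder f b < 0" "g b \<noteq> 0" "r > 0" "cball b r \<subseteq> ball b r1" "g holomorphic_on cball b r"
    "\<forall>w\<in>cball b r - {b}. f w  = g w / (w-b) ^ nat (- zorder f b) \<and> g w \<noteq> 0"
    unfolding g_def by auto
  have q: "0 < q" using r(1) mult by simp
  have g0: "g w \<noteq> 0" if "w \<in> cball b r" for w using r(2,6) that by (cases "w = b") auto
  have fg: "f w = g w / (w - b) ^ q" if "w \<in> cball b r - {b}" for w
    using r(6) that mult by auto
  obtain l where l: "l holomorphic_on ball b r" "\<And>w. w \<in> ball b r \<Longrightarrow> exp (l w) = g w"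
    by (rule holomorphic_logarithm_exists[of "ball b r" g b])
      (use r g0 in \<open>auto intro: holomorphic_on_subset\<close>)
  \<comment> \<open>With f = g / (z - b)^q and g = exp l near b, this is (z - b) times a q-th root
    of 1/g; its derivative at b is that root, hence nonzero.\<close>
  define k where "k z = (z - b) * exp (- l z / of_nat q)" for z
  have k_hol: "k holomorphic_on ball b r" unfolding k_def using l(1) q by (intro holomorphic_intros) auto
  have k_pow: "k z ^ q = (z - b) ^ q / g z" if "z \<in> ball b r" for z
  proof -
    have "exp (- l z / of_nat q) ^ q = exp (of_nat q * (- l z / of_nat q))"
      by (rule exp_of_nat_mult[symmetric])
    also have "\<dots> = exp (- l z)" using q by simp
    finally show ?thesis using l(2)[OF that] by (simp add: k_def power_mult_distrib exp_minus divide_inverse)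
  qed
  have "(l has_field_derivative deriv l b) (at b)"
    using holomorphic_derivI[OF l(1) open_ball] r(3) by simp
  then have "(k has_field_derivative exp (- l b / of_nat q)) (at b)"
    unfolding k_def using q by (auto intro!: derivative_eq_intros)
  then have dk: "deriv k b \<noteq> 0" using DERIV_imp_deriv by fastforce
  obtain r' where r': "r' > 0" "ball b r' \<subseteq> ball b r" "open (k ` ball b r')" "inj_on k (ball b r')"
    using has_complex_derivative_locally_invertible[OF k_hol _ open_ball dk] r(3) by auto
  have k_hol': "k holomorphic_on ball b r'" using k_hol r'(2) by (rule holomorphic_on_subset)
  obtain K where K: "K holomorphic_on k ` ball b r'" "\<And>z. z \<in> ball b r' \<Longrightarrow> deriv k z * deriv K (k z) = 1"
    "\<And>z. z \<in> ball b r' \<Longrightarrow> K (k z) = z"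
    using holomorphic_has_inverse[OF k_hol' open_ball r'(4)] by blast
  have kb: "k b = 0" by (simp add: k_def)
  then have "0 \<in> k ` ball b r'" using r'(1) by (metis centre_in_ball imageI)
  then obtain e where e: "e > 0" "cball 0 e \<subseteq> k ` ball b r'"
    using r'(3) open_contains_cball by blast
  have dK_cont: "continuous_on (cball 0 e) (deriv K)"
    using holomorphic_on_imp_continuous_on[OF holomorphic_deriv[OF K(1) r'(3)]] e(2) by (rule continuous_on_subset)
  have dK_nz: "deriv K u \<noteq> 0" if "u \<in> cball 0 e" for u
  proof -
    obtain z where "z \<in> ball b r'" "u = k z" using e(2) \<open>u \<in> cball 0 e\<close> by blast
    then show ?thesis using K(2)[of z] by auto
  qed
  have ne: "cball (0::complex) e \<noteq> {}" using e(1) by auto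
  have cn: "continuous_on (cball 0 e) (\<lambda>u. norm (deriv K u))" by (intro continuous_intros dK_cont)
  \<comment> \<open>The extrema of |K'| on the closed disk supply \<kappa> and L; the minimum is
    positive because K' has no zero there.\<close>
  obtain u1 where u1: "u1 \<in> cball 0 e" "\<And>u. u \<in> cball 0 e \<Longrightarrow> norm (deriv K u1) \<le> norm (deriv K u)"
    using continuous_attains_inf[OF compact_cball ne cn] by blast
  obtain u2 where u2: "u2 \<in> cball 0 e" "\<And>u. u \<in> cball 0 e \<Longrightarrow> norm (deriv K u) \<le> norm (deriv K u2)"
    using continuous_attains_sup[OF compact_cball ne cn] by blast
  have K0: "K 0 = b" using K(3)[of b] r'(1) kb by simp
  have K_le: "norm (K u - b) \<le> norm (deriv K u2) * norm u" if "u \<in> ball 0 e" for u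
  proof -
    have "norm (K u - K 0) \<le> norm (deriv K u2) * norm (u - 0)"
    proof (rule field_differentiable_bound[of "cball 0 e"])
      fix x :: complex assume x: "x \<in> cball 0 e"
      show "norm (deriv K x) \<le> norm (deriv K u2)" by (rule u2(2)[OF x])
      have "(K has_field_derivative deriv K x) (at x)"
        using holomorphic_derivI[OF K(1) r'(3)] e(2) x by blast
      then show "(K has_field_derivative deriv K x) (at x within cball 0 e)"
        by (rule has_field_derivative_at_within)
    qed (use that e(1) in auto)
    then show ?thesis by (simp add: K0)
  qed
  have K_f: "K u \<notin> poles f \<and> f (K u) = 1 / u ^ q" if u: "u \<in> ball 0 e - {0}" for u
  proof -
    have "u \<in> cball 0 e" using u by auto
    then obtain z where z: "z \<in> ball b r'" "u = k z" using e(2) by blast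
    then have Kz: "K u = z" using K(3) by simp
    have zb: "z \<noteq> b" using z u kb by auto
    have zr: "z \<in> ball b r" using z(1) r'(2) by blast
    have "z \<in> cball b r" using zr by simp
    then have "z \<in> ball b r1 - {b}" using r(4) zb by blast
    then have 1: "z \<notin> poles f" by (rule np)
    have "f z = g z / (z - b) ^ q" using zr zb by (intro fg) auto
    also have "\<dots> = 1 / u ^ q" unfolding z(2) k_pow[OF zr] by simp
    finally show ?thesis using 1 Kz by simp
  qed
  show ?thesis
  proof (rule that[of e "norm (deriv K u1)" "norm (deriv K u2)" K])
    show "K holomorphic_on ball 0 e" using K(1) by (rule holomorphic_on_subset) (use e(2) in auto)
    show "\<forall>u\<in>ball 0 e. norm (deriv K u1) \<le> norm (deriv K u) \<and> norm (K u - b) \<le> norm (deriv K u2) * norm u"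
      using u1(2) K_le by auto
  qed (use q e(1) dK_nz u1(1) u2(1) K_f in auto)
qed

text \<open>The exponent may have either sign: \<alpha> can be negative, and 1 + 1/q enters with a
  minus sign.\<close>

lemma powr_le_of_comparable:
  fixes x y K \<beta> :: real
  assumes "0 < x" "1 \<le> K" "x / K \<le> y" "y \<le> K * x"
  shows "y powr \<beta> \<le> K powr \<bar>\<beta>\<bar> * x powr \<beta>"
proof (cases "\<beta> \<ge> 0")
  case True
  have "0 \<le> y" using assms by (meson divide_nonneg_nonneg less_imp_le order_trans zero_le_one)
  then have "y powr \<beta> \<le> (K * x) powr \<beta>" using True assms by (intro powr_mono2) auto
  then show ?thesis using True assms by (simp add: powr_mult)
next
  case False
  have "0 < x / K" using assms by simp
  then have "y powr \<beta> \<le> (x / K) powr \<beta>" using False assms by (intro powr_mono2') auto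
  also have "\<dots> = K powr \<bar>\<beta>\<bar> * x powr \<beta>"
    using False assms by (simp add: powr_divide powr_minus_divide)
  finally show ?thesis .
qed

text \<open>The comparison of univalent functions concerns distances from b, whereas (M2) concerns
  the modulus. For |z| large against |b| the two differ by a bounded factor.\<close>

lemma norm_comparable_of_dist_comparable:
  fixes x z b :: complex
  assumes K: "1 \<le> K" and 1: "norm (x - b) \<le> K * norm (z - b)" and 2: "norm (z - b) \<le> K * norm (x - b)"
    and z: "4 * K * norm b \<le> norm z"
  shows "norm z / (4 * K) \<le> norm x" "norm x \<le> 4 * K * norm z"
proof -
  have b: "norm b \<le> K * norm b" using K by (simp add: mult_le_cancel_right1)
  then have bz: "norm b \<le> norm z" using z norm_ge_zero[of b] by linarith
  have zK: "norm z \<le> K * norm z" using K by (simp add: mult_le_cancel_right1)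
  have xK: "0 \<le> K * norm x" using K by simp
  have "K * norm (x - b) \<le> K * (norm x + norm b)"
    using K norm_triangle_ineq4[of x b] by (intro mult_left_mono) auto
  then have "norm z \<le> K * norm x + K * norm b + norm b"
    using 2 norm_triangle_ineq2[of z b] by (simp add: algebra_simps)
  then have "norm z \<le> 4 * (K * norm x)" using z b xK by linarith
  then show "norm z / (4 * K) \<le> norm x" using K by (simp add: divide_le_eq algebra_simps)
  have "K * norm (z - b) \<le> K * (norm z + norm b)"
    using K norm_triangle_ineq4[of z b] by (intro mult_left_mono) auto
  also have "\<dots> \<le> K * (norm z + norm z)" using K bz by (intro mult_left_mono) auto
  finally have "norm (x - b) \<le> 2 * (K * norm z)" using 1 by (simp add: algebra_simps)
  moreover have "norm x \<le> norm (x - b) + norm b" using norm_triangle_sub[of x b] by simp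
  ultimately have "norm x \<le> 4 * (K * norm z)" using bz zK norm_ge_zero[of z] by linarith
  then show "norm x \<le> 4 * K * norm z" by simp
qed

text \<open>A branch takes no pole as a value, so it omits b. This gives constants common to all
  branches.\<close>

lemma inverse_branch_comparable:
  assumes \<phi>: "inverse_branch f (ball b R) \<phi>" and pole: "is_pole f b" and R: "R > 0" and w: "w \<in> ball b (R/2)"
  shows "norm (\<phi> w - b) \<le> exp (12 * pi) * norm (\<phi> b - b)"
    and "norm (\<phi> b - b) \<le> exp (12 * pi) * norm (\<phi> w - b)"
proof -
  have h: "\<phi> holomorphic_on ball b R" using \<phi> by (simp add: inverse_branch_def)
  have n: "\<phi> v \<noteq> b" if "v \<in> ball b R" for v using \<phi> that pole by (auto simp: inverse_branch_def poles_def)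
  show "norm (\<phi> w - b) \<le> exp (12 * pi) * norm (\<phi> b - b)"
    "norm (\<phi> b - b) \<le> exp (12 * pi) * norm (\<phi> w - b)"
    using univalent_omitting_comparable[OF h inverse_branch_inj[OF \<phi>] n R w] by auto
qed

text \<open>The two perturbed steps are solved backwards: y = (x - c2) / l2, then \<phi> y, then v =
  (\<phi> y - c1) / l1, then a q-th root u of 1/v, and finally K u. The derivative has modulus |K'
  u| * |u| * |v'| / (q * |v|), where |u| = |v|^(-1/q), |v'| is at least |\<phi>'| / 4, and \<phi>'
  is bounded below through the upper bound on f'. Comparability of |\<phi> y| and |v| with |z| turns
  this into a power of |z|.\<close>

lemma two_step_inverse_map:
  fixes f \<phi> K :: "complex \<Rightarrow> complex" and b z l1 l2 c1 c2 :: complex and q :: nat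
  assumes f: "merom_plane f" and pole: "is_pole f b"
    and \<phi>: "inverse_branch f (ball b R) \<phi>" "\<phi> b = z" and R: "R > 0"
    and q: "0 < q" and e: "0 < e" and \<kappa>: "0 < \<kappa>" and L: "0 < L" and K: "K holomorphic_on ball 0 e"
    "\<forall>u\<in>ball 0 e. \<kappa> \<le> norm (deriv K u) \<and> norm (K u - b) \<le> L * norm u"
    "\<forall>u\<in>ball 0 e - {0}. K u \<notin> poles f \<and> f (K u) = 1 / u ^ q"
    and s: "0 < s"
    and Q: "Q > 0" and bound: "\<And>x. norm x > R1 \<Longrightarrow> x \<notin> poles f \<Longrightarrow> f x \<in> ball b R \<Longrightarrow>
                       norm (deriv f x) \<le> Q * norm x powr \<alpha>"
    and l1: "inverse l1 \<in> ball 1 (1/2)" and l2: "inverse l2 \<in> ball 1 (1/2)" and c1: "norm c1 < 1"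
    and pert: "\<And>x. x \<in> ball b (2 * s) \<Longrightarrow> (x - c2) / l2 \<in> ball b (R/2)"
    and K1: "K1 = 4 * exp (12 * pi)"
    and e': "0 < e'" "e' \<le> e" "L * e' \<le> s / 4"
    and z1: "K1 * norm b \<le> norm z" and z2: "2 * K1 \<le> norm z" and z3: "K1 * R1 < norm z"
    and z4: "4 * K1 * e' powr (- real q) < norm z"
  obtains \<Phi> where "\<Phi> holomorphic_on ball b (2 * s)"
    "\<forall>x\<in>ball b (2 * s). \<Phi> x \<in> ball b (s / 4) \<and> \<Phi> x \<notin> poles f \<and> l1 * f (\<Phi> x) + c1 \<notin> poles f \<and>
       l1 * f (\<Phi> x) + c1 = \<phi> ((x - c2) / l2) \<and>
       l2 * f (l1 * f (\<Phi> x) + c1) + c2 = x \<and>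
       \<kappa> / (4 * real q * Q * (4 * K1) powr (1 + 1 / real q) * K1 powr \<bar>\<alpha>\<bar>)
         * norm z powr (- (\<alpha> + 1 + 1 / real q)) \<le> norm (deriv \<Phi> x)"
proof -
  let ?B = "ball b (2 * s)"
  define y where "y x = (x - c2) / l2" for x
  have inv_bounds: "1/2 \<le> norm (inverse l) \<and> norm (inverse l) \<le> 3/2 \<and> l \<noteq> 0"
    if "inverse l \<in> ball 1 (1/2)" for l :: complex
  proof -
    have d: "norm (1 - inverse l) < 1/2" using that by (simp add: dist_norm)
    have "norm (1::complex) - norm (inverse l) \<le> norm (1 - inverse l)" by (rule norm_triangle_ineq2)
    moreover have "norm (inverse l) - norm (1::complex) \<le> norm (1 - inverse l)"
      using norm_triangle_ineq2[of "inverse l" 1] by (simp add: norm_minus_commute)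
    ultimately have *: "1/2 \<le> norm (inverse l) \<and> norm (inverse l) \<le> 3/2" using d by simp
    moreover have "l \<noteq> 0" using * by auto
    ultimately show ?thesis by blast
  qed
  note l1' = inv_bounds[OF l1] and l2' = inv_bounds[OF l2]
  have yR: "y x \<in> ball b (R/2)" if "x \<in> ?B" for x unfolding y_def by (rule pert[OF that])
  have yR': "y x \<in> ball b R" if "x \<in> ?B" for x using yR[OF that] R by auto
  have K1_ge: "4 \<le> K1" unfolding K1 by simp
  have \<phi>_hol: "\<phi> holomorphic_on ball b R" using \<phi>(1) by (simp add: inverse_branch_def)
  have comp: "norm z / K1 \<le> norm (\<phi> (y x))" "norm (\<phi> (y x)) \<le> K1 * norm z" if "x \<in> ?B" for x
    using norm_comparable_of_dist_comparable[of "exp (12*pi)" "\<phi> (y x)" b z]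
      inverse_branch_comparable[OF \<phi>(1) pole R yR[OF that]] \<phi>(2) z1 unfolding K1 by auto
  define v where "v x = (\<phi> (y x) - c1) * inverse l1" for x
  define K2 where "K2 = 4 * K1"
  \<comment> \<open>Since |c1| < 1, subtracting c1 now changes the modulus by at most a factor 2.
    Together with a factor between 1/2 and 3/2 from l1 this explains K2 = 4 * K1.\<close>
  have \<phi>2: "2 \<le> norm (\<phi> (y x))" if "x \<in> ?B" for x
  proof -
    have "2 \<le> norm z / K1" using z2 K1_ge by (simp add: le_divide_eq)
    then show ?thesis using comp(1)[OF that] by linarith
  qed
  have v_bounds: "norm z / K2 \<le> norm (v x)" "norm (v x) \<le> K2 * norm z" if "x \<in> ?B" for x
  proof -
    let ?p = "norm (\<phi> (y x))"
    have "?p - 1 \<le> norm (\<phi> (y x) - c1)" using norm_triangle_ineq2[of "\<phi> (y x)" c1] c1 by linarith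
    then have lo: "?p / 2 \<le> norm (\<phi> (y x) - c1)" using \<phi>2[OF that] by linarith
    have hi: "norm (\<phi> (y x) - c1) \<le> 2 * ?p" using norm_triangle_ineq4[of "\<phi> (y x)" c1] c1 \<phi>2[OF that] by linarith
    have "norm z / K2 = norm z / K1 * (1/4)" by (simp add: K2_def)
    also have "\<dots> \<le> ?p * (1/4)" by (intro mult_right_mono comp(1)[OF that]) simp
    also have "\<dots> = ?p / 2 * (1/2)" by simp
    also have "\<dots> \<le> norm (v x)" unfolding v_def norm_mult using lo l1' by (intro mult_mono) auto
    finally show "norm z / K2 \<le> norm (v x)" .
    have "norm (v x) \<le> 2 * ?p * (3/2)" unfolding v_def norm_mult using hi l1' by (intro mult_mono) auto
    moreover have "0 \<le> K1 * norm z" using K1_ge by simp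
    ultimately show "norm (v x) \<le> K2 * norm z" using comp(2)[OF that] by (simp add: K2_def)
  qed
  have zpos: "0 < norm z" using z2 K1_ge by linarith
  have K2_ge: "1 \<le> K2" using K1_ge by (simp add: K2_def)
  have v_pos: "0 < norm (v x)" if "x \<in> ?B" for x
  proof -
    have "0 < norm z / K2" using zpos K2_ge by simp
    then show ?thesis using v_bounds(1)[OF that] by linarith
  qed
  have y_hol: "y holomorphic_on ?B" unfolding y_def using l2' by (intro holomorphic_intros) auto
  have y_der: "(y has_field_derivative inverse l2) (at x)" for x
    unfolding y_def using l2' by (auto intro!: derivative_eq_intros simp: field_simps)
  have v_der: "(v has_field_derivative deriv \<phi> (y x) * inverse l2 * inverse l1) (at x)" if "x \<in> ?B" for x
  proof -
    have "(\<phi> has_field_derivative deriv \<phi> (y x)) (at (y x))"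
      using holomorphic_derivI[OF \<phi>_hol open_ball yR'[OF that]] .
    from DERIV_chain2[OF this y_der] show ?thesis
      unfolding v_def by (auto intro!: derivative_eq_intros)
  qed
  have v_hol: "v holomorphic_on ?B"
    unfolding holomorphic_on_open[OF open_ball] using v_der by blast
  obtain l where l: "l holomorphic_on ?B" "\<And>x. x \<in> ?B \<Longrightarrow> exp (l x) = v x"
    by (rule holomorphic_logarithm_exists[of ?B v b]) (use v_hol v_pos s in auto)
  \<comment> \<open>A holomorphic q-th root of 1/v, available because v is zero-free on the
    disk.\<close>
  define u where "u x = exp (- l x / of_nat q)" for x
  have u_norm: "norm (u x) = norm (v x) powr (- 1 / real q)" if "x \<in> ?B" for x
  proof -
    have "norm (v x) = exp (Re (l x))" using l(2)[OF that] by (metis norm_exp_eq_Re)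
    moreover have "norm (u x) = exp (- Re (l x) / real q)"
      unfolding u_def norm_exp_eq_Re by (simp add: Re_divide_of_nat)
    ultimately show ?thesis by (simp add: powr_def)
  qed
  have u_pow: "1 / u x ^ q = v x" if "x \<in> ?B" for x
  proof -
    have "u x ^ q = exp (of_nat q * (- l x / of_nat q))" unfolding u_def by (rule exp_of_nat_mult[symmetric])
    also have "\<dots> = exp (- l x)" using q by simp
    finally show ?thesis using l(2)[OF that] by (simp add: exp_minus divide_inverse)
  qed
  \<comment> \<open>The last threshold on |z| forces |v| > e'^(-q), which is |u| < e'; then K u is
    within L * e' \<le> s/4 of b.\<close>
  have u_small: "norm (u x) < e'" if "x \<in> ?B" for x
  proof -
    have "e' powr (- real q) < norm z / K2"
      using z4 K2_ge unfolding K2_def by (simp add: less_divide_eq mult.commute)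
    also have "\<dots> \<le> norm (v x)" by (rule v_bounds(1)[OF that])
    finally have *: "e' powr (- real q) < norm (v x)" .
    have "norm (u x) < (e' powr (- real q)) powr (- 1 / real q)"
      unfolding u_norm[OF that] using * e' q by (intro powr_less_mono2_neg) auto
    also have "\<dots> = e'" using e' q by (simp add: powr_powr)
    finally show ?thesis .
  qed
  have u_e: "u x \<in> ball 0 e - {0}" if "x \<in> ?B" for x
    using u_small[OF that] e' by (auto simp: u_def)
  have u_hol: "u holomorphic_on ?B" unfolding u_def using l(1) q by (intro holomorphic_intros) auto
  define \<Phi> where "\<Phi> x = K (u x)" for x
  have \<Phi>_hol: "\<Phi> holomorphic_on ?B"
  proof -
    have "u ` ?B \<subseteq> ball 0 e" using u_e by blast
    from holomorphic_on_compose_gen[OF u_hol K(1) this] show ?thesis by (simp add: \<Phi>_def[abs_def] o_def)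
  qed
  define \<tau> where "\<tau> = \<alpha> + 1 + 1 / real q"
  define a0 where "a0 = \<kappa> / (4 * real q * Q * K2 powr (1 + 1 / real q) * K1 powr \<bar>\<alpha>\<bar>)"
  have main: "\<Phi> x \<in> ball b (s / 4) \<and> \<Phi> x \<notin> poles f \<and> l1 * f (\<Phi> x) + c1 \<notin> poles f \<and>
       l1 * f (\<Phi> x) + c1 = \<phi> (y x) \<and> l2 * f (l1 * f (\<Phi> x) + c1) + c2 = x \<and>
       a0 * norm z powr (- \<tau>) \<le> norm (deriv \<Phi> x)" if x: "x \<in> ?B" for x
  proof -
    have "norm (\<Phi> x - b) \<le> L * norm (u x)" unfolding \<Phi>_def using K(2) u_e[OF x] by auto
    also have "\<dots> < L * e'" using u_small[OF x] L by simp
    finally have P1: "\<Phi> x \<in> ball b (s / 4)" using e' by (simp add: dist_norm norm_minus_commute)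
    have P2: "\<Phi> x \<notin> poles f" and fv: "f (\<Phi> x) = v x"
      using K(3) u_e[OF x] u_pow[OF x] by (auto simp: \<Phi>_def)
    have P3: "l1 * f (\<Phi> x) + c1 = \<phi> (y x)" unfolding fv v_def using l1' by (simp add: field_simps)
    have P4: "\<phi> (y x) \<notin> poles f" "f (\<phi> (y x)) = y x"
      using \<phi>(1) yR'[OF x] by (auto simp: inverse_branch_def)
    have P5: "l2 * y x + c2 = x" using l2' by (simp add: y_def)
    have lder: "(l has_field_derivative deriv l x) (at x)" using holomorphic_derivI[OF l(1) open_ball x] .
    have "((\<lambda>x. exp (l x)) has_field_derivative exp (l x) * deriv l x) (at x)"
      using lder by (auto intro!: derivative_eq_intros)
    then have "(v has_field_derivative exp (l x) * deriv l x) (at x)"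
      by (rule has_field_derivative_transform_within_open[OF _ open_ball x]) (rule l(2))
    then have l': "v x * deriv l x = deriv \<phi> (y x) * inverse l2 * inverse l1"
      using v_der[OF x] l(2)[OF x] DERIV_unique by metis
    have "(u has_field_derivative u x * (- deriv l x / of_nat q)) (at x)"
      unfolding u_def using lder q by (auto intro!: derivative_eq_intros)
    moreover have "(K has_field_derivative deriv K (u x)) (at (u x))"
      using holomorphic_derivI[OF K(1) open_ball] u_e[OF x] by blast
    ultimately have "(\<Phi> has_field_derivative deriv K (u x) * (u x * (- deriv l x / of_nat q))) (at x)"
      unfolding \<Phi>_def by (rule DERIV_chain2[rotated])
    then have "deriv \<Phi> x = deriv K (u x) * (u x * (- deriv l x / of_nat q))" by (rule DERIV_imp_deriv)
    then have d\<Phi>: "norm (deriv \<Phi> x) = norm (deriv K (u x)) * (norm (u x) * norm (deriv l x) / real q)"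
      by (simp add: norm_mult norm_divide)
    let ?p = "norm (\<phi> (y x))" and ?v = "norm (v x)"
    have f'\<phi>': "norm (deriv f (\<phi> (y x))) * norm (deriv \<phi> (y x)) = 1"
      using inverse_branch_deriv[OF f \<phi>(1) open_ball yR'[OF x]] by (metis norm_mult norm_one)
    have "norm (deriv f (\<phi> (y x))) \<le> Q * ?p powr \<alpha>"
    proof (rule bound)
      have "R1 < norm z / K1" using z3 K1_ge by (simp add: less_divide_eq mult.commute)
      then show "R1 < ?p" using comp(1)[OF x] by linarith
    qed (use P4 yR'[OF x] in auto)
    also have "?p powr \<alpha> \<le> K1 powr \<bar>\<alpha>\<bar> * norm z powr \<alpha>"
      using comp[OF x] zpos K1_ge by (intro powr_le_of_comparable) auto
    finally have f'_le: "norm (deriv f (\<phi> (y x))) \<le> Q * (K1 powr \<bar>\<alpha>\<bar> * norm z powr \<alpha>)"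
      using Q by simp
    define E where "E = Q * (K1 powr \<bar>\<alpha>\<bar> * norm z powr \<alpha>)"
    have E_pos: "0 < E" unfolding E_def using Q K1_ge zpos by simp
    have "1 \<le> E * norm (deriv \<phi> (y x))"
      using mult_right_mono[OF f'_le norm_ge_zero[of "deriv \<phi> (y x)"]] f'\<phi>' by (simp add: E_def)
    then have \<phi>'_ge: "1 / E \<le> norm (deriv \<phi> (y x))" using E_pos by (simp add: field_simps)
    have vl: "?v * norm (deriv l x) = norm (deriv \<phi> (y x)) * norm (inverse l2) * norm (inverse l1)"
      using l' by (metis norm_mult)
    have "1 / E * (1/2) * (1/2) \<le> ?v * norm (deriv l x)"
      unfolding vl using \<phi>'_ge l1' l2' E_pos by (intro mult_mono) auto
    moreover have "1 / E * (1/2) * (1/2) = 1 / (4 * E)" by simp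
    ultimately have "1 / (4 * E) \<le> norm (deriv l x) * ?v" by (simp only: mult.commute)
    then have l'_ge: "1 / (4 * E) / ?v \<le> norm (deriv l x)"
      by (simp only: pos_divide_le_eq[OF v_pos[OF x]])
    \<comment> \<open>The exponent with |v|^\<beta> = |u| / |v|; adding the exponent -\<alpha> from
      \<phi>' gives -\<tau>.\<close>
    define \<beta> where "\<beta> = - (1 + 1 / real q)"
    have "norm z powr \<beta> \<le> K2 powr \<bar>\<beta>\<bar> * ?v powr \<beta>"
    proof (rule powr_le_of_comparable[OF v_pos[OF x] K2_ge])
      show "?v / K2 \<le> norm z" using v_bounds(2)[OF x] K2_ge by (simp add: divide_le_eq mult.commute)
      show "norm z \<le> K2 * ?v" using v_bounds(1)[OF x] K2_ge by (simp add: divide_le_eq mult.commute)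
    qed
    moreover have "?v powr \<beta> = norm (u x) / ?v"
    proof -
      have "\<beta> = - 1 / real q - 1" by (simp add: \<beta>_def)
      then have "?v powr \<beta> = ?v powr (- 1 / real q - 1)" by (simp only:)
      also have "\<dots> = ?v powr (- 1 / real q) / ?v" using v_pos[OF x] by (subst powr_diff) auto
      finally show ?thesis by (simp add: u_norm[OF x])
    qed
    moreover have \<beta>_abs: "\<bar>\<beta>\<bar> = 1 + 1 / real q" unfolding \<beta>_def abs_minus_cancel by (rule abs_of_nonneg) simp
    ultimately have uv_ge: "norm z powr \<beta> / K2 powr (1 + 1 / real q) \<le> norm (u x) / ?v"
      using K2_ge by (simp add: divide_le_eq mult.commute)
    have "a0 * norm z powr (- \<tau>) = \<kappa> * (norm z powr \<beta> / K2 powr (1 + 1 / real q) * (1 / (4 * E)) / real q)"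
    proof -
      have "norm z powr (- \<tau>) = norm z powr \<beta> / norm z powr \<alpha>"
      proof -
        have "- \<tau> = \<beta> - \<alpha>" by (simp add: \<tau>_def \<beta>_def)
        then show ?thesis by (simp only: powr_diff)
      qed
      then show ?thesis by (simp add: a0_def E_def)
    qed
    also have "\<dots> \<le> \<kappa> * (norm (u x) / ?v * (1 / (4 * E)) / real q)"
      using uv_ge \<kappa> E_pos q by (intro mult_left_mono divide_right_mono mult_right_mono) auto
    also have "\<dots> = \<kappa> * (norm (u x) * (1 / (4 * E) / ?v) / real q)" by simp
    also have "\<dots> \<le> \<kappa> * (norm (u x) * norm (deriv l x) / real q)"
      using l'_ge \<kappa> by (intro mult_left_mono divide_right_mono) auto
    also have "\<dots> \<le> norm (deriv \<Phi> x)"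
      unfolding d\<Phi> using K(2) u_e[OF x] by (intro mult_right_mono) auto
    finally have P6: "a0 * norm z powr (- \<tau>) \<le> norm (deriv \<Phi> x)" .
    show ?thesis using P1 P2 P3 P4 P5 P6 by simp
  qed
  show ?thesis
    by (rule that[OF \<Phi>_hol]) (use main in \<open>simp only: a0_def \<tau>_def K2_def y_def, blast\<close>)
qed

section \<open>Divergence of the sum over the preimages of the pole\<close>

text \<open>Having a pole, f is not constant, so its level sets are discrete. For w = 0 the level
  set includes the poles, where f is set to 0.\<close>

lemma finite_fiber_cball:
  assumes f: "merom_plane f" and pole: "is_pole f b"
  shows "finite {z. f z = w \<and> norm z \<le> r}"
proof -
  have "f nicely_meromorphic_on UNIV" using f by (simp add: merom_plane_def)
  from nicely_meromorphic_imp_constant_or_avoid[OF this, of w]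
  have "(\<forall>x. f x = w) \<or> (\<forall>\<^sub>\<approx>x\<in>UNIV. f x \<noteq> w)" by (simp add: connected_UNIV)
  moreover have "\<not> (\<forall>x. f x = w)"
  proof
    assume "\<forall>x. f x = w"
    then have "f = (\<lambda>_. w)" by auto
    then show False using pole not_is_pole_const[of w b] by simp
  qed
  ultimately have "{z. f z = w} sparse_in UNIV" by (simp add: eventually_cosparse)
  then have "{z. f z = w} sparse_in cball 0 r" by (rule sparse_in_subset) auto
  from sparse_in_compact_finite[OF this] have "finite (cball 0 r \<inter> {z. f z = w})" by simp
  then show ?thesis by (rule finite_subset[rotated]) auto
qed

text \<open>Continuing a branch from w to b inside the disk matches each preimage of w with a
  preimage of b, injectively by uniqueness of branches. The omitted value b bounds the growth of the
  modulus under this matching.\<close>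

lemma card_fiber_le:
  assumes f: "merom_plane f" and pole: "is_pole f b" and R: "R > 0" and sing: "ball b R \<inter> sing_inv f = {}"
    and w: "w \<in> ball b (R/2)" and r: "r \<ge> 1"
  shows "card {a. a \<notin> poles f \<and> f a = w \<and> norm a \<le> r} \<le>
    card {z. z \<notin> poles f \<and> f z = b \<and> norm z \<le> (norm b + exp (12 * pi) * (1 + norm b)) * r}"
proof -
  let ?A = "{a. a \<notin> poles f \<and> f a = w \<and> norm a \<le> r}" and ?K = "exp (12 * pi)"
  have wR: "w \<in> ball b R" using w R by auto
  have "\<exists>\<psi>. inverse_branch f (ball b R) \<psi> \<and> \<psi> w = a" if "a \<in> ?A" for a
    using inverse_branch_exists[OF f open_ball convex_ball sing wR, of a] that by blast
  then obtain \<psi> where \<psi>: "\<And>a. a \<in> ?A \<Longrightarrow> inverse_branch f (ball b R) (\<psi> a) \<and> \<psi> a w = a" by metis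
  have bR: "b \<in> ball b R" using R by simp
  have "inj_on (\<lambda>a. \<psi> a b) ?A"
  proof (rule inj_onI)
    fix a a' assume a: "a \<in> ?A" "a' \<in> ?A" "\<psi> a b = \<psi> a' b"
    have "\<psi> a w = \<psi> a' w"
      by (rule inverse_branch_unique[OF f open_ball connected_ball bR]) (use \<psi> a wR in auto)
    then show "a = a'" using \<psi> a by metis
  qed
  moreover have "(\<lambda>a. \<psi> a b) ` ?A \<subseteq> {z. z \<notin> poles f \<and> f z = b \<and> norm z \<le> (norm b + ?K * (1 + norm b)) * r}"
  proof
    fix z assume "z \<in> (\<lambda>a. \<psi> a b) ` ?A"
    then obtain a where a: "a \<in> ?A" "z = \<psi> a b" by blast
    have br: "inverse_branch f (ball b R) (\<psi> a)" "\<psi> a w = a" using \<psi>[OF a(1)] by auto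
    have zz: "z \<notin> poles f" "f z = b" using br(1) bR a(2) by (auto simp: inverse_branch_def)
    have "norm (z - b) \<le> ?K * norm (a - b)"
      using inverse_branch_comparable(2)[OF br(1) pole R w] br(2) a(2) by simp
    also have "\<dots> \<le> ?K * (r + norm b)" using a(1) norm_triangle_ineq4[of a b] by (intro mult_left_mono) auto
    also have "\<dots> \<le> ?K * (r + norm b * r)"
      using r by (intro mult_left_mono add_left_mono) (auto simp: mult_le_cancel_left1)
    finally have "norm (z - b) \<le> ?K * (1 + norm b) * r" by (simp add: algebra_simps)
    moreover have "norm b \<le> norm b * r" using r by (simp add: mult_le_cancel_left1)
    moreover have "norm z \<le> norm (z - b) + norm b" using norm_triangle_sub[of z b] by simp
    ultimately have "norm z \<le> (norm b + ?K * (1 + norm b)) * r" by (simp add: algebra_simps)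
    then show "z \<in> {z. z \<notin> poles f \<and> f z = b \<and> norm z \<le> (norm b + ?K * (1 + norm b)) * r}" using zz by auto
  qed
  moreover have "finite {z. z \<notin> poles f \<and> f z = b \<and> norm z \<le> (norm b + ?K * (1 + norm b)) * r}"
    by (rule finite_subset[OF _ finite_fiber_cball[OF f pole, of b "(norm b + ?K * (1 + norm b)) * r"]]) auto
  ultimately show ?thesis by (rule card_inj_on_le)
qed

text \<open>If all finite sums stayed below B, then, since every preimage of modulus at most r
  contributes at least r^(-u), there would be at most B * r^u of them beyond M. Transferred to a
  circle of values, this count would force the order to be at most u.\<close>

lemma fiber_sum_unbounded:
  assumes f: "merom_plane f" and pole: "is_pole f b" and R: "R > 0" and sing: "ball b R \<inter> sing_inv f = {}"
    and order: "merom_order f = ereal \<rho>" and u: "0 < u" "u < \<rho>" and M: "0 < M"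
  obtains I where "finite I" "I \<subseteq> {z. z \<notin> poles f \<and> f z = b \<and> M \<le> norm z}"
    "B \<le> (\<Sum>z\<in>I. norm z powr (- u))"
proof (rule ccontr)
  assume "\<not> thesis"
  then have less: "(\<Sum>z\<in>I. norm z powr (- u)) < B"
    if "finite I" "I \<subseteq> {z. z \<notin> poles f \<and> f z = b \<and> M \<le> norm z}" for I
    using that \<open>\<And>I. \<lbrakk>finite I; I \<subseteq> {z. z \<notin> poles f \<and> f z = b \<and> M \<le> norm z}; B \<le> (\<Sum>z\<in>I. norm z powr (- u))\<rbrakk> \<Longrightarrow> thesis\<close>
    by (meson not_less)
  have B: "0 < B" using less[of "{}"] by simp
  define Z where "Z r = {z. z \<notin> poles f \<and> f z = b \<and> norm z \<le> r}" for r
  have finZ: "finite (Z r)" for r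
    unfolding Z_def by (rule finite_subset[OF _ finite_fiber_cball[OF f pole, of b r]]) auto
  define n0 where "n0 = real (card (Z M))"
  have cardZ: "real (card (Z r)) \<le> n0 + B * r powr u" if "0 < r" for r
  proof -
    let ?Y = "{z \<in> Z r. M \<le> norm z}"
    have finY: "finite ?Y" using finZ[of r] by simp
    have "real (card ?Y) * r powr (- u) \<le> (\<Sum>z\<in>?Y. norm z powr (- u))"
    proof -
      have "(\<Sum>z\<in>?Y. r powr (- u)) \<le> (\<Sum>z\<in>?Y. norm z powr (- u))"
        using u M by (intro sum_mono powr_mono2') (auto simp: Z_def)
      then show ?thesis by simp
    qed
    also have "\<dots> < B" by (rule less[OF finY]) (auto simp: Z_def)
    finally have "real (card ?Y) \<le> B * r powr u"
      using that by (simp add: powr_minus_divide divide_less_eq mult.commute)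
    moreover have "card (Z r) \<le> card (Z M) + card ?Y"
    proof -
      have "Z r \<subseteq> Z M \<union> ?Y"
        by (auto simp: Z_def)
      then have "card (Z r) \<le> card (Z M \<union> ?Y)" using finZ finY by (intro card_mono) auto
      also have "\<dots> \<le> card (Z M) + card ?Y" by (rule card_Un_le)
      finally show ?thesis .
    qed
    ultimately show ?thesis unfolding n0_def by linarith
  qed
  define K3 where "K3 = norm b + exp (12 * pi) * (1 + norm b)"
  have K3: "0 < K3" unfolding K3_def by (intro add_nonneg_pos mult_pos_pos add_pos_nonneg) auto
  \<comment> \<open>Two candidate radii below R/2; at most one of the circles passes through
    \<open>f 0\<close>, and Jensen's formula needs the other.\<close>
  define s where "s = (if dist b (f 0) = R/4 then R/3 else R/4)"
  have s: "0 < s" "s < R/2" "dist b (f 0) \<noteq> s" using R by (auto simp: s_def)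
  define D where "D = n0 + B * K3 powr u"
  have "merom_order f \<le> ereal u"
  proof (rule merom_order_le[OF f s(1), where D=D and b=b])
    show "f 0 \<notin> sphere b s" using s(3) by simp
    show "deriv f z \<noteq> 0" if "z \<notin> poles f" "f z \<in> sphere b s" for z
    proof
      assume "deriv f z = 0"
      then have "f z \<in> sing_inv f" using that by (auto simp: sing_inv_def critical_values_def)
      moreover have "f z \<in> ball b R" using that s R by simp
      ultimately show False using sing by blast
    qed
    show "0 < D" unfolding D_def using B K3 by (intro add_nonneg_pos) (auto simp: n0_def)
    show "0 < u" by fact
    fix w r assume w: "w \<in> sphere b s" and r: "(1::real) \<le> r"
    have "real (card {a. a \<notin> poles f \<and> f a = w \<and> norm a \<le> r}) \<le> real (card (Z (K3 * r)))"
      using card_fiber_le[OF f pole R sing _ r, of w] w s(2) unfolding Z_def K3_def by simp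
    also have "\<dots> \<le> n0 + B * (K3 * r) powr u" using K3 r by (intro cardZ) simp
    also have "\<dots> \<le> n0 * r powr u + B * (K3 powr u * r powr u)"
    proof -
      have "1 \<le> r powr u" using r u by (simp add: ge_one_powr_ge_zero)
      then have "n0 * 1 \<le> n0 * r powr u" by (intro mult_left_mono) (auto simp: n0_def)
      then show ?thesis using K3 r by (simp add: powr_mult)
    qed
    finally show "real (card {a. a \<notin> poles f \<and> f a = w \<and> norm a \<le> r}) \<le> D * r powr u"
      by (simp add: D_def algebra_simps)
  qed
  then show False using order u by simp
qed

section \<open>The dimension of the radial Julia set\<close>

context nonaut_ifs
begin

text \<open>The iterate F^(2n) inverts \<open>comp\<close>, so it sends \<open>pt \<omega> 0\<close>
  to \<open>pt \<omega> n\<close>, which lies within s/4 of b. The disk of radius s/2 about it is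
  inside the common domain, and \<open>comp\<close> is the univalent pullback. For the Julia set,
  the points \<open>comp \<omega> 0 n b\<close> tend to \<open>pt \<omega> 0\<close> and have an
  undefined iterate of index 2n + 1.\<close>

lemma pt_in_radial_julia_set:
  assumes pole: "is_pole f b"
    and step: "\<And>n i x. i \<in> I \<Longrightarrow> x \<in> ball b (2 * s) \<Longrightarrow> \<Phi> n i x \<notin> poles f \<and>
       lam (2 * n) * f (\<Phi> n i x) + c (2 * n) \<notin> poles f \<and>
       lam (2 * n + 1) * f (lam (2 * n) * f (\<Phi> n i x) + c (2 * n)) + c (2 * n + 1) = x"
    and \<omega>: "range \<omega> \<subseteq> I"
  shows "pt \<omega> 0 \<in> radial_julia_set f lam c"
proof -
  let ?B = "ball b (2 * s)"
  have \<omega>i: "\<omega> k \<in> I" for k using \<omega> by auto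
  have small: "ball b (s/4) \<subseteq> ?B" using s by auto
  have \<Phi>B: "\<Phi> n (\<omega> k) x \<in> ?B" if "x \<in> ?B" for n k x using img[OF \<omega>i that] small by blast
  have fwd: "nonaut f lam c (2 * n) (comp \<omega> 0 n x) = x \<and> iter_defined f lam c (2 * n) (comp \<omega> 0 n x)"
    if "x \<in> ?B" for n x using that
  proof (induction n arbitrary: x)
    case 0 then show ?case by (simp add: iter_defined_def)
  next
    case (Suc n)
    let ?y = "\<Phi> n (\<omega> n) x" and ?z = "comp \<omega> 0 n (\<Phi> n (\<omega> n) x)"
    have IH: "nonaut f lam c (2 * n) ?z = ?y" "iter_defined f lam c (2 * n) ?z"
      using Suc.IH[OF \<Phi>B[OF Suc.prems]] by auto
    note st = step[OF \<omega>i Suc.prems, of n n]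
    have 1: "nonaut f lam c (Suc (2 * n)) ?z = lam (2 * n) * f ?y + c (2 * n)" using IH by simp
    have 2: "nonaut f lam c (Suc (Suc (2 * n))) ?z = x"
      using st IH(1) by simp
    have "iter_defined f lam c (Suc (Suc (2 * n))) ?z"
      unfolding iter_defined_def
    proof (intro allI impI)
      fix k assume "k < Suc (Suc (2 * n))"
      then consider "k < 2 * n" | "k = 2 * n" | "k = Suc (2 * n)" by linarith
      then show "nonaut f lam c k ?z \<notin> poles f"
      proof cases
        case 1 then show ?thesis using IH(2) by (simp add: iter_defined_def)
      next
        case 2 then show ?thesis using IH(1) st by simp
      next
        case 3 then show ?thesis using IH(1) st by simp
      qed
    qed
    then show ?case using 2 by simp
  qed
  have comp_hol: "comp \<omega> 0 n holomorphic_on ?B" for n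
  proof (induction n)
    case 0
    have "comp \<omega> 0 0 = (\<lambda>x. x)" by auto
    then show ?case by (simp add: holomorphic_on_ident)
  next
    case (Suc n)
    have "comp \<omega> 0 (Suc n) = comp \<omega> 0 n \<circ> \<Phi> n (\<omega> n)" by auto
    moreover have "\<Phi> n (\<omega> n) ` ?B \<subseteq> ?B" using \<Phi>B by blast
    ultimately show ?case using holomorphic_on_compose_gen[OF hol[OF \<omega>i] Suc.IH] by (simp only:)
  qed
  have ptB: "pt \<omega> n \<in> ?B" for n using pt_ball[OF \<omega>] small by blast
  have idef: "iter_defined f lam c n (pt \<omega> 0)" for n
  proof -
    have "iter_defined f lam c (2 * n) (pt \<omega> 0)" using fwd[OF ptB, of n n] pt_0[OF \<omega>, of n] by simp
    then show ?thesis by (auto simp: iter_defined_def)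
  qed
  have julia: "pt \<omega> 0 \<in> julia_set f lam c"
    unfolding julia_set_def
  proof (intro ComplI notI)
    assume "pt \<omega> 0 \<in> {z. \<exists>U. open U \<and> z \<in> U \<and> (\<forall>n. \<forall>w\<in>U. iter_defined f lam c n w) \<and> normal_family U (nonaut f lam c)}"
    then obtain U where U: "open U" "pt \<omega> 0 \<in> U" "\<And>n w. w \<in> U \<Longrightarrow> iter_defined f lam c n w" by blast
    obtain e where e: "e > 0" "ball (pt \<omega> 0) e \<subseteq> U" using U(1,2) open_contains_ball by blast
    obtain n where n: "s * (1/2) ^ n < e"
    proof -
      have "(\<lambda>n. s * (1/2) ^ n) \<longlonglongrightarrow> s * 0" by (intro tendsto_intros LIMSEQ_realpow_zero) auto
      then have "eventually (\<lambda>n. s * (1/2) ^ n < e) sequentially" using e(1) by (intro order_tendstoD) auto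
      then show ?thesis using that by (auto simp: eventually_sequentially)
    qed
    have bs: "b \<in> cball b s" "b \<in> ?B" using s by auto
    have "dist (comp \<omega> 0 n (pt \<omega> n)) (comp \<omega> 0 n b) \<le> dist (pt \<omega> n) b / 2 ^ n"
      by (rule comp_contraction[OF \<omega> pt_cball[OF \<omega>] bs(1)])
    also have "\<dots> \<le> s / 2 ^ n" using pt_cball[OF \<omega>, of n] by (intro divide_right_mono) (auto simp: dist_commute)
    also have "\<dots> = s * (1/2) ^ n" by (simp add: power_one_over)
    finally have "comp \<omega> 0 n b \<in> ball (pt \<omega> 0) e" using n pt_0[OF \<omega>, of n] by simp
    then have "iter_defined f lam c (Suc (2 * n)) (comp \<omega> 0 n b)" using U(3) e(2) by blast
    then have "nonaut f lam c (2 * n) (comp \<omega> 0 n b) \<notin> poles f" by (simp add: iter_defined_def)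
    then show False using fwd[OF bs(2), of n] pole by (simp add: poles_def)
  qed
  have "2 * n \<in> {n. \<exists>V. open V \<and> pt \<omega> 0 \<in> V \<and> (\<forall>w\<in>V. iter_defined f lam c n w) \<and>
          inj_on (nonaut f lam c n) V \<and> nonaut f lam c n ` V = ball (nonaut f lam c n (pt \<omega> 0)) (s/2)}" for n
  proof -
    let ?W = "ball (pt \<omega> n) (s/2)"
    have W: "?W \<subseteq> ?B"
    proof
      fix x assume "x \<in> ?W"
      then show "x \<in> ?B" using pt_ball[OF \<omega>, of n] dist_triangle[of b x "pt \<omega> n"] s by auto
    qed
    have nb: "nonaut f lam c (2 * n) (comp \<omega> 0 n x) = x" "iter_defined f lam c (2 * n) (comp \<omega> 0 n x)" if "x \<in> ?W" for x
      using fwd W that by blast+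
    have injc: "inj_on (comp \<omega> 0 n) ?W" using nb(1) by (metis inj_onI)
    let ?V = "comp \<omega> 0 n ` ?W"
    have "open ?V"
      by (rule open_mapping_thm3[OF holomorphic_on_subset[OF comp_hol W] open_ball injc])
    moreover have "pt \<omega> 0 \<in> ?V"
      unfolding pt_0[OF \<omega>, of n] using s by (intro imageI) simp
    moreover have "\<forall>w\<in>?V. iter_defined f lam c (2 * n) w" using nb(2) by blast
    moreover have "inj_on (nonaut f lam c (2 * n)) ?V"
      by (rule inj_onI) (use nb(1) in auto)
    moreover have "nonaut f lam c (2 * n) ` ?V = ball (nonaut f lam c (2 * n) (pt \<omega> 0)) (s/2)"
    proof -
      have "nonaut f lam c (2 * n) ` ?V = (\<lambda>x. x) ` ?W"
        unfolding image_image using nb(1) by (intro image_cong) auto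
      moreover have "nonaut f lam c (2 * n) (pt \<omega> 0) = pt \<omega> n"
        using nb(1)[of "pt \<omega> n"] s pt_0[OF \<omega>, of n] by simp
      ultimately show ?thesis by simp
    qed
    ultimately show ?thesis by blast
  qed
  then have sub: "range (\<lambda>n::nat. 2 * n) \<subseteq> {n. \<exists>V. open V \<and> pt \<omega> 0 \<in> V \<and> (\<forall>w\<in>V. iter_defined f lam c n w) \<and>
          inj_on (nonaut f lam c n) V \<and> nonaut f lam c n ` V = ball (nonaut f lam c n (pt \<omega> 0)) (s/2)}"
    by blast
  have "infinite (range (\<lambda>n::nat. 2 * n))" by (rule range_inj_infinite) (auto intro: injI)
  then have "infinite {n. \<exists>V. open V \<and> pt \<omega> 0 \<in> V \<and> (\<forall>w\<in>V. iter_defined f lam c n w) \<and>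
          inj_on (nonaut f lam c n) V \<and> nonaut f lam c n ` V = ball (nonaut f lam c n (pt \<omega> 0)) (s/2)}"
    using sub finite_subset by blast
  then show ?thesis unfolding radial_julia_set_def using julia idef s
    by (intro CollectI conjI allI exI[of _ "s/2"]) auto
qed

end

text \<open>The deviation from b splits into three parts bounded by 3/2 * R/4, 3/2 * R/48 and R/32,
  with sum 7/16 * R. The radius R/8 and both smallness conditions are chosen for this.\<close>

lemma perturbed_point_in_ball:
  fixes x b c l :: complex
  assumes R: "R > 0" and x: "x \<in> ball b (2 * (R / 8))" and l: "inverse l \<in> ball 1 \<delta>" and c: "norm c < \<epsilon>"
    and \<delta>: "\<delta> \<le> 1/2" "\<delta> * (norm b + 1) \<le> R / 32" and \<epsilon>: "\<epsilon> \<le> R / 48"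
  shows "(x - c) / l \<in> ball b (R / 2)"
proof -
  have d: "norm (inverse l - 1) < \<delta>" using l by (simp add: dist_norm norm_minus_commute)
  have il: "norm (inverse l) \<le> 3/2" using norm_triangle_sub[of "inverse l" 1] d \<delta>(1) by simp
  have eq: "(x - c) / l - b = inverse l * (x - b) - inverse l * c + (inverse l - 1) * b"
    by (simp add: divide_inverse algebra_simps)
  have 1: "norm (inverse l * (x - b)) \<le> 3/2 * (R / 4)"
    unfolding norm_mult using il x R by (intro mult_mono) (auto simp: dist_norm norm_minus_commute)
  have 2: "norm (inverse l * c) \<le> 3/2 * (R / 48)"
    unfolding norm_mult using il c \<epsilon> by (intro mult_mono) auto
  have "norm ((inverse l - 1) * b) \<le> \<delta> * norm b" unfolding norm_mult using d by (intro mult_right_mono) auto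
  also have "\<dots> \<le> \<delta> * (norm b + 1)" using d norm_ge_zero[of "inverse l - 1"] by (intro mult_left_mono) linarith+
  finally have 3: "norm ((inverse l - 1) * b) \<le> R / 32" using \<delta>(2) by linarith
  have "norm ((x - c) / l - b) \<le> norm (inverse l * (x - b)) + norm (inverse l * c) + norm ((inverse l - 1) * b)"
    unfolding eq using norm_triangle_ineq[of "inverse l * (x - b) - inverse l * c" "(inverse l - 1) * b"]
      norm_triangle_ineq4[of "inverse l * (x - b)" "inverse l * c"] by linarith
  then have "norm ((x - c) / l - b) < R / 2" using 1 2 3 R by linarith
  then show ?thesis by (simp add: dist_norm norm_minus_commute)
qed

theorem theorem4p1:
  fixes f0 :: "complex \<Rightarrow> complex" and \<rho> :: real and b :: complex and q :: nat
    and s0 Q \<alpha> :: real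
  assumes merom: "merom_plane f0"
    and order: "merom_order f0 = ereal \<rho>"
    and M1_pole: "is_pole f0 b"
    and M1_sing: "b \<notin> closure (sing_inv f0)"
    and M1_mult: "zorder f0 b = - int q"
    and M2_s0: "s0 > 0" and M2_Q: "Q > 0"
    and M2_alpha: "\<alpha> > -1 - 1 / real q"
    and M2_bound: "\<exists>R. \<forall>z. norm z > R \<and> z \<notin> poles f0 \<and> f0 z \<in> ball b s0 \<longrightarrow>
                       norm (deriv f0 z) \<le> Q * norm z powr \<alpha>"
  shows "\<exists>\<epsilon>>0. \<exists>\<delta>>0. \<forall>lam c :: nat \<Rightarrow> complex.
           (\<forall>n. lam n \<in> ball 1 \<delta> \<and> inverse (lam n) \<in> ball 1 \<delta> \<and> norm (c n) < \<epsilon>) \<longrightarrow>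
           hausdorff_dim (radial_julia_set f0 lam c) \<ge> ereal (\<rho> / (\<alpha> + 1 + 1 / real q))"
proof -
  obtain R' where R': "R' > 0" "ball b R' \<subseteq> - closure (sing_inv f0)"
    using M1_sing open_contains_ball[of "- closure (sing_inv f0)"] by auto
  define R where "R = min R' s0"
  have R: "R > 0" "R \<le> s0" using R'(1) M2_s0 by (auto simp: R_def)
  have sing: "ball b R \<inter> sing_inv f0 = {}"
  proof -
    have "ball b R \<subseteq> ball b R'" by (auto simp: R_def)
    then show ?thesis using R'(2) closure_subset[of "sing_inv f0"] by blast
  qed
  obtain R1 where R1: "\<forall>z. norm z > R1 \<and> z \<notin> poles f0 \<and> f0 z \<in> ball b s0 \<longrightarrow>
                       norm (deriv f0 z) \<le> Q * norm z powr \<alpha>" using M2_bound by (elim exE)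
  have bound: "norm (deriv f0 x) \<le> Q * norm x powr \<alpha>"
    if "norm x > R1" "x \<notin> poles f0" "f0 x \<in> ball b R" for x
    using R1 that R(2) by auto
  obtain K e \<kappa> L where q: "0 < q" and e: "0 < e" and \<kappa>: "0 < \<kappa>" and L: "0 < L"
    and K: "K holomorphic_on ball 0 e"
    "\<forall>u\<in>ball 0 e. \<kappa> \<le> norm (deriv K u) \<and> norm (K u - b) \<le> L * norm u"
    "\<forall>u\<in>ball 0 e - {0}. K u \<notin> poles f0 \<and> f0 (K u) = 1 / u ^ q"
    by (rule pole_normal_form[OF merom M1_pole M1_mult])
  define s where "s = R / 8"
  have s: "s > 0" using R by (simp add: s_def)
  \<comment> \<open>The bounds 1 for |c n| and 1/2 for |1 / lam n - 1| are those of
    \<open>two_step_inverse_map\<close>; the other two serve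
    \<open>perturbed_point_in_ball\<close>.\<close>
  define \<epsilon> where "\<epsilon> = min 1 (R / 48)"
  define \<delta> where "\<delta> = min (1/2) (R / (32 * (norm b + 1)))"
  have np: "0 < norm b + 1" by (simp add: add_nonneg_pos)
  have \<epsilon>: "\<epsilon> > 0" "\<epsilon> \<le> 1" "\<epsilon> \<le> R / 48" using R by (auto simp: \<epsilon>_def)
  have \<delta>: "\<delta> > 0" "\<delta> \<le> 1/2" unfolding \<delta>_def using R np by (simp, intro min.cobounded1)
  have \<delta>': "\<delta> * (norm b + 1) \<le> R / 32"
  proof -
    have "\<delta> \<le> R / (32 * (norm b + 1))" unfolding \<delta>_def by (rule min.cobounded2)
    then have "\<delta> \<le> R / 32 / (norm b + 1)" by (simp only: divide_divide_eq_left)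
    then show ?thesis using np by (simp only: pos_le_divide_eq)
  qed
  define K1 where "K1 = 4 * exp (12 * pi)"
  have K1: "K1 > 0" by (simp add: K1_def)
  define e' where "e' = min e (s / (4 * L))"
  have e': "0 < e'" "e' \<le> e" using e s L by (auto simp: e'_def)
  have e'': "L * e' \<le> s / 4"
  proof -
    have "L * e' \<le> L * (s / (4 * L))" using L by (intro mult_left_mono) (auto simp: e'_def)
    then show ?thesis using L by simp
  qed
  \<comment> \<open>Majorises all four thresholds on |z| in \<open>two_step_inverse_map\<close> at
    once. The absolute value allows for negative R1, and the final 1 makes the inequalities
    strict.\<close>
  define M where "M = K1 * norm b + 2 * K1 + K1 * \<bar>R1\<bar> + 4 * K1 * e' powr (- real q) + 1"
  have terms: "0 \<le> K1 * norm b" "0 \<le> K1 * \<bar>R1\<bar>" "0 \<le> 4 * K1 * e' powr (- real q)" "K1 * R1 \<le> K1 * \<bar>R1\<bar>"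
    using K1 by auto
  have M: "M > 0" unfolding M_def using terms K1 by linarith
  define \<tau> where "\<tau> = \<alpha> + 1 + 1 / real q"
  have \<tau>: "\<tau> > 0" using M2_alpha by (simp add: \<tau>_def)
  \<comment> \<open>This constant depends neither on z and n nor on the perturbations, so the
    weights a are the same at every time.\<close>
  define a0 where "a0 = \<kappa> / (4 * real q * Q * (4 * K1) powr (1 + 1 / real q) * K1 powr \<bar>\<alpha>\<bar>)"
  have a0: "a0 > 0" unfolding a0_def using \<kappa> q M2_Q K1 by simp
  define Z where "Z = {z. z \<notin> poles f0 \<and> f0 z = b \<and> M \<le> norm z}"
  have bR: "b \<in> ball b R" using R by simp
  have "\<forall>z\<in>Z. \<exists>\<phi>. inverse_branch f0 (ball b R) \<phi> \<and> \<phi> b = z"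
  proof
    fix z assume "z \<in> Z"
    then show "\<exists>\<phi>. inverse_branch f0 (ball b R) \<phi> \<and> \<phi> b = z"
      using inverse_branch_exists[OF merom open_ball convex_ball sing bR, of z] by (auto simp: Z_def)
  qed
  from bchoice[OF this] obtain \<phi> where \<phi>: "\<forall>z\<in>Z. inverse_branch f0 (ball b R) (\<phi> z) \<and> \<phi> z b = z" by (elim exE)
  have dim: "hausdorff_dim (radial_julia_set f0 lam c) \<ge> ereal (\<rho> / \<tau>)"
    if lc: "\<forall>n. lam n \<in> ball 1 \<delta> \<and> inverse (lam n) \<in> ball 1 \<delta> \<and> norm (c n) < \<epsilon>" for lam c :: "nat \<Rightarrow> complex"
  proof -
    define P where "P n z \<Phi> \<longleftrightarrow> \<Phi> holomorphic_on ball b (2 * s) \<and>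
      (\<forall>x\<in>ball b (2 * s). \<Phi> x \<in> ball b (s / 4) \<and> \<Phi> x \<notin> poles f0 \<and> lam (2*n) * f0 (\<Phi> x) + c (2*n) \<notin> poles f0 \<and>
       lam (2*n) * f0 (\<Phi> x) + c (2*n) = \<phi> z ((x - c (2*n+1)) / lam (2*n+1)) \<and>
       lam (2*n+1) * f0 (lam (2*n) * f0 (\<Phi> x) + c (2*n)) + c (2*n+1) = x \<and>
       a0 * norm z powr (- \<tau>) \<le> norm (deriv \<Phi> x))" for n :: nat and z :: complex and \<Phi> :: "complex \<Rightarrow> complex"
    have pert: "(x - c n) / lam n \<in> ball b (R/2)" if "x \<in> ball b (2 * s)" for n x
      by (rule perturbed_point_in_ball[OF R(1) _ _ _ \<delta>(2) \<delta>' \<epsilon>(3)]) (use that lc in \<open>auto simp: s_def\<close>)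
    have half: "inverse (lam n) \<in> ball 1 (1/2)" for n
    proof -
      have "dist 1 (inverse (lam n)) < \<delta>" using lc by simp
      then show ?thesis using \<delta>(2) by simp
    qed
    have c1: "norm (c n) < 1" for n using lc \<epsilon>(2) by (meson less_le_trans)
    have "\<exists>\<Phi>. P n z \<Phi>" if z: "z \<in> Z" for n z
    proof -
      have zM: "M \<le> norm z" using z by (simp add: Z_def)
      have br: "inverse_branch f0 (ball b R) (\<phi> z)" "\<phi> z b = z" using \<phi> z by auto
      have zs: "K1 * norm b \<le> norm z" "2 * K1 \<le> norm z" "K1 * R1 < norm z"
        "4 * K1 * e' powr (- real q) < norm z"
        using zM terms K1 unfolding M_def by linarith+
      obtain \<Phi> where "\<Phi> holomorphic_on ball b (2 * s)"
        "\<forall>x\<in>ball b (2 * s). \<Phi> x \<in> ball b (s / 4) \<and> \<Phi> x \<notin> poles f0 \<and> lam (2*n) * f0 (\<Phi> x) + c (2*n) \<notin> poles f0 \<and>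
           lam (2*n) * f0 (\<Phi> x) + c (2*n) = \<phi> z ((x - c (2*n+1)) / lam (2*n+1)) \<and>
           lam (2*n+1) * f0 (lam (2*n) * f0 (\<Phi> x) + c (2*n)) + c (2*n+1) = x \<and>
           \<kappa> / (4 * real q * Q * (4 * K1) powr (1 + 1 / real q) * K1 powr \<bar>\<alpha>\<bar>)
             * norm z powr (- (\<alpha> + 1 + 1 / real q)) \<le> norm (deriv \<Phi> x)"
        by (rule two_step_inverse_map[OF merom M1_pole br R(1) q e \<kappa> L K s M2_Q bound half half c1 pert K1_def e' e'' zs])
      then have "P n z \<Phi>" unfolding P_def a0_def \<tau>_def by (intro conjI)
      then show ?thesis by (rule exI[of _ \<Phi>])
    qed
    then have SP: "P n z (SOME \<Phi>. P n z \<Phi>)" if "z \<in> Z" for n z using that by (metis someI_ex)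
    define \<Phi> where "\<Phi> n z = (SOME \<Phi>. P n z \<Phi>)" for n z
    have \<Phi>: "P n z (\<Phi> n z)" if "z \<in> Z" for n z unfolding \<Phi>_def by (rule SP[OF that])
    have hol: "\<Phi> n z holomorphic_on ball b (2 * s)" if "z \<in> Z" for n z
      using \<Phi>[OF that] unfolding P_def by blast
    have props: "\<Phi> n z x \<in> ball b (s / 4)" "\<Phi> n z x \<notin> poles f0"
       "lam (2*n) * f0 (\<Phi> n z x) + c (2*n) \<notin> poles f0"
       "lam (2*n) * f0 (\<Phi> n z x) + c (2*n) = \<phi> z ((x - c (2*n+1)) / lam (2*n+1))"
       "lam (2*n+1) * f0 (lam (2*n) * f0 (\<Phi> n z x) + c (2*n)) + c (2*n+1) = x"
       "a0 * norm z powr (- \<tau>) \<le> norm (deriv (\<Phi> n z) x)"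
      if "z \<in> Z" "x \<in> ball b (2 * s)" for n z x
      using \<Phi>[OF that(1), of n] that(2) unfolding P_def by blast+
    \<comment> \<open>The dimension is an infimum over exponents t > 0 of measure zero, so it
      suffices that no such t lies below \<rho> / \<tau>. The negation also forces \<rho> >
      0.\<close>
    have "\<rho> / \<tau> \<le> t" if t: "t > 0" and zero: "hausdorff_measure t (radial_julia_set f0 lam c) = 0" for t
    proof (rule ccontr)
      assume "\<not> \<rho> / \<tau> \<le> t"
      then have u: "0 < \<tau> * t" "\<tau> * t < \<rho>" using \<tau> t by (auto simp: field_simps)
      \<comment> \<open>The target compensates in advance for the constant a0 and for the factor 1/2
        in the weights.\<close>
      obtain I where I: "finite I" "I \<subseteq> Z" "2 / (a0 / 2) powr t \<le> (\<Sum>z\<in>I. norm z powr (- (\<tau> * t)))"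
        unfolding Z_def by (rule fiber_sum_unbounded[OF merom M1_pole R(1) sing order u M])
      define a where "a z = a0 * norm z powr (- \<tau>)" for z :: complex
      have IZ: "i \<in> Z" if "i \<in> I" for i using I(2) that by blast
      interpret nonaut_ifs \<Phi> I b s a
      proof
        show "s > 0" "finite I" by fact+
        fix n i assume i: "i \<in> I"
        have "i \<noteq> 0" using IZ[OF i] M by (auto simp: Z_def)
        then show "0 < a i" using a0 by (simp add: a_def)
        show "\<Phi> n i holomorphic_on ball b (2 * s)" by (rule hol[OF IZ[OF i]])
        show "inj_on (\<Phi> n i) (ball b (2 * s))"
          by (rule inj_onI) (use props(5)[OF IZ[OF i]] in metis)
        fix x assume x: "x \<in> ball b (2 * s)"
        show "\<Phi> n i x \<in> ball b (s / 4)" by (rule props(1)[OF IZ[OF i] x])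
        show "a i \<le> norm (deriv (\<Phi> n i) x)" unfolding a_def by (rule props(6)[OF IZ[OF i] x])
        \<comment> \<open>Applying the two forward steps to the common point gives x = y, and the
          intermediate point shows that the branches of i and j share a value at the same argument.
          They therefore coincide, in particular at b, where their values are i and j.\<close>
        fix j y assume j: "j \<in> I" and y: "y \<in> ball b (2 * s)" and eq: "\<Phi> n i x = \<Phi> n j y"
        have "x = y" using props(5)[OF IZ[OF i] x, of n] props(5)[OF IZ[OF j] y, of n] eq by simp
        let ?w = "(x - c (2*n+1)) / lam (2*n+1)"
        have w: "\<phi> i ?w = \<phi> j ?w"
          using props(4)[OF IZ[OF i] x, of n] props(4)[OF IZ[OF j] y, of n] eq \<open>x = y\<close> by simp
        have wR: "?w \<in> ball b R" using pert[OF x, of "2*n+1"] R by auto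
        have br: "inverse_branch f0 (ball b R) (\<phi> i)" "inverse_branch f0 (ball b R) (\<phi> j)"
          using \<phi> IZ[OF i] IZ[OF j] by auto
        have "\<phi> i b = \<phi> j b"
          by (rule inverse_branch_unique[OF merom open_ball connected_ball wR br w bR])
        then show "i = j" using \<phi> IZ[OF i] IZ[OF j] by metis
      qed
      have "(\<Sum>i\<in>I. (a i / 2) powr t) = (\<Sum>i\<in>I. (a0 / 2) powr t * norm i powr (- (\<tau> * t)))"
      proof (rule sum.cong[OF refl])
        fix i assume "i \<in> I"
        have "(a i / 2) powr t = (a0 / 2 * norm i powr (- \<tau>)) powr t" by (simp add: a_def)
        also have "\<dots> = (a0 / 2) powr t * (norm i powr (- \<tau>)) powr t" using a0 by (subst powr_mult) auto
        finally show "(a i / 2) powr t = (a0 / 2) powr t * norm i powr (- (\<tau> * t))" by (simp add: powr_powr)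
      qed
      also have "\<dots> = (a0 / 2) powr t * (\<Sum>i\<in>I. norm i powr (- (\<tau> * t)))" by (simp add: sum_distrib_left)
      also have "\<dots> \<ge> (a0 / 2) powr t * (2 / (a0 / 2) powr t)" using I(3) by (intro mult_left_mono) auto
      also have "(a0 / 2) powr t * (2 / (a0 / 2) powr t) = 2" using a0 by simp
      finally have sum2: "(\<Sum>i\<in>I. (a i / 2) powr t) \<ge> 2" .
      have "hausdorff_measure t (radial_julia_set f0 lam c) \<noteq> 0"
      proof (rule hausdorff_measure_limit_set_nonzero[OF t sum2])
        fix \<omega> :: "nat \<Rightarrow> complex" assume \<omega>: "range \<omega> \<subseteq> I"
        show "pt \<omega> 0 \<in> radial_julia_set f0 lam c"
          by (rule pt_in_radial_julia_set[OF M1_pole _ \<omega>]) (use props(2,3,5) IZ in blast)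
      qed
      then show False using zero by contradiction
    qed
    then show ?thesis unfolding hausdorff_dim_def by (intro Inf_greatest) auto
  qed
  show ?thesis
    using \<epsilon>(1) \<delta>(1) dim unfolding \<tau>_def by blast
qed

end
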